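(* Let $T_1>0$, $T_0\in[0,T_1)$, $\alpha\in(\tfrac12,1)$, $\beta\in(0,\alpha)$. Fix $B_x,B_w>0$ and $w_0\in\mathbb R^m$. Let $\mathcal I$ be the set of pairs $(x,w)$ with $x\in\mathcal C^1([0,T_1],\mathbb R^d)$, $w\in\mathcal C^\alpha([0,T_0],\mathbb R^m)$ having the fixed initial value $w_0$ at time $0$, and $$|x_0|+\|x\|_{1;[0,T_1]}\le B_x,\qquad \|w\|_{\alpha;[0,T_0]}\le B_w .$$ Let $f:\Lambda^\alpha_\beta([0,T_1],\mathbb R^m)\to L(\mathbb R^d,\mathbb R^m)$ be a continuous non-anticipative functional such that (i) for every compact $K\subset\mathcal C^\alpha_\beta([0,T_1],\mathbb R^m)$ there is $L_K>0$ with $|f(t,u_{\cdot\wedge t})-f(t,v_{\cdot\wedge t})|\le L_K(|u_0-v_0|+\|u_{\cdot\wedge t}-v_{\cdot\wedge t}\|_{\beta;[0,T_1]})$ for all $t\in[0,T_1]$, $u,v\in K$; (ii) there is $C_f>0$ with $|f(t,u_{\cdot\wedge t})|\le C_f(1+|u_0|+\|u_{\cdot\wedge t}\|_{\beta;[0,T_1]})$ for all $(t,u_{\cdot\wedge t})\in\Lambda^\alpha_\beta([0,T_1],\mathbb R^m)$. Let $\sigma:\mathbb R\to\mathbb R$ be Lipschitz, strictly monotone, and such that $|\sigma(r)|\le C_\sigma(1+\ln(1+|r|))$ for all $r\in\mathbb R$ and some constant $C_\sigma$. Then there exist a sequence $(\boldsymbol\ell_n)_{n\ge1}\subset T(\mathbb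 R^{m+1})^{m\times d}$ and constants $c_0\in\mathbb R$, $c_1>0$ such that, for $(x,w)\in\mathcal I$, the unique solutions $y^{(n)}$ of $$y^{(n),i}_t=w^i_{T_0}+\sum_{j=1}^d\int_{T_0}^t\Big(c_1\,\sigma\big(\langle\boldsymbol\ell_n^{ij},S(\hat y^{(n)})_{0,s}\rangle\big)+c_0\Big)\mathrm dx^j_s,\ t\in[T_0,T_1],\qquad y^{(n),i}|_{[0,T_0]}=w^i,\quad i=1,\dots,m,$$ converge in the $\beta$-H\"older topology on $[0,T_1]$ to the unique solution $y$ of $$y^i_t=w^i_{T_0}+\sum_{j=1}^d\int_{T_0}^tf^{ij}(y|_{[0,s]})\,\mathrm dx^j_s,\ t\in[T_0,T_1],\qquad y^i|_{[0,T_0]}=w^i,\quad i=1,\dots,m.$$ Moreover, the convergence is uniform over $(x,w)\in\mathcal I$ (with the same $\boldsymbol\ell_n,c_0,c_1$ for all $(x,w)\in\mathcal I$).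
   Context: $\mathcal C^\gamma([0,T],\mathbb R^m)$, $\gamma\in(0,1]$, is the space of $\gamma$-H\"older paths with norm $|y_0|+\|y\|_{\gamma;[0,T]}$, $\|y\|_{\gamma;[0,T]}=\sup_{s<t}|y_t-y_s|/|t-s|^\gamma$ ($\gamma=1$: Lipschitz). $\mathcal C^\alpha_\beta$ is the set $\mathcal C^\alpha$ with the topology of the $\beta$-H\"older norm. $y_{\cdot\wedge t}$ is the path stopped at $t$; $\Lambda^\alpha_\beta([0,T],\mathbb R^m)=\{(t,y_{\cdot\wedge t}):t\in[0,T],y\in\mathcal C^\alpha([0,T],\mathbb R^m)\}$ has metric $|t-s|+|y_0-z_0|+\|y_{\cdot\wedge t}-z_{\cdot\wedge s}\|_{\beta;[0,T]}$; the element $(t,y_{\cdot\wedge t})$ is also written $y|_{[0,t]}$. A non-anticipative functional is a map on $\Lambda^\alpha_\beta$; $f^{ij}$ are its matrix entries. $T(\mathbb R^{m+1})=\bigoplus_{n\ge0}(\mathbb R^{m+1})^{\otimes n}$ (finitely many nonzero levels), $T((\mathbb R^{m+1}))=\prod_{n\ge0}(\mathbb R^{m+1})^{\otimes n}$, and $\langle\cdot,\cdot\rangle:T(\mathbb R^{m+1})\times T((\mathbb R^{m+1}))\to\mathbb R$ is the coordinatewise pairing in the canonical tensor basis. For a path $y$ in $\mathbb R^m$, $\hat y_t=(t,y_t)\in\mathbb R^{m+1}$ is the time-augmented path. The signature is $S(\hat y)_{0,t}=(1,S^{(1)},S^{(2)},\dots)$ with $S^{(n)}=\int_{0<t_1<\dots<t_n<t}\mathrm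 d\hat y_{t_1}\otimes\cdots\otimes\mathrm d\hat y_{t_n}$ (iterated Young integrals). Integrals against $x$ are Riemann–Stieltjes. Solutions are paths in $\mathcal C^\alpha([0,T_1],\mathbb R^m)$. *)

theory Defs
  imports "HOL-Analysis.Analysis"
begin

section \<open>Hoelder paths\<close>

text \<open>
  A path on \<open>[0,T]\<close> is a function on the reals that is \<open>extensional\<close> on \<open>{0..T}\<close>, so that
  equality of functions is equality of paths and the distances below are genuine metrics.
\<close>

definition holder_quotients ::
  "real \<Rightarrow> real \<Rightarrow> (real \<Rightarrow> 'a::real_normed_vector) \<Rightarrow> real set" where
  "holder_quotients \<gamma> T y =
     {norm (y t - y s) / (t - s) powr \<gamma> |s t. 0 \<le> s \<and> s < t \<and> t \<le> T}"

definition holder_paths :: "real \<Rightarrow> real \<Rightarrow> (real \<Rightarrow> 'a::real_normed_vector) set" where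
  "holder_paths \<gamma> T = {y \<in> extensional {0..T}. bdd_above (holder_quotients \<gamma> T y)}"

text \<open>
  The element \<open>0\<close> is inserted only to obtain \<open>Sup {} = 0\<close> in the degenerate case \<open>T = 0\<close>. The
  value for paths that are not Hoelder continuous is never relevant; choosing \<open>0\<close> makes the
  seminorm unconditionally nonnegative, as \<^locale>\<open>Metric_space\<close> demands of distances.
\<close>

definition holder_seminorm :: "real \<Rightarrow> real \<Rightarrow> (real \<Rightarrow> 'a::real_normed_vector) \<Rightarrow> real" where
  "holder_seminorm \<gamma> T y =
     (if bdd_above (holder_quotients \<gamma> T y) then Sup (insert 0 (holder_quotients \<gamma> T y)) else 0)"

definition holder_dist ::
  "real \<Rightarrow> real \<Rightarrow> (real \<Rightarrow> 'a::real_normed_vector) \<Rightarrow> (real \<Rightarrow> 'a) \<Rightarrow> real" where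
  "holder_dist \<beta> T y z = norm (y 0 - z 0) + holder_seminorm \<beta> T (\<lambda>t. y t - z t)"

text \<open>The set of \<open>\<alpha>\<close>-Hoelder paths with the topology of the \<open>\<beta>\<close>-Hoelder norm.\<close>

definition holder_topology ::
  "real \<Rightarrow> real \<Rightarrow> real \<Rightarrow> (real \<Rightarrow> 'a::real_normed_vector) topology" where
  "holder_topology \<alpha> \<beta> T = Metric_space.mtopology (holder_paths \<alpha> T) (holder_dist \<beta> T)"

section \<open>Stopped paths\<close>

definition stopped :: "real \<Rightarrow> real \<Rightarrow> (real \<Rightarrow> 'a) \<Rightarrow> real \<Rightarrow> 'a" where
  "stopped T t y = restrict (\<lambda>s. y (min s t)) {0..T}"

definition stopped_paths ::
  "real \<Rightarrow> real \<Rightarrow> (real \<times> (real \<Rightarrow> 'a::real_normed_vector)) set" where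
  "stopped_paths \<alpha> T = {(t, stopped T t y) |t y. t \<in> {0..T} \<and> y \<in> holder_paths \<alpha> T}"

definition stopped_dist ::
  "real \<Rightarrow> real \<Rightarrow> real \<times> (real \<Rightarrow> 'a::real_normed_vector) \<Rightarrow> real \<times> (real \<Rightarrow> 'a) \<Rightarrow> real" where
  "stopped_dist \<beta> T = (\<lambda>(t, y) (s, z). \<bar>t - s\<bar> + holder_dist \<beta> T y z)"

definition stopped_topology ::
  "real \<Rightarrow> real \<Rightarrow> real \<Rightarrow> (real \<times> (real \<Rightarrow> 'a::real_normed_vector)) topology" where
  "stopped_topology \<alpha> \<beta> T = Metric_space.mtopology (stopped_paths \<alpha> T) (stopped_dist \<beta> T)"

section \<open>Riemann--Stieltjes integrals\<close>

text \<open>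
  Limit of the Riemann--Stieltjes sums as the mesh tends to zero, uniformly in the tags. Applied to
  Hoelder functions whose exponents add up to more than \<open>1\<close>, this is the Young integral.
\<close>

definition has_rs_integral ::
  "real \<Rightarrow> real \<Rightarrow> (real \<Rightarrow> real) \<Rightarrow> (real \<Rightarrow> real) \<Rightarrow> real \<Rightarrow> bool" where
  "has_rs_integral a b f g I \<longleftrightarrow>
     (\<forall>\<epsilon>>0. \<exists>\<delta>>0. \<forall>p. p tagged_division_of {a..b} \<and> (\<forall>(\<xi>, K)\<in>p. Sup K - Inf K < \<delta>) \<longrightarrow>
        \<bar>(\<Sum>(\<xi>, K)\<in>p. f \<xi> * (g (Sup K) - g (Inf K))) - I\<bar> < \<epsilon>)"

definition rs_integrable :: "real \<Rightarrow> real \<Rightarrow> (real \<Rightarrow> real) \<Rightarrow> (real \<Rightarrow> real) \<Rightarrow> bool" where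
  "rs_integrable a b f g \<longleftrightarrow> (\<exists>I. has_rs_integral a b f g I)"

definition rs_integral :: "real \<Rightarrow> real \<Rightarrow> (real \<Rightarrow> real) \<Rightarrow> (real \<Rightarrow> real) \<Rightarrow> real" where
  "rs_integral a b f g = (THE I. has_rs_integral a b f g I)"

section \<open>Signatures\<close>

text \<open>
  The canonical basis of the \<open>n\<close>-fold tensor power of \<open>real ^ 'k\<close> is indexed by the words of length
  \<open>n\<close> over \<open>'k\<close>, so an element of the product of all tensor powers is a function \<open>'k list \<Rightarrow> real\<close>.
\<close>

definition tensor_algebra :: "('k::finite list \<Rightarrow> real) set" where
  "tensor_algebra = {a. finite {n. \<exists>v. length v = n \<and> a v \<noteq> 0}}"

definition tensor_pairing :: "('k::finite list \<Rightarrow> real) \<Rightarrow> ('k list \<Rightarrow> real) \<Rightarrow> real" where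
  "tensor_pairing a b = (\<Sum>v | a v \<noteq> 0. a v * b v)"

text \<open>
  The letter of the outermost integration variable \<open>t\<^sub>n\<close> is the last letter of the word, hence the
  recursion over the reversed word.
\<close>

fun rev_signature :: "(real \<Rightarrow> real ^ 'k::finite) \<Rightarrow> real \<Rightarrow> 'k list \<Rightarrow> real" where
  "rev_signature z t [] = 1"
| "rev_signature z t (k # v) = rs_integral 0 t (\<lambda>s. rev_signature z s v) (\<lambda>s. z s $ k)"

definition signature :: "(real \<Rightarrow> real ^ 'k::finite) \<Rightarrow> real \<Rightarrow> 'k list \<Rightarrow> real" where
  "signature z t v = rev_signature z t (rev v)"

text \<open>The index \<open>None\<close> is the time coordinate; \<open>real ^ 'm option\<close> has dimension \<open>CARD('m) + 1\<close>.\<close>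

definition time_augmented :: "(real \<Rightarrow> real ^ 'm::finite) \<Rightarrow> real \<Rightarrow> real ^ 'm option" where
  "time_augmented y t = (\<chi> k. case k of None \<Rightarrow> t | Some i \<Rightarrow> y t $ i)"

section \<open>Path-dependent controlled equations\<close>

text \<open>\<open>G s y i j\<close> is the \<open>(i,j)\<close> entry of the coefficient at time \<open>s\<close> along the path \<open>y\<close>.\<close>

definition controlled_solution ::
  "real \<Rightarrow> real \<Rightarrow> real \<Rightarrow> (real \<Rightarrow> (real \<Rightarrow> real ^ 'm) \<Rightarrow> 'm \<Rightarrow> 'd \<Rightarrow> real) \<Rightarrow>
   (real \<Rightarrow> real ^ 'd::finite) \<Rightarrow> (real \<Rightarrow> real ^ 'm::finite) \<Rightarrow> (real \<Rightarrow> real ^ 'm) \<Rightarrow> bool" where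
  "controlled_solution \<alpha> T\<^sub>0 T\<^sub>1 G x w y \<longleftrightarrow>
     y \<in> holder_paths \<alpha> T\<^sub>1 \<and>
     (\<forall>t\<in>{0..T\<^sub>0}. y t = w t) \<and>
     (\<forall>t\<in>{T\<^sub>0..T\<^sub>1}. \<forall>i.
        (\<forall>j. rs_integrable T\<^sub>0 t (\<lambda>s. G s y i j) (\<lambda>s. x s $ j)) \<and>
        y t $ i = w T\<^sub>0 $ i + (\<Sum>j\<in>UNIV. rs_integral T\<^sub>0 t (\<lambda>s. G s y i j) (\<lambda>s. x s $ j)))"

definition functional_coeff ::
  "real \<Rightarrow> (real \<times> (real \<Rightarrow> real ^ 'm) \<Rightarrow> (real ^ 'd::finite) \<Rightarrow>\<^sub>L (real ^ 'm::finite)) \<Rightarrow>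
   real \<Rightarrow> (real \<Rightarrow> real ^ 'm) \<Rightarrow> 'm \<Rightarrow> 'd \<Rightarrow> real" where
  "functional_coeff T f s y i j = blinfun_apply (f (s, stopped T s y)) (axis j 1) $ i"

definition signature_coeff ::
  "(real \<Rightarrow> real) \<Rightarrow> real \<Rightarrow> real \<Rightarrow> ('m \<Rightarrow> 'd \<Rightarrow> 'm option list \<Rightarrow> real) \<Rightarrow>
   real \<Rightarrow> (real \<Rightarrow> real ^ 'm::finite) \<Rightarrow> 'm \<Rightarrow> 'd \<Rightarrow> real" where
  "signature_coeff \<sigma> c\<^sub>0 c\<^sub>1 l s y i j =
     c\<^sub>1 * \<sigma> (tensor_pairing (l i j) (signature (time_augmented y) s)) + c\<^sub>0"

definition admissible_inputs ::
  "real \<Rightarrow> real \<Rightarrow> real \<Rightarrow> real \<Rightarrow> real \<Rightarrow> real ^ 'm::finite \<Rightarrow>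
   ((real \<Rightarrow> real ^ 'd::finite) \<times> (real \<Rightarrow> real ^ 'm)) set" where
  "admissible_inputs \<alpha> T\<^sub>0 T\<^sub>1 B\<^sub>x B\<^sub>w w\<^sub>0 =
     {(x, w). x \<in> holder_paths 1 T\<^sub>1 \<and> w \<in> holder_paths \<alpha> T\<^sub>0 \<and> w 0 = w\<^sub>0 \<and>
        norm (x 0) + holder_seminorm 1 T\<^sub>1 x \<le> B\<^sub>x \<and> holder_seminorm \<alpha> T\<^sub>0 w \<le> B\<^sub>w}"

section \<open>Well-definedness\<close>

lemma has_rs_integral_unique:
  assumes "has_rs_integral a b f g I" "has_rs_integral a b f g J"
  shows "I = J"
proof (rule ccontr)
  assume "I \<noteq> J"
  define e where "e = \<bar>I - J\<bar> / 2"
  have e: "e > 0" using \<open>I \<noteq> J\<close> by (simp add: e_def)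
  let ?S = "\<lambda>p. \<Sum>(\<xi>, K)\<in>p. f \<xi> * (g (Sup K) - g (Inf K))"
  let ?m = "\<lambda>\<delta> p. \<forall>(\<xi>, K)\<in>p. Sup K - Inf K < (\<delta>::real)"
  obtain d1 where d1: "d1 > 0"
    "\<And>p. p tagged_division_of {a..b} \<Longrightarrow> ?m d1 p \<Longrightarrow> \<bar>?S p - I\<bar> < e"
    using assms(1) e unfolding has_rs_integral_def by meson
  obtain d2 where d2: "d2 > 0"
    "\<And>p. p tagged_division_of {a..b} \<Longrightarrow> ?m d2 p \<Longrightarrow> \<bar>?S p - J\<bar> < e"
    using assms(2) e unfolding has_rs_integral_def by meson
  define d where "d = min d1 d2"
  have d: "d > 0" using d1 d2 by (simp add: d_def)
  have "gauge (\<lambda>x::real. ball x (d/2))" using d by (simp add: gauge_def)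
  then obtain p where p: "p tagged_division_of {a..b}" "(\<lambda>x. ball x (d/2)) fine p"
    using fine_division_exists_real by blast
  have m: "Sup K - Inf K < d" if mem: "(\<xi>, K) \<in> p" for \<xi> K
  proof -
    obtain u v where K: "K = {u..v}" "\<xi> \<in> K"
      using tagged_division_ofD(2)[OF p(1) mem] tagged_division_ofD(4)[OF p(1) mem] by auto
    then have uv: "u \<in> K" "v \<in> K" by auto
    have "K \<subseteq> ball \<xi> (d/2)" using p(2) mem by (auto simp: fine_def)
    then have "u \<in> ball \<xi> (d/2)" "v \<in> ball \<xi> (d/2)" using uv by blast+
    then show ?thesis using K uv by (auto simp: dist_real_def)
  qed
  have "\<bar>?S p - I\<bar> < e" "\<bar>?S p - J\<bar> < e"
    using d1(2)[OF p(1)] d2(2)[OF p(1)] m unfolding d_def by fastforce+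
  moreover have "\<bar>I - J\<bar> \<le> \<bar>?S p - I\<bar> + \<bar>?S p - J\<bar>" by argo
  moreover have "\<bar>I - J\<bar> = e + e" by (simp add: e_def)
  ultimately show False by argo
qed

lemma rs_integral_eqI: "has_rs_integral a b f g I \<Longrightarrow> rs_integral a b f g = I"
  unfolding rs_integral_def using has_rs_integral_unique by blast

lemma holder_seminorm_nonneg: "0 \<le> holder_seminorm \<gamma> T y"
  unfolding holder_seminorm_def by (auto intro!: cSup_upper)

lemma holder_seminorm_bound:
  assumes "bdd_above (holder_quotients \<gamma> T y)" "0 \<le> s" "s < t" "t \<le> T"
  shows "norm (y t - y s) \<le> holder_seminorm \<gamma> T y * (t - s) powr \<gamma>"
proof -
  have "norm (y t - y s) / (t - s) powr \<gamma> \<in> holder_quotients \<gamma> T y"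
    using assms unfolding holder_quotients_def by blast
  then have "norm (y t - y s) / (t - s) powr \<gamma> \<le> holder_seminorm \<gamma> T y"
    unfolding holder_seminorm_def using assms(1) by (auto intro!: cSup_upper)
  then show ?thesis using assms by (simp add: pos_divide_le_eq)
qed

lemma bdd_above_holder_quotientsI:
  assumes "\<And>s t. 0 \<le> s \<Longrightarrow> s < t \<Longrightarrow> t \<le> T \<Longrightarrow> norm (y t - y s) \<le> C * (t - s) powr \<gamma>"
  shows "bdd_above (holder_quotients \<gamma> T y)"
  unfolding holder_quotients_def
  by (rule bdd_aboveI[of _ C]) (auto simp: pos_divide_le_eq assms)

lemma holder_seminorm_leI:
  assumes "\<And>s t. 0 \<le> s \<Longrightarrow> s < t \<Longrightarrow> t \<le> T \<Longrightarrow> norm (y t - y s) \<le> C * (t - s) powr \<gamma>" "0 \<le> C"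
  shows "holder_seminorm \<gamma> T y \<le> C"
proof -
  have "Sup (insert 0 (holder_quotients \<gamma> T y)) \<le> C"
    by (rule cSup_least) (auto simp: holder_quotients_def pos_divide_le_eq assms)
  then show ?thesis using assms(2) unfolding holder_seminorm_def by simp
qed

lemma holder_paths_mono:
  assumes "\<beta> \<le> \<alpha>"
  shows "holder_paths \<alpha> T \<subseteq> holder_paths \<beta> T"
proof
  fix y :: "real \<Rightarrow> 'a" assume y: "y \<in> holder_paths \<alpha> T"
  have "norm (y t - y s) \<le> (holder_seminorm \<alpha> T y * T powr (\<alpha> - \<beta>)) * (t - s) powr \<beta>"
    if st: "0 \<le> s" "s < t" "t \<le> T" for s t
  proof -
    have "norm (y t - y s) \<le> holder_seminorm \<alpha> T y * (t - s) powr \<alpha>"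
      using y st holder_seminorm_bound unfolding holder_paths_def by blast
    also have "(t - s) powr \<alpha> = (t - s) powr (\<alpha> - \<beta>) * (t - s) powr \<beta>"
      using st by (simp flip: powr_add)
    also have "\<dots> \<le> T powr (\<alpha> - \<beta>) * (t - s) powr \<beta>"
      using st assms by (intro mult_right_mono powr_mono2) auto
    finally show ?thesis
      by (simp add: holder_seminorm_nonneg mult_left_mono mult.assoc)
  qed
  then have "bdd_above (holder_quotients \<beta> T y)"
    by (rule bdd_above_holder_quotientsI)
  then show "y \<in> holder_paths \<beta> T" using y by (simp add: holder_paths_def)
qed

lemma holder_quotients_diff_bound:
  assumes "y \<in> holder_paths \<beta> T" "z \<in> holder_paths \<beta> T"
  shows "bdd_above (holder_quotients \<beta> T (\<lambda>t. y t - z t))"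
proof (rule bdd_above_holder_quotientsI)
  fix s t assume st: "0 \<le> s" "s < t" "t \<le> T"
  have "norm (y t - z t - (y s - z s)) \<le> norm (y t - y s) + norm (z t - z s)"
    using norm_triangle_ineq4[of "y t - y s" "z t - z s"] by (simp add: algebra_simps)
  also have "\<dots> \<le> holder_seminorm \<beta> T y * (t - s) powr \<beta> + holder_seminorm \<beta> T z * (t - s) powr \<beta>"
    using assms st unfolding holder_paths_def by (intro add_mono holder_seminorm_bound) auto
  finally show "norm (y t - z t - (y s - z s)) \<le>
      (holder_seminorm \<beta> T y + holder_seminorm \<beta> T z) * (t - s) powr \<beta>"
    by (simp add: distrib_right)
qed

lemma Metric_space_holder:
  assumes "0 \<le> T" "\<beta> \<le> \<alpha>"
  shows "Metric_space (holder_paths \<alpha> T :: (real \<Rightarrow> 'a::real_normed_vector) set) (holder_dist \<beta> T)"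
proof
  fix y z u :: "real \<Rightarrow> 'a"
  show "0 \<le> holder_dist \<beta> T y z"
    unfolding holder_dist_def by (simp add: holder_seminorm_nonneg)
  have "norm (y t - z t - (y s - z s)) = norm (z t - y t - (z s - y s))" for s t
    using norm_minus_commute[of "y t - z t" "y s - z s"] by (simp add: algebra_simps)
  then have "holder_quotients \<beta> T (\<lambda>t. y t - z t) = holder_quotients \<beta> T (\<lambda>t. z t - y t)"
    unfolding holder_quotients_def by simp
  then show "holder_dist \<beta> T y z = holder_dist \<beta> T z y"
    unfolding holder_dist_def holder_seminorm_def by (simp add: norm_minus_commute)
  assume "y \<in> holder_paths \<alpha> T" "z \<in> holder_paths \<alpha> T"
  then have yz: "y \<in> holder_paths \<beta> T" "z \<in> holder_paths \<beta> T"
    using holder_paths_mono[OF assms(2)] by blast+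
  show "holder_dist \<beta> T y z = 0 \<longleftrightarrow> y = z"
  proof
    assume "holder_dist \<beta> T y z = 0"
    then have 0: "y 0 = z 0" "holder_seminorm \<beta> T (\<lambda>t. y t - z t) = 0"
      using holder_seminorm_nonneg[of \<beta> T "\<lambda>t. y t - z t"] norm_ge_zero[of "y 0 - z 0"]
      by (auto simp: holder_dist_def add_nonneg_eq_0_iff)
    have "y t = z t" if "t \<in> {0..T}" for t
    proof (cases "t = 0")
      case False
      then show ?thesis
        using holder_seminorm_bound[OF holder_quotients_diff_bound[OF yz], of 0 t] that 0 by simp
    qed (simp add: 0)
    then show "y = z" using yz unfolding holder_paths_def by (blast intro: extensionalityI)
  next
    assume "y = z"
    have "holder_seminorm \<beta> T (\<lambda>t. 0 :: 'a) \<le> 0" by (rule holder_seminorm_leI) auto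
    then show "holder_dist \<beta> T y z = 0"
      using \<open>y = z\<close> holder_seminorm_nonneg[of \<beta> T "\<lambda>t. 0 :: 'a"] by (simp add: holder_dist_def)
  qed
  assume "u \<in> holder_paths \<alpha> T"
  then have u: "u \<in> holder_paths \<beta> T" using holder_paths_mono[OF assms(2)] by blast
  let ?a = "holder_seminorm \<beta> T (\<lambda>t. y t - z t)" and ?b = "holder_seminorm \<beta> T (\<lambda>t. z t - u t)"
  have "holder_seminorm \<beta> T (\<lambda>t. y t - u t) \<le> ?a + ?b"
  proof (rule holder_seminorm_leI)
    fix s t assume st: "0 \<le> s" "s < t" "t \<le> T"
    have "norm (y t - u t - (y s - u s)) \<le>
        norm (y t - z t - (y s - z s)) + norm (z t - u t - (z s - u s))"
      using norm_triangle_ineq[of "y t - z t - (y s - z s)" "z t - u t - (z s - u s)"]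
      by (simp add: algebra_simps)
    also have "\<dots> \<le> ?a * (t - s) powr \<beta> + ?b * (t - s) powr \<beta>"
      using holder_seminorm_bound[OF holder_quotients_diff_bound[OF yz] st]
        holder_seminorm_bound[OF holder_quotients_diff_bound[OF yz(2) u] st] by (rule add_mono)
    finally show "norm (y t - u t - (y s - u s)) \<le> (?a + ?b) * (t - s) powr \<beta>"
      by (simp add: distrib_right)
  qed (simp add: holder_seminorm_nonneg)
  moreover have "norm (y 0 - u 0) \<le> norm (y 0 - z 0) + norm (z 0 - u 0)"
    using norm_triangle_ineq[of "y 0 - z 0" "z 0 - u 0"] by simp
  ultimately show "holder_dist \<beta> T y u \<le> holder_dist \<beta> T y z + holder_dist \<beta> T z u"
    unfolding holder_dist_def by linarith
qed

lemma stopped_in_holder_paths: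
  assumes "0 \<le> \<alpha>" "t \<in> {0..T}" "y \<in> holder_paths \<alpha> T"
  shows "stopped T t y \<in> holder_paths \<alpha> T"
proof -
  have b: "bdd_above (holder_quotients \<alpha> T y)" using assms(3) by (simp add: holder_paths_def)
  have "norm (stopped T t y r - stopped T t y s) \<le> holder_seminorm \<alpha> T y * (r - s) powr \<alpha>"
    if sr: "0 \<le> s" "s < r" "r \<le> T" for s r
  proof (cases "s < t")
    case True
    then have "norm (y (min r t) - y s) \<le> holder_seminorm \<alpha> T y * (min r t - s) powr \<alpha>"
      using sr by (intro holder_seminorm_bound[OF b]) auto
    also have "\<dots> \<le> holder_seminorm \<alpha> T y * (r - s) powr \<alpha>"
      using True sr assms(1) by (intro mult_left_mono powr_mono2) (auto simp: holder_seminorm_nonneg)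
    finally show ?thesis using sr True by (simp add: stopped_def min_def)
  next
    case False
    then show ?thesis using sr by (simp add: stopped_def min_def holder_seminorm_nonneg)
  qed
  then have "bdd_above (holder_quotients \<alpha> T (stopped T t y))"
    by (rule bdd_above_holder_quotientsI)
  then show ?thesis by (simp add: holder_paths_def) (simp add: stopped_def)
qed

lemma Metric_space_stopped:
  assumes "0 \<le> T" "\<beta> \<le> \<alpha>" "0 \<le> \<alpha>"
  shows "Metric_space (stopped_paths \<alpha> T :: (real \<times> (real \<Rightarrow> 'a::real_normed_vector)) set)
    (stopped_dist \<beta> T)"
proof -
  interpret H: Metric_space "holder_paths \<alpha> T :: (real \<Rightarrow> 'a) set" "holder_dist \<beta> T"
    using Metric_space_holder assms by blast
  have sub: "snd p \<in> holder_paths \<alpha> T" if "p \<in> stopped_paths \<alpha> T" for p :: "real \<times> (real \<Rightarrow> 'a)"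
    using that stopped_in_holder_paths[OF assms(3), where 'a = 'a]
    unfolding stopped_paths_def by force
  show ?thesis
  proof
    fix p q r :: "real \<times> (real \<Rightarrow> 'a)"
    show "0 \<le> stopped_dist \<beta> T p q" by (auto simp: stopped_dist_def split: prod.split)
    show "stopped_dist \<beta> T p q = stopped_dist \<beta> T q p"
      using H.commute by (auto simp: stopped_dist_def split: prod.split)
    assume pq: "p \<in> stopped_paths \<alpha> T" "q \<in> stopped_paths \<alpha> T"
    have "\<bar>fst p - fst q\<bar> + holder_dist \<beta> T (snd p) (snd q) = 0 \<longleftrightarrow> fst p = fst q \<and> snd p = snd q"
      using H.zero[OF sub[OF pq(1)] sub[OF pq(2)]] H.nonneg[of "snd p" "snd q"] by linarith
    then show "stopped_dist \<beta> T p q = 0 \<longleftrightarrow> p = q"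
      by (simp add: stopped_dist_def case_prod_beta prod_eq_iff)
    assume r: "r \<in> stopped_paths \<alpha> T"
    show "stopped_dist \<beta> T p r \<le> stopped_dist \<beta> T p q + stopped_dist \<beta> T q r"
      using H.triangle[OF sub[OF pq(1)] sub[OF pq(2)] sub[OF r]]
      by (simp add: stopped_dist_def case_prod_beta)
  qed
qed

end

theory Submission
  imports Defs
begin

text \<open>
  For \<open>\<alpha> > 1 / 2\<close> the Young integral \<open>F = \<integral> f dg\<close> is characterised by the local expansion
  \<open>\<bar>F t - F s - f s * (g t - g s)\<bar> \<le> C * (t - s) powr (2 * \<alpha>)\<close>, because an increment that is
  superlinearly small everywhere vanishes. The shuffle identity, integration by parts and the Lipschitz
  dependence of signatures on the path all reduce to comparing such expansions.

  Hoelder balls with a fixed starting point are compact for pointwise convergence (Tychonoff), and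
  there the pointwise and the \<open>\<beta>\<close>-Hoelder topology agree. On the compact set of stopped paths the
  linear functionals of the signature form an algebra, by the shuffle identity, and separate points,
  by moments against powers of time. Stone--Weierstrass therefore approximates
  \<open>\<sigma>\<inverse> ((f - c\<^sub>0) / c\<^sub>1)\<close>, where \<open>c\<^sub>0, c\<^sub>1\<close> are chosen such that \<open>c\<^sub>1 * \<sigma> + c\<^sub>0\<close> maps \<open>{-1..1}\<close> onto an interval
  containing the values of \<open>f\<close>.

  Once the coefficients are within distance \<open>1\<close> of \<open>f\<close> on the compact set, the growth of \<open>f\<close> bounds
  the solutions of all equations alike: truncating the coefficients at that bound does not change the
  solutions, so they stay in the compact set. Existence, uniqueness and stability follow from one
  contraction estimate in the \<open>\<beta>\<close>-Hoelder norm with weight \<open>exp (\<rho> * t)\<close>.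
\<close>

section \<open>Riemann--Stieltjes primitives\<close>

text \<open>The Young primitive arises as a limit of ordinary integrals of \<open>f\<close> against
  difference quotients of \<open>g\<close> with step \<open>T / 2 ^ k\<close>; halving the step
  costs an error that is summable because \<open>2 * \<alpha> > 1\<close>. Along a path the
  functional is merely continuous in time, so its integrals against the Lipschitz driver need a
  second construction, by polynomial approximation of the integrand. A circularity has to be broken:
  the tensors approximate well only on a compact ball, the ball must contain the solutions, and the
  solutions depend on the tensors. The growth of \<open>f\<close>, enlarged by \<open>1\<close>,
  fixes the radius before any tensor is chosen. The Lipschitz constants of the signature
  coefficients are not controlled in \<open>n\<close>. They serve existence and uniqueness for each
  \<open>n\<close> separately. The distance of the two solutions is measured by the Lipschitz
  constant of \<open>f\<close> on the ball, and the signature coefficient is evaluated only along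
  its own solution, where it differs from \<open>f\<close> by at most
  \<open>1 / real (Suc n)\<close>.\<close>

lemma powr_le_linear:
  fixes C \<theta> \<epsilon> :: real
  assumes "1 < \<theta>" "0 < \<epsilon>"
  shows "\<exists>\<delta>>0. \<forall>r. 0 \<le> r \<and> r < \<delta> \<longrightarrow> C * r powr \<theta> \<le> \<epsilon> * r"
proof -
  define c where "c = \<bar>C\<bar> + 1"
  have c: "0 < c" "C \<le> c" by (auto simp: c_def)
  define \<delta> where "\<delta> = (\<epsilon> / c) powr (1 / (\<theta> - 1))"
  have "0 < \<delta>" using assms c by (simp add: \<delta>_def)
  moreover have "C * r powr \<theta> \<le> \<epsilon> * r" if "0 \<le> r" "r < \<delta>" for r
  proof -
    have "r powr (\<theta> - 1) \<le> \<delta> powr (\<theta> - 1)" using that assms by (intro powr_mono2) auto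
    also have "\<dots> = \<epsilon> / c" using assms c by (simp add: \<delta>_def powr_powr)
    finally have *: "c * r powr (\<theta> - 1) \<le> \<epsilon>" using c by (simp add: field_simps)
    have "C * r powr \<theta> \<le> c * r powr \<theta>" using c by (intro mult_right_mono) auto
    also have "\<dots> = c * r powr (\<theta> - 1) * r"
      using that by (cases "r = 0") (auto simp: powr_diff)
    also have "\<dots> \<le> \<epsilon> * r"
      using * that by (intro mult_right_mono)
    finally show ?thesis .
  qed
  ultimately show ?thesis by blast
qed

text \<open>Along a uniform grid the terms \<open>\<Psi> t - \<Psi> s\<close> telescope and the
  errors add up to \<open>\<epsilon> * (b - a)\<close>, which vanishes with
  \<open>\<epsilon>\<close>. No derivative of \<open>F\<close> enters; in the uses below
  \<open>F\<close> may be merely Hoelder continuous.\<close>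

lemma increment_bound_infinitesimal:
  fixes F \<Psi> :: "real \<Rightarrow> real"
  assumes "a \<le> b"
    and loc: "\<And>\<epsilon>. 0 < \<epsilon> \<Longrightarrow> \<exists>\<delta>>0. \<forall>s t. a \<le> s \<and> s \<le> t \<and> t \<le> b \<and> t - s < \<delta> \<longrightarrow>
        \<bar>F t - F s\<bar> \<le> \<Psi> t - \<Psi> s + \<epsilon> * (t - s)"
  shows "\<bar>F b - F a\<bar> \<le> \<Psi> b - \<Psi> a"
proof (rule field_le_epsilon)
  fix e :: real assume e: "0 < e"
  define \<epsilon> where "\<epsilon> = e / (b - a + 1)"
  have \<epsilon>: "0 < \<epsilon>" using e assms(1) by (simp add: \<epsilon>_def)
  obtain \<delta> where \<delta>: "\<delta> > 0" "\<And>s t. a \<le> s \<Longrightarrow> s \<le> t \<Longrightarrow> t \<le> b \<Longrightarrow> t - s < \<delta> \<Longrightarrow>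
      \<bar>F t - F s\<bar> \<le> \<Psi> t - \<Psi> s + \<epsilon> * (t - s)"
    using loc[OF \<epsilon>] by blast
  obtain n :: nat where n: "(b - a) / \<delta> < real n" using reals_Archimedean2 by blast
  define h where "h = (b - a) / real (Suc n)"
  have h0: "0 \<le> h" using assms(1) by (simp add: h_def)
  have h: "h < \<delta>"
  proof -
    have "b - a < \<delta> * real n" using n \<delta>(1) by (simp add: field_simps)
    also have "\<dots> \<le> \<delta> * real (Suc n)" using \<delta>(1) by simp
    finally show ?thesis by (simp add: h_def field_simps)
  qed
  have hn: "real (Suc n) * h = b - a" by (simp add: h_def)
  have "\<bar>F (a + real i * h) - F a\<bar> \<le> \<Psi> (a + real i * h) - \<Psi> a + \<epsilon> * (real i * h)"
    if "i \<le> Suc n" for i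
    using that
  proof (induction i)
    case (Suc i)
    have "real (Suc i) * h \<le> real (Suc n) * h" using Suc.prems h0 by (intro mult_right_mono) auto
    then have "a + real (Suc i) * h \<le> b" using hn by linarith
    then have "\<bar>F (a + real (Suc i) * h) - F (a + real i * h)\<bar> \<le>
        \<Psi> (a + real (Suc i) * h) - \<Psi> (a + real i * h) + \<epsilon> * ((a + real (Suc i) * h) - (a + real i * h))"
      using h0 h by (intro \<delta>(2)) (auto simp: algebra_simps)
    moreover have "(a + real (Suc i) * h) - (a + real i * h) = h" by (simp add: algebra_simps)
    moreover have "\<epsilon> * (real (Suc i) * h) = \<epsilon> * (real i * h) + \<epsilon> * h" by (simp add: algebra_simps)
    ultimately show ?case using Suc by simp
  qed simp
  from this[of "Suc n"] have "\<bar>F b - F a\<bar> \<le> \<Psi> b - \<Psi> a + \<epsilon> * (b - a)" unfolding hn by simp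
  also have "\<epsilon> * (b - a) \<le> e"
    using e assms(1) by (simp add: \<epsilon>_def field_simps)
  finally show "\<bar>F b - F a\<bar> \<le> \<Psi> b - \<Psi> a + e" by simp
qed

text \<open>Used with \<open>A = 0\<close> to prove identities, and with \<open>A > 0\<close> to
  turn a local expansion into a Lipschitz bound in which the remainder leaves no trace.\<close>

lemma increment_bound_powr:
  fixes F :: "real \<Rightarrow> real"
  assumes "a \<le> b" "1 < \<theta>"
    and loc: "\<And>s t. a \<le> s \<Longrightarrow> s \<le> t \<Longrightarrow> t \<le> b \<Longrightarrow> \<bar>F t - F s\<bar> \<le> A * (t - s) + C * (t - s) powr \<theta>"
  shows "\<bar>F b - F a\<bar> \<le> A * (b - a)"
proof -
  have "\<bar>F b - F a\<bar> \<le> A * b - A * a"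
  proof (rule increment_bound_infinitesimal[OF assms(1)])
    fix \<epsilon> :: real assume "0 < \<epsilon>"
    then obtain \<delta> where "\<delta> > 0" "\<forall>r. 0 \<le> r \<and> r < \<delta> \<longrightarrow> C * r powr \<theta> \<le> \<epsilon> * r"
      using powr_le_linear[OF assms(2)] by blast
    then show "\<exists>\<delta>>0. \<forall>s t. a \<le> s \<and> s \<le> t \<and> t \<le> b \<and> t - s < \<delta> \<longrightarrow>
        \<bar>F t - F s\<bar> \<le> A * t - A * s + \<epsilon> * (t - s)"
      using loc by (intro exI[of _ \<delta>]) (smt (verit) right_diff_distrib)
  qed
  then show ?thesis by (simp add: algebra_simps)
qed

text \<open>The error is measured by \<open>t - s\<close>, so that it sums to
  \<open>\<epsilon> * (b - a)\<close> over any partition; the tag \<open>\<xi>\<close> is arbitrary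
  because \<open>has_rs_integral\<close> admits every tag. The notion covers Young integrals as well
  as continuous integrands against Lipschitz integrators.\<close>

definition rs_primitive ::
  "real \<Rightarrow> real \<Rightarrow> (real \<Rightarrow> real) \<Rightarrow> (real \<Rightarrow> real) \<Rightarrow> (real \<Rightarrow> real) \<Rightarrow> bool" where
  "rs_primitive a b f g F \<longleftrightarrow>
     (\<forall>\<epsilon>>0. \<exists>\<delta>>0. \<forall>s \<xi> t. a \<le> s \<and> s \<le> \<xi> \<and> \<xi> \<le> t \<and> t \<le> b \<and> t - s < \<delta> \<longrightarrow>
        \<bar>F t - F s - f \<xi> * (g t - g s)\<bar> \<le> \<epsilon> * (t - s))"

lemma rs_primitive_subinterval:
  assumes "rs_primitive a b f g F" "a \<le> c" "d \<le> b"
  shows "rs_primitive c d f g F"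
  using assms unfolding rs_primitive_def by (meson order_trans)

lemma rs_primitive_diff:
  assumes "rs_primitive a b f g F" "rs_primitive a b f' g F'"
  shows "rs_primitive a b (\<lambda>t. f t - f' t) g (\<lambda>t. F t - F' t)"
  unfolding rs_primitive_def
proof (intro allI impI)
  fix \<epsilon> :: real assume "0 < \<epsilon>"
  then have "0 < \<epsilon> / 2" by simp
  obtain d where d: "d > 0" "\<And>s \<xi> t. a \<le> s \<and> s \<le> \<xi> \<and> \<xi> \<le> t \<and> t \<le> b \<and> t - s < d \<Longrightarrow>
      \<bar>F t - F s - f \<xi> * (g t - g s)\<bar> \<le> \<epsilon> / 2 * (t - s)"
    using assms(1) \<open>0 < \<epsilon> / 2\<close> unfolding rs_primitive_def by blast
  obtain d' where d': "d' > 0" "\<And>s \<xi> t. a \<le> s \<and> s \<le> \<xi> \<and> \<xi> \<le> t \<and> t \<le> b \<and> t - s < d' \<Longrightarrow>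
      \<bar>F' t - F' s - f' \<xi> * (g t - g s)\<bar> \<le> \<epsilon> / 2 * (t - s)"
    using assms(2) \<open>0 < \<epsilon> / 2\<close> unfolding rs_primitive_def by blast
  have "\<bar>(F t - F' t) - (F s - F' s) - (f \<xi> - f' \<xi>) * (g t - g s)\<bar> \<le> \<epsilon> * (t - s)"
    if "a \<le> s \<and> s \<le> \<xi> \<and> \<xi> \<le> t \<and> t \<le> b \<and> t - s < min d d'" for s \<xi> t
  proof -
    have "(F t - F' t) - (F s - F' s) - (f \<xi> - f' \<xi>) * (g t - g s) =
        (F t - F s - f \<xi> * (g t - g s)) - (F' t - F' s - f' \<xi> * (g t - g s))"
      by (simp add: algebra_simps)
    moreover have "\<epsilon> * (t - s) = \<epsilon> / 2 * (t - s) + \<epsilon> / 2 * (t - s)" by simp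
    ultimately show ?thesis using d(2)[of s \<xi> t] d'(2)[of s \<xi> t] that by linarith
  qed
  then show "\<exists>\<delta>>0. \<forall>s \<xi> t. a \<le> s \<and> s \<le> \<xi> \<and> \<xi> \<le> t \<and> t \<le> b \<and> t - s < \<delta> \<longrightarrow>
      \<bar>(F t - F' t) - (F s - F' s) - (f \<xi> - f' \<xi>) * (g t - g s)\<bar> \<le> \<epsilon> * (t - s)"
    using d(1) d'(1) by (intro exI[of _ "min d d'"]) auto
qed

text \<open>Each term of a Riemann-Stieltjes sum differs from the increment of \<open>F\<close> over
  its cell by at most \<open>\<epsilon>\<close> times the length of the cell; the increments and the
  lengths both telescope.\<close>

lemma has_rs_integral_primitive:
  assumes "a \<le> b" "rs_primitive a b f g F"
  shows "has_rs_integral a b f g (F b - F a)"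
  unfolding has_rs_integral_def
proof (intro allI impI)
  fix e :: real assume e: "0 < e"
  \<comment> \<open>The \<open>+ 1\<close> covers \<open>a = b\<close> and makes the final
    inequality strict.\<close>
  define \<epsilon> where "\<epsilon> = e / (b - a + 1)"
  have \<epsilon>: "0 < \<epsilon>" using e assms(1) by (simp add: \<epsilon>_def)
  obtain \<delta> where \<delta>: "\<delta> > 0" "\<And>s \<xi> t. a \<le> s \<and> s \<le> \<xi> \<and> \<xi> \<le> t \<and> t \<le> b \<and> t - s < \<delta> \<Longrightarrow>
      \<bar>F t - F s - f \<xi> * (g t - g s)\<bar> \<le> \<epsilon> * (t - s)"
    using assms(2) \<epsilon> unfolding rs_primitive_def by blast
  have "\<bar>(\<Sum>(\<xi>, K)\<in>p. f \<xi> * (g (Sup K) - g (Inf K))) - (F b - F a)\<bar> < e"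
    if p: "p tagged_division_of {a..b}" and m: "\<forall>(\<xi>, K)\<in>p. Sup K - Inf K < \<delta>" for p
  proof -
    have tele: "(\<Sum>(\<xi>, K)\<in>p. H (Sup K) - H (Inf K)) = H b - H a" for H :: "real \<Rightarrow> real"
      by (rule additive_tagged_division_1[OF assms(1) p])
    have "\<bar>(\<Sum>(\<xi>, K)\<in>p. f \<xi> * (g (Sup K) - g (Inf K))) - (F b - F a)\<bar> =
        \<bar>\<Sum>(\<xi>, K)\<in>p. f \<xi> * (g (Sup K) - g (Inf K)) - (F (Sup K) - F (Inf K))\<bar>"
      unfolding tele[of F, symmetric] by (simp add: sum_subtractf case_prod_unfold)
    also have "\<dots> \<le> (\<Sum>(\<xi>, K)\<in>p. \<epsilon> * (Sup K - Inf K))"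
    proof (rule order_trans[OF sum_abs], rule sum_mono, clarify)
      fix \<xi> K assume mem: "(\<xi>, K) \<in> p"
      obtain u v where K: "K = {u..v}" "\<xi> \<in> K"
        using tagged_division_ofD(2,4)[OF p mem] by auto
      moreover have "K \<subseteq> {a..b}" using tagged_division_ofD(3)[OF p mem] .
      ultimately have "a \<le> u" "u \<le> \<xi>" "\<xi> \<le> v" "v \<le> b" "Sup K = v" "Inf K = u" by auto
      then show "\<bar>f \<xi> * (g (Sup K) - g (Inf K)) - (F (Sup K) - F (Inf K))\<bar> \<le> \<epsilon> * (Sup K - Inf K)"
        using \<delta>(2)[of u \<xi> v] m mem by fastforce
    qed
    also have "\<dots> = \<epsilon> * (b - a)"
      unfolding tele[of "\<lambda>x. x", symmetric] by (simp add: sum_distrib_left case_prod_unfold)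
    also have "\<dots> < e" using e assms(1) by (simp add: \<epsilon>_def field_simps)
    finally show ?thesis .
  qed
  then show "\<exists>\<delta>>0. \<forall>p. p tagged_division_of {a..b} \<and> (\<forall>(\<xi>, K)\<in>p. Sup K - Inf K < \<delta>) \<longrightarrow>
      \<bar>(\<Sum>(\<xi>, K)\<in>p. f \<xi> * (g (Sup K) - g (Inf K))) - (F b - F a)\<bar> < e"
    using \<delta>(1) by blast
qed

lemma rs_primitive_integral:
  assumes "rs_primitive a b f g F" "a \<le> t" "t \<le> b"
  shows "rs_integrable a t f g" "rs_integral a t f g = F t - F a"
  using has_rs_integral_primitive[OF assms(2) rs_primitive_subinterval[OF assms(1) order_refl assms(3)]]
  by (auto simp: rs_integrable_def intro: rs_integral_eqI)

text \<open>The freedom in the tag makes this work: the mean value theorem supplies a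
  \<open>\<xi>\<close> with \<open>\<Phi> t - \<Phi> s = (t - s) * \<phi> \<xi>\<close>, and the
  expansion is taken at that very \<open>\<xi>\<close>. Later \<open>\<phi>\<close> is an
  exponential weight.\<close>

lemma rs_primitive_increment_bound:
  assumes "a \<le> b" "rs_primitive a b f g F"
    and lip: "\<And>s t. a \<le> s \<Longrightarrow> s \<le> t \<Longrightarrow> t \<le> b \<Longrightarrow> \<bar>g t - g s\<bar> \<le> B * (t - s)"
    and der: "\<And>t. a \<le> t \<Longrightarrow> t \<le> b \<Longrightarrow> (\<Phi> has_real_derivative \<phi> t) (at t)"
    and bd: "\<And>t. a \<le> t \<Longrightarrow> t \<le> b \<Longrightarrow> \<bar>f t\<bar> \<le> \<phi> t"
  shows "\<bar>F b - F a\<bar> \<le> B * (\<Phi> b - \<Phi> a)"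
proof -
  have "\<bar>F b - F a\<bar> \<le> B * \<Phi> b - B * \<Phi> a"
  proof (rule increment_bound_infinitesimal[OF assms(1)])
    fix \<epsilon> :: real assume \<epsilon>: "0 < \<epsilon>"
    obtain \<delta> where \<delta>: "\<delta> > 0" "\<And>s \<xi> t. a \<le> s \<and> s \<le> \<xi> \<and> \<xi> \<le> t \<and> t \<le> b \<and> t - s < \<delta> \<Longrightarrow>
        \<bar>F t - F s - f \<xi> * (g t - g s)\<bar> \<le> \<epsilon> * (t - s)"
      using assms(2) \<epsilon> unfolding rs_primitive_def by blast
    have "\<bar>F t - F s\<bar> \<le> B * \<Phi> t - B * \<Phi> s + \<epsilon> * (t - s)"
      if st: "a \<le> s" "s \<le> t" "t \<le> b" "t - s < \<delta>" for s t
    proof (cases "s = t")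
      case False
      then obtain \<xi> where \<xi>: "s < \<xi>" "\<xi> < t" "\<Phi> t - \<Phi> s = (t - s) * \<phi> \<xi>"
        using MVT2[of s t \<Phi> \<phi>] der st by force
      have "\<bar>F t - F s\<bar> \<le> \<bar>f \<xi>\<bar> * \<bar>g t - g s\<bar> + \<epsilon> * (t - s)"
        using \<delta>(2)[of s \<xi> t] \<xi> st by (simp add: abs_mult[symmetric])
      also have "\<bar>f \<xi>\<bar> * \<bar>g t - g s\<bar> \<le> \<phi> \<xi> * (B * (t - s))"
        using lip[OF st(1-3)] bd[of \<xi>] \<xi> st by (intro mult_mono) auto
      also have "\<phi> \<xi> * (B * (t - s)) = B * ((t - s) * \<phi> \<xi>)" by simp
      also have "\<dots> = B * \<Phi> t - B * \<Phi> s" unfolding \<xi>(3)[symmetric] by (simp add: algebra_simps)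
      finally show ?thesis by simp
    qed simp
    then show "\<exists>\<delta>>0. \<forall>s t. a \<le> s \<and> s \<le> t \<and> t \<le> b \<and> t - s < \<delta> \<longrightarrow>
        \<bar>F t - F s\<bar> \<le> B * \<Phi> t - B * \<Phi> s + \<epsilon> * (t - s)"
      using \<delta>(1) by blast
  qed
  then show ?thesis by (simp add: algebra_simps)
qed

text \<open>The left-point local estimate that the Young integral satisfies with \<open>\<theta> = 2 * \<alpha>\<close>.\<close>

lemma rs_primitive_powr:
  assumes "1 < \<theta>" "0 \<le> \<alpha>" "\<theta> \<le> 2 * \<alpha>" "0 \<le> A" "0 \<le> B"
    and loc: "\<And>s t. a \<le> s \<Longrightarrow> s \<le> t \<Longrightarrow> t \<le> b \<Longrightarrow>
        \<bar>F t - F s - f s * (g t - g s)\<bar> \<le> C * (t - s) powr \<theta>"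
    and f: "\<And>s t. a \<le> s \<Longrightarrow> s \<le> t \<Longrightarrow> t \<le> b \<Longrightarrow> \<bar>f t - f s\<bar> \<le> A * (t - s) powr \<alpha>"
    and g: "\<And>s t. a \<le> s \<Longrightarrow> s \<le> t \<Longrightarrow> t \<le> b \<Longrightarrow> \<bar>g t - g s\<bar> \<le> B * (t - s) powr \<alpha>"
  shows "rs_primitive a b f g F"
  unfolding rs_primitive_def
proof (intro allI impI)
  fix \<epsilon> :: real assume "0 < \<epsilon>"
  then obtain \<delta> where \<delta>: "\<delta> > 0" "\<And>r. 0 \<le> r \<Longrightarrow> r < \<delta> \<Longrightarrow> (C + A * B) * r powr \<theta> \<le> \<epsilon> * r"
    using powr_le_linear[OF assms(1)] by blast
  \<comment> \<open>Moving the tag from \<open>s\<close> to \<open>\<xi>\<close> costs a product of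
    two Hoelder increments, of order \<open>2 * \<alpha>\<close>. The cap \<open>1\<close> on
    \<open>t - s\<close> allows it to be bounded by order \<open>\<theta>\<close>.\<close>
  have "\<bar>F t - F s - f \<xi> * (g t - g s)\<bar> \<le> \<epsilon> * (t - s)"
    if st: "a \<le> s" "s \<le> \<xi>" "\<xi> \<le> t" "t \<le> b" "t - s < min \<delta> 1" for s \<xi> t
  proof -
    have "\<bar>f \<xi> - f s\<bar> \<le> A * (t - s) powr \<alpha>"
      using f[of s \<xi>] st assms(2,4) powr_mono2[of \<alpha> "\<xi> - s" "t - s"]
      by (smt (verit) mult_left_mono)
    then have "\<bar>f \<xi> - f s\<bar> * \<bar>g t - g s\<bar> \<le> (A * (t - s) powr \<alpha>) * (B * (t - s) powr \<alpha>)"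
      using g[of s t] st by (intro mult_mono) auto
    also have "\<dots> = A * B * (t - s) powr (2 * \<alpha>)" by (simp flip: powr_add)
    also have "\<dots> \<le> A * B * (t - s) powr \<theta>"
      using assms st by (intro mult_left_mono powr_mono') auto
    finally have "\<bar>(f \<xi> - f s) * (g t - g s)\<bar> \<le> A * B * (t - s) powr \<theta>" by (simp add: abs_mult)
    moreover have "F t - F s - f \<xi> * (g t - g s) =
        (F t - F s - f s * (g t - g s)) - (f \<xi> - f s) * (g t - g s)" by (simp add: algebra_simps)
    ultimately have "\<bar>F t - F s - f \<xi> * (g t - g s)\<bar> \<le> (C + A * B) * (t - s) powr \<theta>"
      using loc[of s t] st by (simp add: distrib_right)
    also have "\<dots> \<le> \<epsilon> * (t - s)" using st by (intro \<delta>(2)) auto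
    finally show ?thesis .
  qed
  then show "\<exists>\<delta>>0. \<forall>s \<xi> t. a \<le> s \<and> s \<le> \<xi> \<and> \<xi> \<le> t \<and> t \<le> b \<and> t - s < \<delta> \<longrightarrow>
      \<bar>F t - F s - f \<xi> * (g t - g s)\<bar> \<le> \<epsilon> * (t - s)"
    using \<delta>(1) by (intro exI[of _ "min \<delta> 1"]) auto
qed

section \<open>Existence of Young and Riemann--Stieltjes primitives\<close>

lemma continuous_on_holder:
  fixes f :: "real \<Rightarrow> 'a::real_normed_vector"
  assumes "0 < \<alpha>" and f: "\<And>s t. s \<in> S \<Longrightarrow> t \<in> S \<Longrightarrow> s \<le> t \<Longrightarrow> norm (f t - f s) \<le> A * (t - s) powr \<alpha>"
  shows "continuous_on S f"
  unfolding continuous_on_def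
proof
  fix x assume x: "x \<in> S"
  have "((\<lambda>t. \<bar>t - x\<bar> powr \<alpha>) \<longlongrightarrow> \<bar>x - x\<bar> powr \<alpha>) (at x within S)"
    using assms(1) by (intro tendsto_powr' tendsto_intros) auto
  then have "((\<lambda>t. A * \<bar>t - x\<bar> powr \<alpha>) \<longlongrightarrow> 0) (at x within S)"
    by (intro tendsto_mult_right_zero) simp
  moreover have "norm (f t - f x) \<le> A * \<bar>t - x\<bar> powr \<alpha>" if "t \<in> S" for t
    using f[OF x that] f[OF that x] by (cases "x \<le> t") (auto simp: norm_minus_commute)
  ultimately have "((\<lambda>t. f t - f x) \<longlongrightarrow> 0) (at x within S)"
    by (intro Lim_null_comparison[of "\<lambda>t. f t - f x"]) (auto simp: eventually_at_filter)
  then show "(f \<longlongrightarrow> f x) (at x within S)" by (simp add: LIM_zero_iff)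
qed

text \<open>Summation by parts with step \<open>h\<close>: the shift moves from
  \<open>\<delta>\<close> to \<open>\<phi>\<close>. The interior term then carries an increment of
  \<open>\<phi>\<close> over length \<open>h\<close>, and the two boundary terms live on intervals
  of length \<open>h\<close>; this compensates for a \<open>\<delta>\<close> as large as
  \<open>h powr (\<alpha> - 1)\<close>.\<close>

lemma integral_shift_split:
  fixes \<phi> \<delta> :: "real \<Rightarrow> real"
  assumes [continuous_intros]: "continuous_on UNIV \<phi>" "continuous_on UNIV \<delta>"
    and h: "0 \<le> h" "h \<le> t - s"
  shows "integral {s..t} (\<lambda>r. \<phi> r * \<delta> (r + h)) - integral {s..t} (\<lambda>r. \<phi> r * \<delta> r) =
    integral {s + h..t} (\<lambda>r. (\<phi> (r - h) - \<phi> r) * \<delta> r) +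
    integral {t..t + h} (\<lambda>r. \<phi> (r - h) * \<delta> r) - integral {s..s + h} (\<lambda>r. \<phi> r * \<delta> r)"
proof -
  have [continuous_intros]: "continuous_on S (\<lambda>r. \<phi> (u r))" "continuous_on S (\<lambda>r. \<delta> (u r))"
    if "continuous_on S u" for S and u :: "real \<Rightarrow> real"
    using continuous_on_compose2[OF assms(1) that] continuous_on_compose2[OF assms(2) that] by auto
  have "integral {s..t} (\<lambda>r. \<phi> r * \<delta> (r + h)) = integral {s + h..t + h} (\<lambda>r. \<phi> (r - h) * \<delta> r)"
    using integral_shift_Icc_real[of s t "\<lambda>r. \<phi> (r - h) * \<delta> r" h]
    by (simp add: o_def add.commute)
  also have "\<dots> = integral {s + h..t} (\<lambda>r. \<phi> (r - h) * \<delta> r) + integral {t..t + h} (\<lambda>r. \<phi> (r - h) * \<delta> r)"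
    using h by (intro Henstock_Kurzweil_Integration.integral_combine[symmetric] integrable_continuous_interval continuous_intros) auto
  finally have 1: "integral {s..t} (\<lambda>r. \<phi> r * \<delta> (r + h)) = \<dots>" .
  have 2: "integral {s..t} (\<lambda>r. \<phi> r * \<delta> r) =
      integral {s..s + h} (\<lambda>r. \<phi> r * \<delta> r) + integral {s + h..t} (\<lambda>r. \<phi> r * \<delta> r)"
    using h by (intro Henstock_Kurzweil_Integration.integral_combine[symmetric] integrable_continuous_interval continuous_intros) auto
  have 3: "integral {s + h..t} (\<lambda>r. (\<phi> (r - h) - \<phi> r) * \<delta> r) =
      integral {s + h..t} (\<lambda>r. \<phi> (r - h) * \<delta> r) - integral {s + h..t} (\<lambda>r. \<phi> r * \<delta> r)"
    unfolding left_diff_distrib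
    by (intro Henstock_Kurzweil_Integration.integral_diff integrable_continuous_interval continuous_intros)
  show ?thesis unfolding 1 2 3 by simp
qed

lemma integral_product_bound:
  fixes \<phi> \<delta> :: "real \<Rightarrow> real"
  assumes "continuous_on {a..b} \<phi>" "continuous_on {a..b} \<delta>" "a \<le> b"
    and "\<And>r. a \<le> r \<Longrightarrow> r \<le> b \<Longrightarrow> \<bar>\<phi> r\<bar> \<le> P" "\<And>r. a \<le> r \<Longrightarrow> r \<le> b \<Longrightarrow> \<bar>\<delta> r\<bar> \<le> Q"
  shows "\<bar>integral {a..b} (\<lambda>r. \<phi> r * \<delta> r)\<bar> \<le> P * Q * (b - a)"
proof -
  have "norm (\<phi> r * \<delta> r) \<le> P * Q" if "r \<in> {a..b}" for r
    using assms(4,5)[of r] that by (auto simp: abs_mult intro!: mult_mono)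
  then show ?thesis
    using integral_bound[of a b "\<lambda>r. \<phi> r * \<delta> r" "P * Q"] assms
    by (auto intro: continuous_intros)
qed

section \<open>The Young integral as a limit of smoothed integrals\<close>

definition young_const :: "real \<Rightarrow> real" where
  "young_const \<alpha> = 2 + 2 / (1 - (1 / 2) powr (2 * \<alpha> - 1))"

context
  fixes f g :: "real \<Rightarrow> real" and \<alpha> A B :: real
  assumes \<alpha>: "1 / 2 < \<alpha>" "\<alpha> \<le> 1" and AB: "0 \<le> A" "0 \<le> B"
    and fH: "\<And>s t. s \<le> t \<Longrightarrow> \<bar>f t - f s\<bar> \<le> A * (t - s) powr \<alpha>"
    and gH: "\<And>s t. s \<le> t \<Longrightarrow> \<bar>g t - g s\<bar> \<le> B * (t - s) powr \<alpha>"
begin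

text \<open>This is the derivative of the average of \<open>g\<close> over
  \<open>{r..r + h}\<close>, thus of a smoothing of \<open>g\<close>; it is continuous, so ordinary
  integrals against it exist.\<close>

definition diff_quot where "diff_quot h r = (g (r + h) - g r) / h"

text \<open>Subtracting \<open>f s\<close> isolates the smoothed version of the remainder
  \<open>F t - F s - f s * (g t - g s)\<close>, the quantity that has to be of order
  \<open>2 * \<alpha>\<close> uniformly in \<open>h\<close>.\<close>

definition mollified_increment where
  "mollified_increment h s t = integral {s..t} (\<lambda>r. (f r - f s) * diff_quot h r)"

lemma continuous_fg: "continuous_on S f" "continuous_on S g"
  using \<alpha> fH gH by (auto intro!: continuous_on_holder[of \<alpha>])

lemma continuous_diff_quot: "0 < h \<Longrightarrow> continuous_on S (diff_quot h)"
  unfolding diff_quot_def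
  by (intro continuous_intros continuous_on_compose2[OF continuous_fg(2)[of UNIV]]) auto

lemma diff_quot_bound: "0 < h \<Longrightarrow> \<bar>diff_quot h r\<bar> \<le> B * h powr (\<alpha> - 1)"
  using gH[of r "r + h"] by (simp add: diff_quot_def powr_diff divide_right_mono)

lemma diff_quot_double: "0 < h \<Longrightarrow> diff_quot (2 * h) r = (diff_quot h (r + h) + diff_quot h r) / 2"
  by (simp add: diff_quot_def field_simps)

text \<open>The quotient with step \<open>2 * h\<close> is the mean of the quotient with step
  \<open>h\<close> and its shift by \<open>h\<close>, so the change of scale is half a shift
  difference and splits into three pieces. Each is at most \<open>A * B * (t - s) powr (2 *
  \<alpha>) * (h / (t - s)) powr (2 * \<alpha> - 1)\<close>, and the positive exponent of
  \<open>h\<close> makes dyadic steps summable.\<close>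

lemma mollified_increment_step:
  assumes st: "s < t" and h: "0 < h" "h \<le> t - s"
  shows "\<bar>mollified_increment (2 * h) s t - mollified_increment h s t\<bar> \<le>
    2 * A * B * (t - s) powr (2 * \<alpha>) * (h / (t - s)) powr (2 * \<alpha> - 1)"
proof -
  let ?\<phi> = "\<lambda>r. f r - f s" and ?\<delta> = "diff_quot h" and ?D = "t - s"
  define u where "u = h powr (\<alpha> - 1)"
  have hu: "h * u = h powr \<alpha>" using h by (simp add: u_def powr_diff)
  have u0: "0 \<le> u" by (simp add: u_def)
  note [continuous_intros] = continuous_fg continuous_diff_quot[OF h(1)]
  have [continuous_intros]: "continuous_on S (\<lambda>r. f (v r))" "continuous_on S (\<lambda>r. diff_quot h (v r))"
    if "continuous_on S v" for S and v :: "real \<Rightarrow> real"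
    using continuous_on_compose2[OF continuous_fg(1)[of UNIV] that]
      continuous_on_compose2[OF continuous_diff_quot[OF h(1), of UNIV] that] by auto
  have D: "h powr \<alpha> \<le> ?D powr \<alpha>" using h \<alpha> by (intro powr_mono2) auto
  have "mollified_increment (2 * h) s t =
      (integral {s..t} (\<lambda>r. ?\<phi> r * ?\<delta> (r + h)) + integral {s..t} (\<lambda>r. ?\<phi> r * ?\<delta> r)) / 2"
  proof -
    have "mollified_increment (2 * h) s t =
        integral {s..t} (\<lambda>r. (?\<phi> r * ?\<delta> (r + h) + ?\<phi> r * ?\<delta> r) / 2)"
      unfolding mollified_increment_def diff_quot_double[OF h(1)] by (simp add: algebra_simps)
    also have "\<dots> = integral {s..t} (\<lambda>r. ?\<phi> r * ?\<delta> (r + h) + ?\<phi> r * ?\<delta> r) / 2" by simp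
    also have "\<dots> = (integral {s..t} (\<lambda>r. ?\<phi> r * ?\<delta> (r + h)) + integral {s..t} (\<lambda>r. ?\<phi> r * ?\<delta> r)) / 2"
      by (subst Henstock_Kurzweil_Integration.integral_add)
        (auto intro!: integrable_continuous_interval continuous_intros)
    finally show ?thesis .
  qed
  then have "mollified_increment (2 * h) s t - mollified_increment h s t =
      (integral {s..t} (\<lambda>r. ?\<phi> r * ?\<delta> (r + h)) - integral {s..t} (\<lambda>r. ?\<phi> r * ?\<delta> r)) / 2"
    by (simp add: mollified_increment_def field_simps)
  also have "\<dots> = (integral {s + h..t} (\<lambda>r. (?\<phi> (r - h) - ?\<phi> r) * ?\<delta> r) +
    integral {t..t + h} (\<lambda>r. ?\<phi> (r - h) * ?\<delta> r) - integral {s..s + h} (\<lambda>r. ?\<phi> r * ?\<delta> r)) / 2"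
    using h by (subst integral_shift_split) (auto intro!: continuous_intros)
  finally have eq: "mollified_increment (2 * h) s t - mollified_increment h s t = \<dots>" .
  have "\<bar>integral {s + h..t} (\<lambda>r. (?\<phi> (r - h) - ?\<phi> r) * ?\<delta> r)\<bar> \<le>
      A * h powr \<alpha> * (B * u) * (t - (s + h))"
    using fH[of "r - h" r for r] h diff_quot_bound[OF h(1)]
    by (intro integral_product_bound continuous_intros) (auto simp: abs_minus_commute u_def)
  also have "\<dots> \<le> A * h powr \<alpha> * (B * u) * ?D"
    using h AB u0 by (intro mult_left_mono) auto
  finally have 1: "\<bar>integral {s + h..t} (\<lambda>r. (?\<phi> (r - h) - ?\<phi> r) * ?\<delta> r)\<bar> \<le>
      A * B * (h powr \<alpha> * u * ?D)" by (simp add: mult_ac)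
  have "\<bar>integral {t..t + h} (\<lambda>r. ?\<phi> (r - h) * ?\<delta> r)\<bar> \<le> A * ?D powr \<alpha> * (B * u) * (t + h - t)"
  proof (intro integral_product_bound continuous_intros)
    fix r assume r: "t \<le> r" "r \<le> t + h"
    have "\<bar>f (r - h) - f s\<bar> \<le> A * (r - h - s) powr \<alpha>" using r h by (intro fH) auto
    also have "\<dots> \<le> A * ?D powr \<alpha>" using r h AB \<alpha> by (intro mult_left_mono powr_mono2) auto
    finally show "\<bar>f (r - h) - f s\<bar> \<le> A * ?D powr \<alpha>" .
  qed (use h diff_quot_bound[OF h(1)] in \<open>auto simp: u_def\<close>)
  then have 2: "\<bar>integral {t..t + h} (\<lambda>r. ?\<phi> (r - h) * ?\<delta> r)\<bar> \<le> A * B * (?D powr \<alpha> * h powr \<alpha>)"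
    by (simp add: hu[symmetric] mult_ac)
  have "\<bar>integral {s..s + h} (\<lambda>r. ?\<phi> r * ?\<delta> r)\<bar> \<le> A * ?D powr \<alpha> * (B * u) * (s + h - s)"
  proof (intro integral_product_bound continuous_intros)
    fix r assume r: "s \<le> r" "r \<le> s + h"
    have "\<bar>f r - f s\<bar> \<le> A * (r - s) powr \<alpha>" using r by (intro fH)
    also have "\<dots> \<le> A * ?D powr \<alpha>" using r h AB \<alpha> by (intro mult_left_mono powr_mono2) auto
    finally show "\<bar>f r - f s\<bar> \<le> A * ?D powr \<alpha>" .
  qed (use h diff_quot_bound[OF h(1)] in \<open>auto simp: u_def\<close>)
  then have 3: "\<bar>integral {s..s + h} (\<lambda>r. ?\<phi> r * ?\<delta> r)\<bar> \<le> A * B * (?D powr \<alpha> * h powr \<alpha>)"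
    by (simp add: hu[symmetric] mult_ac)
  \<comment> \<open>The boundary pieces are of relative size \<open>\<rho> powr \<alpha>\<close>,
    which is at most \<open>\<rho> powr (2 * \<alpha> - 1)\<close> because
    \<open>\<rho> \<le> 1\<close> and \<open>\<alpha> \<le> 1\<close>.\<close>
  define \<rho> where "\<rho> = h / ?D"
  have \<rho>: "0 < \<rho>" "\<rho> \<le> 1" "h = \<rho> * ?D" using h st by (auto simp: \<rho>_def)
  have q: "h powr \<alpha> * u * ?D = ?D powr (2 * \<alpha>) * \<rho> powr (2 * \<alpha> - 1)"
  proof -
    have "h powr \<alpha> * u = h powr (2 * \<alpha> - 1)" by (simp add: u_def flip: powr_add)
    also have "\<dots> = \<rho> powr (2 * \<alpha> - 1) * ?D powr (2 * \<alpha> - 1)"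
      using \<rho> st by (simp add: powr_mult)
    finally show ?thesis using st by (simp add: powr_diff)
  qed
  have "?D powr \<alpha> * h powr \<alpha> = ?D powr (2 * \<alpha>) * \<rho> powr \<alpha>"
    using \<rho> st by (simp add: powr_mult flip: powr_add)
  also have "\<dots> \<le> ?D powr (2 * \<alpha>) * \<rho> powr (2 * \<alpha> - 1)"
    using \<rho> \<alpha> by (intro mult_left_mono powr_mono') auto
  finally have q2: "A * B * (?D powr \<alpha> * h powr \<alpha>) \<le> A * B * (?D powr (2 * \<alpha>) * \<rho> powr (2 * \<alpha> - 1))"
    using AB by (intro mult_left_mono) auto
  have "0 \<le> A * B * (?D powr (2 * \<alpha>) * \<rho> powr (2 * \<alpha> - 1))" using AB by simp
  then show ?thesis
    unfolding eq \<rho>_def[symmetric] using 1 2 3 q2 unfolding q by (simp add: mult.assoc)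
qed

lemma mollified_increment_coarse:
  assumes st: "s < t" and h: "t - s \<le> 2 * h"
  shows "\<bar>mollified_increment h s t\<bar> \<le> 2 * A * B * (t - s) powr (2 * \<alpha>)"
proof -
  let ?D = "t - s"
  have h0: "0 < h" using st h by simp
  have "\<bar>mollified_increment h s t\<bar> \<le> A * ?D powr \<alpha> * (B * h powr (\<alpha> - 1)) * ?D"
    unfolding mollified_increment_def
  proof (intro integral_product_bound continuous_intros continuous_fg continuous_diff_quot h0)
    fix r assume r: "s \<le> r" "r \<le> t"
    have "\<bar>f r - f s\<bar> \<le> A * (r - s) powr \<alpha>" using r by (intro fH)
    also have "\<dots> \<le> A * ?D powr \<alpha>" using r h AB \<alpha> by (intro mult_left_mono powr_mono2) auto
    finally show "\<bar>f r - f s\<bar> \<le> A * ?D powr \<alpha>" .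
  qed (use st diff_quot_bound[OF h0] in auto)
  also have "\<dots> \<le> A * ?D powr \<alpha> * (B * (2 * ?D powr (\<alpha> - 1))) * ?D"
  proof -
    have "h powr (\<alpha> - 1) \<le> (?D / 2) powr (\<alpha> - 1)"
      using \<alpha> st h by (intro powr_mono2') auto
    also have "\<dots> = ?D powr (\<alpha> - 1) * 2 powr (1 - \<alpha>)"
      using st by (simp add: powr_divide powr_diff divide_simps)
    also have "\<dots> \<le> ?D powr (\<alpha> - 1) * 2 powr 1"
      using \<alpha> by (intro mult_left_mono powr_mono) auto
    finally show ?thesis using AB st by (intro mult_right_mono mult_left_mono) auto
  qed
  also have "\<dots> = 2 * A * B * (?D powr \<alpha> * (?D powr (\<alpha> - 1) * ?D))" by simp
  also have "?D powr \<alpha> * (?D powr (\<alpha> - 1) * ?D) = ?D powr (2 * \<alpha>)"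
    using st by (simp add: powr_diff flip: powr_add)
  finally show ?thesis .
qed

text \<open>Scales coarser than \<open>t - s\<close> are skipped. At the first dyadic scale below
  \<open>t - s\<close> the coarse bound holds, and the later steps form a geometric series with
  ratio \<open>(1 / 2) powr (2 * \<alpha> - 1)\<close>. These two contributions are the two summands
  of \<open>young_const\<close>, which is therefore independent of \<open>T\<close>.\<close>

lemma mollified_increment_converges:
  assumes T: "0 < T" "t - s \<le> T" and st: "s < t"
  shows "\<exists>L. (\<lambda>k. mollified_increment (T / 2 ^ k) s t) \<longlonglongrightarrow> L \<and>
    \<bar>L\<bar> \<le> young_const \<alpha> * A * B * (t - s) powr (2 * \<alpha>)"
proof -
  let ?D = "t - s"
  define q where "q = (1 / 2) powr (2 * \<alpha> - 1)"
  define M where "M = A * B * ?D powr (2 * \<alpha>)"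
  have M: "0 \<le> M" using AB by (simp add: M_def)
  have q: "0 < q" "q < 1" using \<alpha> powr_less_mono2[of "2 * \<alpha> - 1" "1 / 2" 1] by (auto simp: q_def)
  have "\<exists>k. T / 2 ^ k \<le> ?D"
  proof -
    obtain k where "T / ?D < 2 ^ k" using real_arch_pow[of 2] by auto
    then show ?thesis using st by (intro exI[of _ k]) (simp add: field_simps)
  qed
  \<comment> \<open>Twice this scale is at least \<open>t - s\<close>: by minimality, or by
    \<open>t - s \<le> T\<close> when \<open>k0 = 0\<close>.\<close>
  define k0 where "k0 = (LEAST k. T / 2 ^ k \<le> ?D)"
  have k0: "T / 2 ^ k0 \<le> ?D" unfolding k0_def using \<open>\<exists>k. T / 2 ^ k \<le> ?D\<close> by (rule LeastI_ex)
  have k0': "?D \<le> 2 * (T / 2 ^ k0)"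
  proof (cases k0)
    case (Suc k)
    then have "\<not> T / 2 ^ k \<le> ?D" unfolding k0_def using not_less_Least by (metis lessI)
    then show ?thesis using Suc by simp
  qed (use T in simp)
  define E where "E j = mollified_increment (T / 2 ^ (k0 + j)) s t" for j
  have step: "\<bar>E (Suc j) - E j\<bar> \<le> 2 * M * q ^ j" for j
  proof -
    let ?h = "T / 2 ^ (k0 + Suc j)"
    have h: "?h / ?D \<le> (1 / 2) ^ j"
    proof -
      have "?h = T / 2 ^ k0 * (1 / 2) ^ Suc j" by (simp add: power_add power_divide)
      also have "\<dots> \<le> ?D * (1 / 2) ^ j" using k0 T st by (intro mult_mono power_decreasing) auto
      finally show ?thesis using st by (simp add: field_simps)
    qed
    moreover have "(1 / 2 :: real) ^ j \<le> 1" by (intro power_le_one) auto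
    ultimately have "?h / ?D \<le> 1" by linarith
    then have "\<bar>mollified_increment (2 * ?h) s t - mollified_increment ?h s t\<bar> \<le>
        2 * A * B * ?D powr (2 * \<alpha>) * (?h / ?D) powr (2 * \<alpha> - 1)"
      using T st by (intro mollified_increment_step) (auto simp: field_simps)
    also have "(?h / ?D) powr (2 * \<alpha> - 1) \<le> ((1 / 2) ^ j) powr (2 * \<alpha> - 1)"
      using h \<alpha> T st by (intro powr_mono2) auto
    also have "\<dots> = q ^ j"
      by (simp add: q_def powr_powr powr_realpow[symmetric] mult.commute)
    finally show ?thesis
      using AB by (simp add: E_def M_def abs_minus_commute mult_left_mono mult.assoc)
  qed
  have bound: "\<bar>E j\<bar> \<le> 2 * M + 2 * M * (\<Sum>i<j. q ^ i)" for j
  proof (induction j)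
    case 0
    then show ?case using mollified_increment_coarse[OF st k0'] by (simp add: E_def M_def mult_ac)
  next
    case (Suc j)
    then show ?case using step[of j] by (simp add: algebra_simps)
  qed
  have "summable (\<lambda>j. 2 * M * q ^ j)" using q by (intro summable_mult summable_geometric) auto
  then have "summable (\<lambda>j. E (Suc j) - E j)"
    by (rule summable_comparison_test'[where N = 0]) (use step in auto)
  then have "convergent (\<lambda>n. E n - E 0)" by (simp add: summable_iff_convergent sum_lessThan_telescope)
  then have "convergent E" by (simp add: convergent_diff_const_right_iff)
  then obtain L where L: "E \<longlonglongrightarrow> L" by (auto simp: convergent_def)
  have "\<bar>E j\<bar> \<le> young_const \<alpha> * M" for j
  proof -
    have "(\<Sum>i<j. q ^ i) \<le> (\<Sum>i. q ^ i)" using q by (intro sum_le_suminf summable_geometric) auto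
    also have "\<dots> = 1 / (1 - q)" using q by (intro suminf_geometric) auto
    finally have "2 * M * (\<Sum>i<j. q ^ i) \<le> 2 * M * (1 / (1 - q))" using M by (intro mult_left_mono) auto
    then show ?thesis using bound[of j] by (simp add: young_const_def q_def algebra_simps)
  qed
  then have "\<bar>L\<bar> \<le> young_const \<alpha> * M"
    using tendsto_rabs[OF L] by (intro LIMSEQ_le_const2) auto
  moreover have "(\<lambda>k. mollified_increment (T / 2 ^ k) s t) \<longlonglongrightarrow> L"
    using L unfolding E_def by (subst (asm) add.commute) (rule LIMSEQ_offset)
  ultimately show ?thesis by (auto simp: M_def mult_ac)
qed

text \<open>A shift of the variable leaves only the averages of \<open>g\<close> over
  \<open>{t..t + h}\<close> and \<open>{s..s + h}\<close>, which deviate from the endpoint values by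
  at most \<open>B * h powr \<alpha>\<close>.\<close>

lemma integral_diff_quot_tendsto:
  assumes T: "0 < T" and st: "s < t"
  shows "(\<lambda>k. integral {s..t} (diff_quot (T / 2 ^ k))) \<longlonglongrightarrow> g t - g s"
proof -
  have h0: "(\<lambda>k. T / 2 ^ k) \<longlonglongrightarrow> 0"
    using LIMSEQ_inverse_realpow_zero[of 2] tendsto_mult_right_zero[of "\<lambda>n. inverse (2 ^ n)" sequentially T]
    by (simp add: divide_inverse)
  have avg: "\<bar>integral {c..c + h} g - g c * h\<bar> \<le> B * h powr \<alpha> * h" if h: "0 < h" for c h
  proof -
    have "integral {c..c + h} g - g c * h = integral {c..c + h} (\<lambda>r. (g r - g c) * 1)"
      using h by (simp add: Henstock_Kurzweil_Integration.integral_diff integrable_continuous_interval continuous_fg mult.commute)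
    also have "\<bar>\<dots>\<bar> \<le> B * h powr \<alpha> * 1 * (c + h - c)"
    proof (intro integral_product_bound continuous_intros continuous_fg)
      fix r assume r: "c \<le> r" "r \<le> c + h"
      have "\<bar>g r - g c\<bar> \<le> B * (r - c) powr \<alpha>" using r by (intro gH)
      also have "\<dots> \<le> B * h powr \<alpha>" using r h AB \<alpha> by (intro mult_left_mono powr_mono2) auto
      finally show "\<bar>g r - g c\<bar> \<le> B * h powr \<alpha>" .
    qed (use h in auto)
    finally show ?thesis by simp
  qed
  have est: "\<bar>integral {s..t} (diff_quot h) - (g t - g s)\<bar> \<le> 2 * B * h powr \<alpha>"
    if h: "0 < h" "h \<le> t - s" for h
  proof -
    have "integral {s..t} (diff_quot h) = (integral {s..t} (\<lambda>r. g (r + h) - g r)) / h"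
      unfolding diff_quot_def by simp
    also have "integral {s..t} (\<lambda>r. g (r + h) - g r) =
        integral {s..t} (\<lambda>r. g (r + h)) - integral {s..t} g"
      by (intro Henstock_Kurzweil_Integration.integral_diff integrable_continuous_interval continuous_fg
          continuous_on_compose2[OF continuous_fg(2)[of UNIV]] continuous_intros) auto
    also have "\<dots> = integral {t..t + h} g - integral {s..s + h} g"
      using integral_shift_split[of "\<lambda>_. 1" g h t s] h by (simp add: continuous_fg)
    finally have "integral {s..t} (diff_quot h) - (g t - g s) =
        ((integral {t..t + h} g - g t * h) - (integral {s..s + h} g - g s * h)) / h"
      using h by (simp add: field_simps)
    also have "\<bar>\<dots>\<bar> \<le> (2 * (B * h powr \<alpha> * h)) / h"
      unfolding abs_divide abs_of_pos[OF h(1)]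
      using avg[OF h(1), of t] avg[OF h(1), of s] h(1) by (intro divide_right_mono) linarith+
    also have "\<dots> = 2 * B * h powr \<alpha>" using h by simp
    finally show ?thesis .
  qed
  have "eventually (\<lambda>k. T / 2 ^ k < t - s) sequentially"
    using order_tendstoD(2)[OF h0, of "t - s"] st by simp
  then have ev: "eventually (\<lambda>k. norm (integral {s..t} (diff_quot (T / 2 ^ k)) - (g t - g s)) \<le>
      2 * B * (T / 2 ^ k) powr \<alpha>) sequentially"
    by eventually_elim (use T in \<open>auto intro!: est\<close>)
  have "(\<lambda>k. (T / 2 ^ k) powr \<alpha>) \<longlonglongrightarrow> 0 powr \<alpha>"
    using h0 \<alpha> T by (intro tendsto_powr') auto
  then have "(\<lambda>k. 2 * B * (T / 2 ^ k) powr \<alpha>) \<longlonglongrightarrow> 0"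
    by (intro tendsto_mult_right_zero) simp
  from Lim_null_comparison[OF ev this] show ?thesis by (simp add: LIM_zero_iff)
qed

lemma young_primitive_exists_global:
  assumes T: "0 < T"
  shows "\<exists>F. F 0 = 0 \<and> (\<forall>s t. 0 \<le> s \<and> s \<le> t \<and> t \<le> T \<longrightarrow>
    \<bar>F t - F s - f s * (g t - g s)\<bar> \<le> young_const \<alpha> * A * B * (t - s) powr (2 * \<alpha>))"
proof -
  define P where "P k t = integral {0..t} (\<lambda>r. f r * diff_quot (T / 2 ^ k) r)" for k t
  have h: "0 < T / 2 ^ k" for k using T by simp
  \<comment> \<open>This separates the remainder, whose limit satisfies the Young bound, from a main
    term that converges to \<open>f s * (g t - g s)\<close>.\<close>
  have incr: "P k t - P k s = mollified_increment (T / 2 ^ k) s t + f s * integral {s..t} (diff_quot (T / 2 ^ k))"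
    if "0 \<le> s" "s \<le> t" for k s t
  proof -
    have "P k s + integral {s..t} (\<lambda>r. f r * diff_quot (T / 2 ^ k) r) = P k t"
      unfolding P_def using that
      by (intro Henstock_Kurzweil_Integration.integral_combine integrable_continuous_interval
          continuous_intros continuous_fg continuous_diff_quot[OF h]) auto
    moreover have "mollified_increment (T / 2 ^ k) s t = integral {s..t} (\<lambda>r. f r * diff_quot (T / 2 ^ k) r) -
        integral {s..t} (\<lambda>r. f s * diff_quot (T / 2 ^ k) r)"
      unfolding mollified_increment_def left_diff_distrib
      by (intro Henstock_Kurzweil_Integration.integral_diff integrable_continuous_interval
          continuous_intros continuous_fg continuous_diff_quot[OF h])
    ultimately show ?thesis by simp
  qed
  have conv: "\<exists>l. (\<lambda>k. P k t) \<longlonglongrightarrow> l" if t: "0 \<le> t" "t \<le> T" for t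
  proof (cases "t = 0")
    case False
    then have "0 < t" using t by simp
    from mollified_increment_converges[OF T, of t 0] this t obtain L
      where "(\<lambda>k. mollified_increment (T / 2 ^ k) 0 t) \<longlonglongrightarrow> L" by auto
    then have "(\<lambda>k. P k t - P k 0) \<longlonglongrightarrow> L + f 0 * (g t - g 0)"
      unfolding incr[OF order_refl t(1)]
      by (intro tendsto_intros integral_diff_quot_tendsto[OF T \<open>0 < t\<close>])
    then show ?thesis by (auto simp: P_def)
  qed (auto simp: P_def)
  define F where "F t = lim (\<lambda>k. P k t)" for t
  have F: "(\<lambda>k. P k t) \<longlonglongrightarrow> F t" if "0 \<le> t" "t \<le> T" for t
    using conv[OF that] unfolding F_def by (simp add: convergent_LIMSEQ_iff[symmetric] convergent_def)
  have "\<bar>F t - F s - f s * (g t - g s)\<bar> \<le> young_const \<alpha> * A * B * (t - s) powr (2 * \<alpha>)"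
    if st: "0 \<le> s" "s \<le> t" "t \<le> T" for s t
  proof (cases "s = t")
    case False
    then have "s < t" using st by simp
    from mollified_increment_converges[OF T, of t s] this st obtain L
      where L: "(\<lambda>k. mollified_increment (T / 2 ^ k) s t) \<longlonglongrightarrow> L"
        "\<bar>L\<bar> \<le> young_const \<alpha> * A * B * (t - s) powr (2 * \<alpha>)" by auto
    have "(\<lambda>k. P k t - P k s) \<longlonglongrightarrow> L + f s * (g t - g s)"
      unfolding incr[OF st(1,2)]
      by (intro tendsto_intros L integral_diff_quot_tendsto[OF T \<open>s < t\<close>])
    moreover have "(\<lambda>k. P k t - P k s) \<longlonglongrightarrow> F t - F s"
      using st by (intro tendsto_diff F) auto
    ultimately have "F t - F s = L + f s * (g t - g s)" by (rule LIMSEQ_unique[rotated])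
    then show ?thesis using L(2) by simp
  qed simp
  moreover have "F 0 = 0" by (simp add: F_def P_def)
  ultimately show ?thesis by blast
qed

end

text \<open>The shifts by \<open>h\<close> leave the interval, so the construction works with
  functions on the whole line. Projecting the argument onto \<open>{0..T}\<close> extends
  \<open>f\<close> and \<open>g\<close> with the same Hoelder constants, because the projection is
  1-Lipschitz.\<close>

lemma young_primitive_exists:
  fixes f g :: "real \<Rightarrow> real"
  assumes \<alpha>: "1 / 2 < \<alpha>" "\<alpha> \<le> 1" and AB: "0 \<le> A" "0 \<le> B" and T: "0 < T"
    and fH: "\<And>s t. 0 \<le> s \<Longrightarrow> s \<le> t \<Longrightarrow> t \<le> T \<Longrightarrow> \<bar>f t - f s\<bar> \<le> A * (t - s) powr \<alpha>"
    and gH: "\<And>s t. 0 \<le> s \<Longrightarrow> s \<le> t \<Longrightarrow> t \<le> T \<Longrightarrow> \<bar>g t - g s\<bar> \<le> B * (t - s) powr \<alpha>"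
  shows "\<exists>F. F 0 = 0 \<and> (\<forall>s t. 0 \<le> s \<and> s \<le> t \<and> t \<le> T \<longrightarrow>
    \<bar>F t - F s - f s * (g t - g s)\<bar> \<le> young_const \<alpha> * A * B * (t - s) powr (2 * \<alpha>))"
proof -
  define c where "c r = max 0 (min T r)" for r
  have c: "0 \<le> c s" "c s \<le> c t" "c t \<le> T" "c t - c s \<le> t - s" if "s \<le> t" for s t
    using that T by (auto simp: c_def)
  have *: "\<bar>u (c t) - u (c s)\<bar> \<le> D * (t - s) powr \<alpha>"
    if "0 \<le> D" "s \<le> t" and u: "\<And>s t. 0 \<le> s \<Longrightarrow> s \<le> t \<Longrightarrow> t \<le> T \<Longrightarrow> \<bar>u t - u s\<bar> \<le> D * (t - s) powr \<alpha>"
    for u :: "real \<Rightarrow> real" and D s t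
  proof -
    have "\<bar>u (c t) - u (c s)\<bar> \<le> D * (c t - c s) powr \<alpha>" using c[OF that(2)] by (intro u)
    also have "\<dots> \<le> D * (t - s) powr \<alpha>"
      using c[OF that(2)] that(1) \<alpha> by (intro mult_left_mono powr_mono2) auto
    finally show ?thesis .
  qed
  obtain F where F: "F 0 = 0" "\<And>s t. 0 \<le> s \<Longrightarrow> s \<le> t \<Longrightarrow> t \<le> T \<Longrightarrow>
    \<bar>F t - F s - f (c s) * (g (c t) - g (c s))\<bar> \<le> young_const \<alpha> * A * B * (t - s) powr (2 * \<alpha>)"
    using young_primitive_exists_global[of \<alpha> A B "\<lambda>r. f (c r)" "\<lambda>r. g (c r)", OF \<alpha> AB _ _ T]
      *[of A _ _ f, OF AB(1) _ fH] *[of B _ _ g, OF AB(2) _ gH] by blast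
  have "c r = r" if "0 \<le> r" "r \<le> T" for r using that by (simp add: c_def)
  then show ?thesis using F by (intro exI[of _ F]) auto
qed

section \<open>Continuous integrands against Lipschitz integrators\<close>

lemma rs_primitive_const: "rs_primitive a b (\<lambda>_. c) g (\<lambda>t. c * g t)"
proof -
  have "c * g t - c * g s - c * (g t - g s) = 0" for s t by (simp add: algebra_simps)
  then show ?thesis unfolding rs_primitive_def by (auto intro!: exI[of _ "1::real"])
qed

lemma rs_primitive_exists:
  fixes f g :: "real \<Rightarrow> real"
  assumes ab: "a < b" and f: "continuous_on {a..b} f"
    and lip: "\<And>s t. a \<le> s \<Longrightarrow> s \<le> t \<Longrightarrow> t \<le> b \<Longrightarrow> \<bar>g t - g s\<bar> \<le> B * (t - s)"
  shows "\<exists>F. rs_primitive a b f g F"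
proof -
  have B: "0 \<le> B" using lip[of a b] ab by (smt (verit) zero_le_mult_iff)
  text \<open>Polynomials are Lipschitz, so that the Young integral exists for them.\<close>
  have approx: "\<exists>p F. (\<forall>t\<in>{a..b}. \<bar>f t - p t\<bar> \<le> e) \<and> rs_primitive a b p g F" if e: "0 < e" for e
  proof -
    obtain p where p: "real_polynomial_function p" "\<And>t. t \<in> {a..b} \<Longrightarrow> \<bar>f t - p t\<bar> < e"
      using Stone_Weierstrass_real_polynomial_function[OF compact_Icc f e] by auto
    obtain p' where p': "real_polynomial_function p'" "\<And>t. (p has_real_derivative p' t) (at t)"
      using has_real_derivative_polynomial_function[OF p(1)] by blast
    have "continuous_on {a..b} p'" using continuous_real_polymonial_function[OF p'(1)]
      by (intro continuous_at_imp_continuous_on) auto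
    then have "bounded (p' ` {a..b})" by (intro compact_imp_bounded compact_continuous_image) auto
    then obtain D where D: "0 < D" "\<And>t. t \<in> {a..b} \<Longrightarrow> \<bar>p' t\<bar> \<le> D"
      unfolding bounded_pos by auto
    have plip: "\<bar>p t - p s\<bar> \<le> D * (t - s)" if st: "a \<le> s" "s \<le> t" "t \<le> b" for s t
    proof (cases "s = t")
      case False
      then obtain z where z: "s < z" "z < t" "p t - p s = (t - s) * p' z"
        using MVT2[of s t p p'] p'(2) st by force
      then show ?thesis using D(2)[of z] st by (simp add: abs_mult mult.commute mult_left_mono)
    qed simp
    \<comment> \<open>The Young construction lives on an interval that starts at \<open>0\<close>,
      hence the translation by \<open>a\<close>. Exponent \<open>1\<close> for both functions gives
      a remainder of order \<open>2\<close>.\<close>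
    have "\<exists>F. F 0 = 0 \<and> (\<forall>s t. 0 \<le> s \<and> s \<le> t \<and> t \<le> b - a \<longrightarrow>
        \<bar>F t - F s - p (a + s) * (g (a + t) - g (a + s))\<bar> \<le> young_const 1 * D * B * (t - s) powr (2 * 1))"
      using plip[of "a + s" "a + t" for s t] lip[of "a + s" "a + t" for s t] D(1) B ab
      by (intro young_primitive_exists) auto
    then obtain F where F: "\<And>s t. 0 \<le> s \<Longrightarrow> s \<le> t \<Longrightarrow> t \<le> b - a \<Longrightarrow>
        \<bar>F t - F s - p (a + s) * (g (a + t) - g (a + s))\<bar> \<le> young_const 1 * D * B * (t - s) powr 2"
      unfolding mult_1_right by blast
    have "rs_primitive a b p g (\<lambda>t. F (t - a))"
    proof (rule rs_primitive_powr[of 2 1 D B])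
      show "\<bar>F (t - a) - F (s - a) - p s * (g t - g s)\<bar> \<le> young_const 1 * D * B * (t - s) powr 2"
        if "a \<le> s" "s \<le> t" "t \<le> b" for s t
        using F[of "s - a" "t - a"] that by simp
    qed (use D B plip lip in auto)
    then show ?thesis using p(2) by (intro exI[of _ p] exI[of _ "\<lambda>t. F (t - a)"]) (auto intro: less_imp_le)
  qed
  then have "\<forall>n. \<exists>p F. (\<forall>t\<in>{a..b}. \<bar>f t - p t\<bar> \<le> 1 / real (Suc n)) \<and> rs_primitive a b p g F"
    by simp
  then obtain p F where pF: "\<And>n t. t \<in> {a..b} \<Longrightarrow> \<bar>f t - p n t\<bar> \<le> 1 / real (Suc n)"
      "\<And>n. rs_primitive a b (p n) g (F n)"
    by metis
  \<comment> \<open>A primitive is determined only up to a constant; the normalisation at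
    \<open>a\<close> makes the sequence converge pointwise.\<close>
  define G where "G n t = F n t - F n a" for n t
  have G: "rs_primitive a b (p n) g (G n)" for n
    using pF(2)[of n] unfolding rs_primitive_def G_def by simp
  have bound: "\<bar>(G n t - G n s) - (G m t - G m s)\<bar> \<le> (1 / real (Suc n) + 1 / real (Suc m)) * B * (t - s)"
    if "a \<le> s" "s \<le> t" "t \<le> b" for n m s t
  proof -
    let ?e = "1 / real (Suc n) + 1 / real (Suc m)"
    have "rs_primitive s t (\<lambda>r. p n r - p m r) g (\<lambda>r. G n r - G m r)"
      using that by (intro rs_primitive_diff rs_primitive_subinterval[OF G]) auto
    then have "\<bar>(G n t - G m t) - (G n s - G m s)\<bar> \<le> B * (?e * t - ?e * s)"
    proof (rule rs_primitive_increment_bound[OF that(2)])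
      show "((\<lambda>t. ?e * t) has_real_derivative ?e) (at r)" for r by (auto intro!: derivative_eq_intros)
      show "\<bar>p n r - p m r\<bar> \<le> ?e" if "s \<le> r" "r \<le> t" for r
        using pF(1)[of r n] pF(1)[of r m] that \<open>a \<le> s\<close> \<open>t \<le> b\<close> by auto
    qed (use lip that in auto)
    moreover have "B * (e * t - e * s) = e * B * (t - s)" for e by (simp add: algebra_simps)
    moreover have "(G n t - G n s) - (G m t - G m s) = (G n t - G m t) - (G n s - G m s)" by simp
    ultimately show ?thesis by (simp only:)
  qed
  have "Cauchy (\<lambda>n. G n t)" if t: "a \<le> t" "t \<le> b" for t
  proof (rule CauchyI)
    fix e :: real assume e: "0 < e"
    obtain N :: nat where N: "2 * B * (b - a) / e < real N" using reals_Archimedean2 by blast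
    have "norm (G m t - G n t) < e" if mn: "N \<le> m" "N \<le> n" for m n
    proof -
      have "\<bar>G m t - G n t\<bar> \<le> (1 / real (Suc m) + 1 / real (Suc n)) * B * (t - a)"
        using bound[OF order_refl t, of m n] by (simp add: G_def)
      also have "\<dots> \<le> (1 / real (Suc N) + 1 / real (Suc N)) * B * (b - a)"
        using t B mn by (intro mult_mono add_mono divide_left_mono add_nonneg_nonneg) auto
      also have "\<dots> < e"
      proof -
        have "2 * B * (b - a) < e * real N" using N e by (simp add: field_simps)
        also have "\<dots> \<le> e * real (Suc N)" using e by simp
        finally show ?thesis by (simp add: field_simps)
      qed
      finally show ?thesis by simp
    qed
    then show "\<exists>M. \<forall>m\<ge>M. \<forall>n\<ge>M. norm (G m t - G n t) < e" by blast
  qed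
  then have "\<exists>l. (\<lambda>n. G n t) \<longlonglongrightarrow> l" if "a \<le> t" "t \<le> b" for t
    using that by (simp add: Cauchy_convergent_iff convergent_def)
  then obtain H where H: "\<And>t. a \<le> t \<Longrightarrow> t \<le> b \<Longrightarrow> (\<lambda>n. G n t) \<longlonglongrightarrow> H t" by metis
  have "rs_primitive a b f g H"
    unfolding rs_primitive_def
  proof (intro allI impI)
    fix \<epsilon> :: real assume \<epsilon>: "0 < \<epsilon>"
    have "uniformly_continuous_on {a..b} f" using f by (intro compact_uniformly_continuous) auto
    then obtain \<delta> where \<delta>: "\<delta> > 0" "\<And>r r'. r \<in> {a..b} \<Longrightarrow> r' \<in> {a..b} \<Longrightarrow> \<bar>r' - r\<bar> < \<delta> \<Longrightarrow>
        \<bar>f r' - f r\<bar> < \<epsilon> / (B + 1)"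
    proof -
      have "0 < \<epsilon> / (B + 1)" using \<epsilon> B by simp
      with \<open>uniformly_continuous_on {a..b} f\<close> show ?thesis
        unfolding uniformly_continuous_on_def dist_real_def using that by blast
    qed
    have "\<bar>H t - H s - f \<xi> * (g t - g s)\<bar> \<le> \<epsilon> * (t - s)"
      if st: "a \<le> s" "s \<le> \<xi>" "\<xi> \<le> t" "t \<le> b" "t - s < \<delta>" for s \<xi> t
    proof -
      \<comment> \<open>The comparison is with the constant integrand \<open>f \<xi>\<close> and its
        primitive \<open>f \<xi> * g\<close>. On a short interval \<open>p n\<close> stays near
        \<open>f \<xi>\<close> by uniform continuity of \<open>f\<close>, up to the approximation
        error.\<close>
      have *: "\<bar>G n t - G n s - f \<xi> * (g t - g s)\<bar> \<le> B * ((\<epsilon> / (B + 1) + 1 / real (Suc n)) * (t - s))" for n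
      proof -
        let ?e = "\<epsilon> / (B + 1) + 1 / real (Suc n)"
        have "rs_primitive s t (\<lambda>r. p n r - f \<xi>) g (\<lambda>r. G n r - f \<xi> * g r)"
        proof (rule rs_primitive_diff[OF rs_primitive_subinterval[OF G]])
          show "rs_primitive s t (\<lambda>r. f \<xi>) g (\<lambda>r. f \<xi> * g r)"
            by (rule rs_primitive_const)
        qed (use st in auto)
        then have "\<bar>(G n t - f \<xi> * g t) - (G n s - f \<xi> * g s)\<bar> \<le> B * (?e * t - ?e * s)"
        proof (rule rs_primitive_increment_bound[rotated])
          show "((\<lambda>t. ?e * t) has_real_derivative ?e) (at r)" for r by (auto intro!: derivative_eq_intros)
          show "\<bar>p n r - f \<xi>\<bar> \<le> ?e" if r: "s \<le> r" "r \<le> t" for r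
          proof -
            have "\<bar>r - \<xi>\<bar> < \<delta>" using r st by linarith
            then show ?thesis using pF(1)[of r n] \<delta>(2)[of \<xi> r] r st by (simp del: of_nat_Suc)
          qed
        qed (use lip st in auto)
        moreover have "B * (e * t - e * s) = B * (e * (t - s))" for e by (simp add: algebra_simps)
        moreover have "G n t - G n s - f \<xi> * (g t - g s) = (G n t - f \<xi> * g t) - (G n s - f \<xi> * g s)"
          by (simp add: algebra_simps)
        ultimately show ?thesis by (simp only:)
      qed
      have "(\<lambda>n. \<bar>G n t - G n s - f \<xi> * (g t - g s)\<bar>) \<longlonglongrightarrow> \<bar>H t - H s - f \<xi> * (g t - g s)\<bar>"
        using st by (intro tendsto_intros H) auto
      moreover have "(\<lambda>n. B * ((\<epsilon> / (B + 1) + 1 / real (Suc n)) * (t - s))) \<longlonglongrightarrow>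
          B * ((\<epsilon> / (B + 1) + 0) * (t - s))"
        by (rule tendsto_mult[OF tendsto_const tendsto_mult[OF tendsto_add[OF tendsto_const
              LIMSEQ_Suc[OF lim_1_over_n]] tendsto_const]])
      ultimately have "\<bar>H t - H s - f \<xi> * (g t - g s)\<bar> \<le> B * ((\<epsilon> / (B + 1) + 0) * (t - s))"
        by (rule LIMSEQ_le) (use * in blast)
      also have "\<dots> = (B / (B + 1) * \<epsilon>) * (t - s)" by simp
      also have "\<dots> \<le> (1 * \<epsilon>) * (t - s)" using B \<epsilon> st by (intro mult_right_mono) auto
      finally show ?thesis by simp
    qed
    then show "\<exists>\<delta>>0. \<forall>s \<xi> t. a \<le> s \<and> s \<le> \<xi> \<and> \<xi> \<le> t \<and> t \<le> b \<and> t - s < \<delta> \<longrightarrow>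
        \<bar>H t - H s - f \<xi> * (g t - g s)\<bar> \<le> \<epsilon> * (t - s)"
      using \<delta>(1) by blast
  qed
  then show ?thesis by blast
qed

section \<open>Coordinates of the signature\<close>

text \<open>The expansion with the tag at \<open>x\<close>, from either side, says that
  \<open>F\<close> has derivative \<open>f x\<close>, and the fundamental theorem applies. In this
  way the time letter of a signature becomes an ordinary integral.\<close>

lemma rs_primitive_time_has_integral:
  assumes "a \<le> b" "rs_primitive a b f (\<lambda>t. t) F"
  shows "(f has_integral (F b - F a)) {a..b}"
proof (rule fundamental_theorem_of_calculus[OF assms(1)])
  fix x assume x: "x \<in> {a..b}"
  show "(F has_vector_derivative f x) (at x within {a..b})"
    unfolding has_vector_derivative_def has_derivative_within_alt
  proof (intro conjI allI impI)
    show "bounded_linear (\<lambda>h. h *\<^sub>R f x)" by (rule bounded_linear_scaleR_left)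
  next
    fix e :: real assume "0 < e"
    then obtain \<delta> where \<delta>: "\<delta> > 0" "\<And>s \<xi> t. a \<le> s \<and> s \<le> \<xi> \<and> \<xi> \<le> t \<and> t \<le> b \<and> t - s < \<delta> \<Longrightarrow>
        \<bar>F t - F s - f \<xi> * (t - s)\<bar> \<le> e * (t - s)"
      using assms(2) unfolding rs_primitive_def by blast
    have "norm (F y - F x - (y - x) *\<^sub>R f x) \<le> e * norm (y - x)"
      if y: "y \<in> {a..b}" "norm (y - x) < \<delta>" for y
    proof (cases "x \<le> y")
      case True
      then show ?thesis using \<delta>(2)[of x x y] x y by (simp add: mult.commute)
    next
      case False
      have "F y - F x - (y - x) *\<^sub>R f x = - (F x - F y - f x * (x - y))" by (simp add: algebra_simps)
      then show ?thesis using False \<delta>(2)[of y x x] x y by simp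
    qed
    then show "\<exists>d>0. \<forall>y\<in>{a..b}. norm (y - x) < d \<longrightarrow>
        norm (F y - F x - (y - x) *\<^sub>R f x) \<le> e * norm (y - x)"
      using \<delta>(1) by blast
  qed
qed

lemma rs_primitive_cong:
  assumes "rs_primitive a b f g F" and eq: "\<And>t. a \<le> t \<Longrightarrow> t \<le> b \<Longrightarrow> F' t = F t"
  shows "rs_primitive a b f g F'"
  unfolding rs_primitive_def
proof (intro allI impI)
  fix \<epsilon> :: real assume "0 < \<epsilon>"
  then obtain \<delta> where \<delta>: "\<delta> > 0" "\<And>s \<xi> t. a \<le> s \<and> s \<le> \<xi> \<and> \<xi> \<le> t \<and> t \<le> b \<and> t - s < \<delta> \<Longrightarrow>
      \<bar>F t - F s - f \<xi> * (g t - g s)\<bar> \<le> \<epsilon> * (t - s)"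
    using assms(1) unfolding rs_primitive_def by blast
  have "\<bar>F' t - F' s - f \<xi> * (g t - g s)\<bar> \<le> \<epsilon> * (t - s)"
    if "a \<le> s \<and> s \<le> \<xi> \<and> \<xi> \<le> t \<and> t \<le> b \<and> t - s < \<delta>" for s \<xi> t
    using \<delta>(2)[OF that] eq[of s] eq[of t] that by simp
  then show "\<exists>\<delta>>0. \<forall>s \<xi> t. a \<le> s \<and> s \<le> \<xi> \<and> \<xi> \<le> t \<and> t \<le> b \<and> t - s < \<delta> \<longrightarrow>
      \<bar>F' t - F' s - f \<xi> * (g t - g s)\<bar> \<le> \<epsilon> * (t - s)"
    using \<delta>(1) by blast
qed

text \<open>Only increments are bounded, since signatures do not see the starting point. All
  constants below depend on the path through \<open>\<alpha>\<close>, \<open>B\<close> and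
  \<open>T\<close> alone.\<close>

definition holder_coords :: "real \<Rightarrow> real \<Rightarrow> real \<Rightarrow> (real \<Rightarrow> real ^ 'k::finite) \<Rightarrow> bool" where
  "holder_coords \<alpha> B T z \<longleftrightarrow>
     (\<forall>k s t. 0 \<le> s \<and> s \<le> t \<and> t \<le> T \<longrightarrow> \<bar>z t $ k - z s $ k\<bar> \<le> B * (t - s) powr \<alpha>)"

text \<open>On a degenerate interval all increments vanish, so the zero function is a primitive of
  any integrand.\<close>

lemma rev_signature_0: "rev_signature z 0 (k # v) = 0"
proof -
  have "\<bar>0 - 0 - f \<xi> * (g t - g s)\<bar> \<le> \<epsilon> * (t - s)"
    if "0 \<le> s \<and> s \<le> \<xi> \<and> \<xi> \<le> t \<and> t \<le> 0 \<and> t - s < 1" for f g :: "real \<Rightarrow> real" and \<epsilon> s \<xi> t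
  proof -
    have "s = t" using that by simp
    then show ?thesis by simp
  qed
  then have "rs_primitive 0 0 f g (\<lambda>_. 0)" for f g
    unfolding rs_primitive_def by (blast intro: zero_less_one)
  from rs_primitive_integral(2)[OF this, of 0] show ?thesis by simp
qed

context
  fixes \<alpha> B T :: real
  assumes \<alpha>: "1 / 2 < \<alpha>" "\<alpha> \<le> 1" and B: "0 \<le> B" and T: "0 < T"
begin

text \<open>A primitive that vanishes at \<open>0\<close> is the integral from \<open>0\<close>, so
  the recursive definition inherits the left-point expansion of the Young primitive.\<close>

lemma rev_signature_Cons_local:
  assumes z: "holder_coords \<alpha> B T z" and A: "0 \<le> A"
    and S: "\<And>s t. 0 \<le> s \<Longrightarrow> s \<le> t \<Longrightarrow> t \<le> T \<Longrightarrow>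
      \<bar>rev_signature z t v - rev_signature z s v\<bar> \<le> A * (t - s) powr \<alpha>"
  shows "rs_primitive 0 T (\<lambda>s. rev_signature z s v) (\<lambda>s. z s $ k) (\<lambda>t. rev_signature z t (k # v))"
    and "0 \<le> s \<Longrightarrow> s \<le> t \<Longrightarrow> t \<le> T \<Longrightarrow>
      \<bar>rev_signature z t (k # v) - rev_signature z s (k # v) - rev_signature z s v * (z t $ k - z s $ k)\<bar>
      \<le> young_const \<alpha> * A * B * (t - s) powr (2 * \<alpha>)"
proof -
  have zk: "\<bar>z t $ k - z s $ k\<bar> \<le> B * (t - s) powr \<alpha>" if "0 \<le> s" "s \<le> t" "t \<le> T" for s t
    using z that by (auto simp: holder_coords_def)
  obtain F where F: "F 0 = 0" "\<And>s t. 0 \<le> s \<Longrightarrow> s \<le> t \<Longrightarrow> t \<le> T \<Longrightarrow>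
    \<bar>F t - F s - rev_signature z s v * (z t $ k - z s $ k)\<bar> \<le> young_const \<alpha> * A * B * (t - s) powr (2 * \<alpha>)"
    using young_primitive_exists[OF \<alpha> A B T S zk] by blast
  have prim: "rs_primitive 0 T (\<lambda>s. rev_signature z s v) (\<lambda>s. z s $ k) F"
    using \<alpha> by (intro rs_primitive_powr[OF _ _ _ A B F(2) S zk]) auto
  have eq: "rev_signature z t (k # v) = F t" if "0 \<le> t" "t \<le> T" for t
    using rs_primitive_integral(2)[OF prim that] F(1) by simp
  show "rs_primitive 0 T (\<lambda>s. rev_signature z s v) (\<lambda>s. z s $ k) (\<lambda>t. rev_signature z t (k # v))"
    using prim by (rule rs_primitive_cong) (use eq in auto)
  show "\<bar>rev_signature z t (k # v) - rev_signature z s (k # v) - rev_signature z s v * (z t $ k - z s $ k)\<bar>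
      \<le> young_const \<alpha> * A * B * (t - s) powr (2 * \<alpha>)" if "0 \<le> s" "s \<le> t" "t \<le> T"
    using F(2)[OF that] eq that by simp
qed

text \<open>The constant is quantified before the path: uniformity over a whole ball is what the
  convergence and Lipschitz arguments rely on. In \<open>A'\<close> the first summand is a supremum
  bound times \<open>B\<close>; the second is the Young remainder with one factor
  \<open>(t - s) powr \<alpha>\<close> replaced by \<open>T powr \<alpha>\<close>.\<close>

lemma rev_signature_holder:
  fixes v :: "'k::finite list"
  shows "\<exists>A\<ge>0. \<forall>z :: real \<Rightarrow> real ^ 'k. holder_coords \<alpha> B T z \<longrightarrow>
    (\<forall>s t. 0 \<le> s \<and> s \<le> t \<and> t \<le> T \<longrightarrow> \<bar>rev_signature z t v - rev_signature z s v\<bar> \<le> A * (t - s) powr \<alpha>)"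
proof (induction v)
  case Nil
  show ?case by (intro exI[of _ 0]) auto
next
  case (Cons k v)
  obtain A where A: "0 \<le> A" "\<And>z :: real \<Rightarrow> real ^ 'k. \<And>s t. holder_coords \<alpha> B T z \<Longrightarrow> 0 \<le> s \<Longrightarrow> s \<le> t \<Longrightarrow> t \<le> T \<Longrightarrow>
      \<bar>rev_signature z t v - rev_signature z s v\<bar> \<le> A * (t - s) powr \<alpha>"
    using Cons by blast
  define C where "C = young_const \<alpha> * A * B"
  define A' where "A' = (1 + A * T powr \<alpha>) * B + \<bar>C\<bar> * T powr \<alpha>"
  have "\<bar>rev_signature z t (k # v) - rev_signature z s (k # v)\<bar> \<le> A' * (t - s) powr \<alpha>"
    if z: "holder_coords \<alpha> B T z" and st: "0 \<le> s" "s \<le> t" "t \<le> T" for z :: "real \<Rightarrow> real ^ 'k" and s t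
  proof -
    have loc: "\<bar>rev_signature z t (k # v) - rev_signature z s (k # v) - rev_signature z s v * (z t $ k - z s $ k)\<bar>
        \<le> young_const \<alpha> * A * B * (t - s) powr (2 * \<alpha>)"
      by (rule rev_signature_Cons_local(2)[OF z A(1)]) (use A(2)[OF z] st in auto)
    have S0: "\<bar>rev_signature z 0 v\<bar> \<le> 1" by (cases v) (simp_all add: rev_signature_0 del: rev_signature.simps(2))
    have "\<bar>rev_signature z s v\<bar> \<le> 1 + A * s powr \<alpha>" using A(2)[OF z, of 0 s] S0 st by auto
    also have "\<dots> \<le> 1 + A * T powr \<alpha>"
      using st A(1) \<alpha> by (intro add_left_mono mult_left_mono powr_mono2) auto
    finally have S: "\<bar>rev_signature z s v\<bar> \<le> 1 + A * T powr \<alpha>" .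
    have zk: "\<bar>z t $ k - z s $ k\<bar> \<le> B * (t - s) powr \<alpha>"
      using z st by (auto simp: holder_coords_def)
    have "\<bar>rev_signature z t (k # v) - rev_signature z s (k # v)\<bar> \<le>
        \<bar>rev_signature z s v * (z t $ k - z s $ k)\<bar> + C * (t - s) powr (2 * \<alpha>)"
      using loc[folded C_def] by linarith
    also have "\<bar>rev_signature z s v * (z t $ k - z s $ k)\<bar> \<le> (1 + A * T powr \<alpha>) * (B * (t - s) powr \<alpha>)"
      unfolding abs_mult using S zk by (intro mult_mono) auto
    also have "C * (t - s) powr (2 * \<alpha>) \<le> \<bar>C\<bar> * (T powr \<alpha> * (t - s) powr \<alpha>)"
    proof -
      have "(t - s) powr (2 * \<alpha>) = (t - s) powr \<alpha> * (t - s) powr \<alpha>" by (simp flip: powr_add)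
      also have "\<dots> \<le> T powr \<alpha> * (t - s) powr \<alpha>"
        using st \<alpha> by (intro mult_right_mono powr_mono2) auto
      finally show ?thesis by (intro mult_mono) auto
    qed
    finally show ?thesis by (simp add: A'_def algebra_simps)
  qed
  moreover have "0 \<le> A'" using A(1) B by (simp add: A'_def)
  ultimately show ?case by blast
qed

lemma rev_signature_estimates:
  fixes v :: "'k::finite list"
  obtains C where "0 \<le> C"
    and "\<And>z :: real \<Rightarrow> real ^ 'k. \<And>t. holder_coords \<alpha> B T z \<Longrightarrow> 0 \<le> t \<Longrightarrow> t \<le> T \<Longrightarrow> \<bar>rev_signature z t v\<bar> \<le> C"
    and "\<And>z :: real \<Rightarrow> real ^ 'k. \<And>s t. holder_coords \<alpha> B T z \<Longrightarrow> 0 \<le> s \<Longrightarrow> s \<le> t \<Longrightarrow> t \<le> T \<Longrightarrow>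
      \<bar>rev_signature z t v - rev_signature z s v\<bar> \<le> C * (t - s) powr \<alpha>"
    and "\<And>z :: real \<Rightarrow> real ^ 'k. \<And>k s t. holder_coords \<alpha> B T z \<Longrightarrow> 0 \<le> s \<Longrightarrow> s \<le> t \<Longrightarrow> t \<le> T \<Longrightarrow>
      \<bar>rev_signature z t (k # v) - rev_signature z s (k # v) - rev_signature z s v * (z t $ k - z s $ k)\<bar>
      \<le> C * (t - s) powr (2 * \<alpha>)"
proof -
  obtain A where A: "0 \<le> A" "\<And>z :: real \<Rightarrow> real ^ 'k. \<And>s t. holder_coords \<alpha> B T z \<Longrightarrow> 0 \<le> s \<Longrightarrow> s \<le> t \<Longrightarrow> t \<le> T \<Longrightarrow>
      \<bar>rev_signature z t v - rev_signature z s v\<bar> \<le> A * (t - s) powr \<alpha>"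
    using rev_signature_holder[of v] by blast
  define C where "C = max (1 + A * T powr \<alpha>) (max A (young_const \<alpha> * A * B))"
  have C: "1 + A * T powr \<alpha> \<le> C" "A \<le> C" "young_const \<alpha> * A * B \<le> C" by (auto simp: C_def)
  show thesis
  proof
    show "0 \<le> C" using A(1) C(2) by simp
    fix z :: "real \<Rightarrow> real ^ 'k" and t assume z: "holder_coords \<alpha> B T z" and t: "t \<le> T"
    show "\<bar>rev_signature z t v\<bar> \<le> C" if "0 \<le> t"
    proof -
      have S0: "\<bar>rev_signature z 0 v\<bar> \<le> 1"
        by (cases v) (simp_all add: rev_signature_0 del: rev_signature.simps(2))
      have "\<bar>rev_signature z t v\<bar> \<le> 1 + A * t powr \<alpha>" using A(2)[OF z, of 0 t] S0 t that by auto
      also have "\<dots> \<le> 1 + A * T powr \<alpha>"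
        using that t A(1) \<alpha> by (intro add_left_mono mult_left_mono powr_mono2) auto
      finally show ?thesis using C(1) by simp
    qed
    fix s assume s: "0 \<le> s" "s \<le> t"
    show "\<bar>rev_signature z t v - rev_signature z s v\<bar> \<le> C * (t - s) powr \<alpha>"
      using A(2)[OF z s t] C(2) by (meson mult_right_mono order_trans powr_ge_zero)
    show "\<bar>rev_signature z t (k # v) - rev_signature z s (k # v) - rev_signature z s v * (z t $ k - z s $ k)\<bar>
      \<le> C * (t - s) powr (2 * \<alpha>)" for k
    proof -
      have "\<bar>rev_signature z t (k # v) - rev_signature z s (k # v) - rev_signature z s v * (z t $ k - z s $ k)\<bar>
          \<le> young_const \<alpha> * A * B * (t - s) powr (2 * \<alpha>)"
        by (rule rev_signature_Cons_local(2)[OF z A(1)]) (use A(2)[OF z] s t in auto)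
      then show ?thesis using C(3) by (meson mult_right_mono order_trans powr_ge_zero)
    qed
  qed
qed

lemma continuous_on_rev_signature:
  assumes "holder_coords \<alpha> B T z"
  shows "continuous_on {0..T} (\<lambda>t. rev_signature z t v)"
proof -
  obtain C where "\<And>s t. 0 \<le> s \<Longrightarrow> s \<le> t \<Longrightarrow> t \<le> T \<Longrightarrow>
      \<bar>rev_signature z t v - rev_signature z s v\<bar> \<le> C * (t - s) powr \<alpha>"
    using rev_signature_estimates[of v] assms by metis
  then show ?thesis using \<alpha> by (intro continuous_on_holder[of \<alpha> _ _ C]) auto
qed

lemma rev_signature_sum_local:
  assumes z: "holder_coords \<alpha> B T z"
  shows "\<exists>C. \<forall>s t. 0 \<le> s \<and> s \<le> t \<and> t \<le> T \<longrightarrow>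
    \<bar>(\<Sum>w\<leftarrow>ws. rev_signature z t (k # w)) - (\<Sum>w\<leftarrow>ws. rev_signature z s (k # w)) -
      (\<Sum>w\<leftarrow>ws. rev_signature z s w) * (z t $ k - z s $ k)\<bar> \<le> C * (t - s) powr (2 * \<alpha>)"
proof (induction ws)
  case Nil
  show ?case by (intro exI[of _ 0]) auto
next
  case (Cons w ws)
  let ?S = "\<lambda>t. \<Sum>w\<leftarrow>ws. rev_signature z t (k # w)" and ?S' = "\<lambda>t. \<Sum>w\<leftarrow>ws. rev_signature z t w"
  obtain C where C: "\<And>s t. 0 \<le> s \<and> s \<le> t \<and> t \<le> T \<Longrightarrow>
    \<bar>?S t - ?S s - ?S' s * (z t $ k - z s $ k)\<bar> \<le> C * (t - s) powr (2 * \<alpha>)"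
    using Cons by blast
  obtain D where D: "\<And>s t. 0 \<le> s \<Longrightarrow> s \<le> t \<Longrightarrow> t \<le> T \<Longrightarrow>
      \<bar>rev_signature z t (k # w) - rev_signature z s (k # w) - rev_signature z s w * (z t $ k - z s $ k)\<bar>
      \<le> D * (t - s) powr (2 * \<alpha>)"
    using rev_signature_estimates[of w] z by metis
  have "\<bar>(rev_signature z t (k # w) + ?S t) - (rev_signature z s (k # w) + ?S s) -
      (rev_signature z s w + ?S' s) * (z t $ k - z s $ k)\<bar> \<le> (D + C) * (t - s) powr (2 * \<alpha>)"
    if "0 \<le> s \<and> s \<le> t \<and> t \<le> T" for s t
    using C[OF that] D[of s t] that unfolding distrib_right by linarith
  then show ?case by (intro exI[of _ "D + C"]) (simp del: rev_signature.simps(2))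
qed

text \<open>
  The shuffle identity: both sides of the recursion have the same local expansion up to
  \<open>\<bar>t - s\<bar> powr (2 * \<alpha>)\<close>, so their difference is constant.
\<close>

lemma rev_signature_product:
  fixes u v :: "'k::finite list"
  shows "\<exists>ws. \<forall>z :: real \<Rightarrow> real ^ 'k. holder_coords \<alpha> B T z \<longrightarrow> (\<forall>t. 0 \<le> t \<and> t \<le> T \<longrightarrow>
    rev_signature z t u * rev_signature z t v = (\<Sum>w\<leftarrow>ws. rev_signature z t w))"
proof (induction u v rule: shuffles.induct)
  case (1 v)
  show ?case by (intro exI[of _ "[v]"]) simp
next
  case (2 u)
  show ?case by (intro exI[of _ "[u]"]) simp
next
  case (3 a u b v)
  let ?S = "\<lambda>z t ws. \<Sum>w\<leftarrow>ws. rev_signature z t w"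
  obtain ws1 where ws1: "\<And>z :: real \<Rightarrow> real ^ 'k. \<And>t. holder_coords \<alpha> B T z \<Longrightarrow> 0 \<le> t \<Longrightarrow> t \<le> T \<Longrightarrow>
      rev_signature z t u * rev_signature z t (b # v) = ?S z t ws1" using 3(1) by blast
  obtain ws2 where ws2: "\<And>z :: real \<Rightarrow> real ^ 'k. \<And>t. holder_coords \<alpha> B T z \<Longrightarrow> 0 \<le> t \<Longrightarrow> t \<le> T \<Longrightarrow>
      rev_signature z t (a # u) * rev_signature z t v = ?S z t ws2" using 3(2) by blast
  \<comment> \<open>Heads of reversed words are outermost integration variables; the two halves of
    the list correspond to which of the two is the later one.\<close>
  have "rev_signature z t (a # u) * rev_signature z t (b # v) = ?S z t (map ((#) a) ws1 @ map ((#) b) ws2)"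
    if z: "holder_coords \<alpha> B T z" and t: "0 \<le> t" "t \<le> T" for z :: "real \<Rightarrow> real ^ 'k" and t
  proof -
    define P where "P t = rev_signature z t (a # u)" for t
    define Q where "Q t = rev_signature z t (b # v)" for t
    define X where "X t = (\<Sum>w\<leftarrow>ws1. rev_signature z t (a # w))" for t
    define Y where "Y t = (\<Sum>w\<leftarrow>ws2. rev_signature z t (b # w))" for t
    obtain Cu where Cu: "\<And>s t. 0 \<le> s \<Longrightarrow> s \<le> t \<Longrightarrow> t \<le> T \<Longrightarrow>
        \<bar>P t - P s - rev_signature z s u * (z t $ a - z s $ a)\<bar> \<le> Cu * (t - s) powr (2 * \<alpha>)"
      unfolding P_def using rev_signature_estimates[of u] z by metis
    obtain Cv where Cv: "\<And>s t. 0 \<le> s \<Longrightarrow> s \<le> t \<Longrightarrow> t \<le> T \<Longrightarrow>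
        \<bar>Q t - Q s - rev_signature z s v * (z t $ b - z s $ b)\<bar> \<le> Cv * (t - s) powr (2 * \<alpha>)"
      unfolding Q_def using rev_signature_estimates[of v] z by metis
    obtain Cp where Cp: "0 \<le> Cp" "\<And>t. 0 \<le> t \<Longrightarrow> t \<le> T \<Longrightarrow> \<bar>P t\<bar> \<le> Cp"
        "\<And>s t. 0 \<le> s \<Longrightarrow> s \<le> t \<Longrightarrow> t \<le> T \<Longrightarrow> \<bar>P t - P s\<bar> \<le> Cp * (t - s) powr \<alpha>"
      unfolding P_def using rev_signature_estimates[of "a # u"] z by metis
    obtain Cq where Cq: "0 \<le> Cq" "\<And>t. 0 \<le> t \<Longrightarrow> t \<le> T \<Longrightarrow> \<bar>Q t\<bar> \<le> Cq"
        "\<And>s t. 0 \<le> s \<Longrightarrow> s \<le> t \<Longrightarrow> t \<le> T \<Longrightarrow> \<bar>Q t - Q s\<bar> \<le> Cq * (t - s) powr \<alpha>"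
      unfolding Q_def using rev_signature_estimates[of "b # v"] z by metis
    obtain Cx where Cx: "\<And>s t. 0 \<le> s \<Longrightarrow> s \<le> t \<Longrightarrow> t \<le> T \<Longrightarrow>
        \<bar>X t - X s - (rev_signature z s u * Q s) * (z t $ a - z s $ a)\<bar> \<le> Cx * (t - s) powr (2 * \<alpha>)"
    proof -
      obtain C where "\<And>s t. 0 \<le> s \<and> s \<le> t \<and> t \<le> T \<Longrightarrow>
          \<bar>X t - X s - ?S z s ws1 * (z t $ a - z s $ a)\<bar> \<le> C * (t - s) powr (2 * \<alpha>)"
        unfolding X_def using rev_signature_sum_local[OF z, of a ws1] by blast
      then show thesis using ws1[OF z] that[of C] unfolding Q_def by simp
    qed
    obtain Cy where Cy: "\<And>s t. 0 \<le> s \<Longrightarrow> s \<le> t \<Longrightarrow> t \<le> T \<Longrightarrow>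
        \<bar>Y t - Y s - (P s * rev_signature z s v) * (z t $ b - z s $ b)\<bar> \<le> Cy * (t - s) powr (2 * \<alpha>)"
    proof -
      obtain C where "\<And>s t. 0 \<le> s \<and> s \<le> t \<and> t \<le> T \<Longrightarrow>
          \<bar>Y t - Y s - ?S z s ws2 * (z t $ b - z s $ b)\<bar> \<le> C * (t - s) powr (2 * \<alpha>)"
        unfolding Y_def using rev_signature_sum_local[OF z, of b ws2] by blast
      then show thesis using ws2[OF z] that[of C] unfolding P_def by simp
    qed
    define D where "D t = P t * Q t - X t - Y t" for t
    have "\<bar>D t - D 0\<bar> \<le> 0 * (t - 0)"
    proof (rule increment_bound_powr[OF t(1)])
      show "1 < 2 * \<alpha>" using \<alpha> by simp
      fix r s assume rs: "0 \<le> r" "r \<le> s" "s \<le> t"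
      then have sT: "s \<le> T" using t by simp
      let ?d = "(s - r) powr (2 * \<alpha>)"
      let ?eQ = "Q s - Q r - rev_signature z r v * (z s $ b - z r $ b)"
      let ?eP = "P s - P r - rev_signature z r u * (z s $ a - z r $ a)"
      let ?eX = "X s - X r - (rev_signature z r u * Q r) * (z s $ a - z r $ a)"
      let ?eY = "Y s - Y r - (P r * rev_signature z r v) * (z s $ b - z r $ b)"
      \<comment> \<open>Discrete product rule. As \<open>ws1\<close> and \<open>ws2\<close> expand
        the mixed products, the first-order terms in the letters \<open>a\<close> and
        \<open>b\<close> cancel against those of \<open>X\<close> and \<open>Y\<close>. Four
        expansion errors and a product of two Hoelder increments remain, all of order
        \<open>2 * \<alpha>\<close>.\<close>
      have "D s - D r = P r * ?eQ + Q r * ?eP + (P s - P r) * (Q s - Q r) - ?eX - ?eY"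
        by (simp add: D_def algebra_simps)
      moreover have "\<bar>P r * ?eQ\<bar> \<le> Cp * (Cv * ?d)"
        unfolding abs_mult using Cp(1) Cp(2)[of r] Cv[OF rs(1,2) sT] rs sT by (intro mult_mono) auto
      moreover have "\<bar>Q r * ?eP\<bar> \<le> Cq * (Cu * ?d)"
        unfolding abs_mult using Cq(1) Cq(2)[of r] Cu[OF rs(1,2) sT] rs sT by (intro mult_mono) auto
      moreover have "\<bar>(P s - P r) * (Q s - Q r)\<bar> \<le> Cp * Cq * ?d"
      proof -
        have "\<bar>(P s - P r) * (Q s - Q r)\<bar> \<le> (Cp * (s - r) powr \<alpha>) * (Cq * (s - r) powr \<alpha>)"
          unfolding abs_mult using Cp(1) Cp(3)[OF rs(1,2) sT] Cq(3)[OF rs(1,2) sT] by (intro mult_mono) auto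
        also have "\<dots> = Cp * Cq * ?d" by (simp flip: powr_add)
        finally show ?thesis .
      qed
      moreover note Cx[OF rs(1,2) sT] Cy[OF rs(1,2) sT]
      ultimately have "\<bar>D s - D r\<bar> \<le> Cp * (Cv * ?d) + Cq * (Cu * ?d) + Cp * Cq * ?d + Cx * ?d + Cy * ?d"
        by linarith
      then show "\<bar>D s - D r\<bar> \<le> 0 * (s - r) + (Cp * Cv + Cq * Cu + Cp * Cq + Cx + Cy) * ?d"
        by (simp add: algebra_simps)
    qed
    moreover have "D 0 = 0"
      by (simp add: D_def P_def Q_def X_def Y_def rev_signature_0 del: rev_signature.simps(2))
    ultimately have "P t * Q t = X t + Y t" by (simp add: D_def)
    then show ?thesis by (simp add: P_def Q_def X_def Y_def o_def del: rev_signature.simps(2))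
  qed
  then show ?case by blast
qed

end

section \<open>Compact sets of Hoelder paths\<close>

text \<open>The bound is imposed on every increment instead of on \<open>holder_seminorm\<close>, so
  that the set is visibly closed under pointwise limits.\<close>

definition holder_ball :: "real \<Rightarrow> real \<Rightarrow> 'a::euclidean_space \<Rightarrow> real \<Rightarrow> (real \<Rightarrow> 'a) set" where
  "holder_ball \<alpha> T y\<^sub>0 R =
     {y \<in> extensional {0..T}. y 0 = y\<^sub>0 \<and>
        (\<forall>s t. 0 \<le> s \<and> s \<le> t \<and> t \<le> T \<longrightarrow> norm (y t - y s) \<le> R * (t - s) powr \<alpha>)}"

lemma holder_ball_abs:
  assumes "y \<in> holder_ball \<alpha> T y\<^sub>0 R" "s \<in> {0..T}" "t \<in> {0..T}"
  shows "norm (y t - y s) \<le> R * \<bar>t - s\<bar> powr \<alpha>"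
proof (cases "s \<le> t")
  case False
  then have "norm (y s - y t) \<le> R * (s - t) powr \<alpha>" using assms by (auto simp: holder_ball_def)
  then show ?thesis using False by (simp add: norm_minus_commute)
qed (use assms in \<open>auto simp: holder_ball_def\<close>)

lemma holder_ball_subset_paths: "holder_ball \<alpha> T y\<^sub>0 R \<subseteq> holder_paths \<alpha> T"
  unfolding holder_ball_def holder_paths_def
  by (auto intro!: bdd_above_holder_quotientsI[of T _ R \<alpha>])

lemma continuous_on_holder_ball:
  assumes "0 < \<alpha>" "y \<in> holder_ball \<alpha> T y\<^sub>0 R"
  shows "continuous_on {0..T} y"
  using assms by (intro continuous_on_holder[of \<alpha> _ _ R]) (auto simp: holder_ball_def)

lemma compact_holder_ball:
  assumes "0 \<le> T" "0 \<le> \<alpha>" "0 \<le> R"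
  shows "compact (holder_ball \<alpha> T y\<^sub>0 R)"
proof -
  \<comment> \<open>Singletons outside \<open>{0..T}\<close> place extensional paths in a product of
    compact sets.\<close>
  define C where "C s = (if s \<in> {0..T} then cball y\<^sub>0 (R * T powr \<alpha>) else {undefined})" for s
  have "compactin (product_topology (\<lambda>_. euclidean) UNIV) (PiE UNIV C)"
    by (subst compactin_PiE) (auto simp: C_def)
  then have "compact (PiE UNIV C)" by (simp add: euclidean_product_topology)
  moreover have "holder_ball \<alpha> T y\<^sub>0 R \<subseteq> PiE UNIV C"
  proof
    fix y assume y: "y \<in> holder_ball \<alpha> T y\<^sub>0 R"
    have "norm (y s - y\<^sub>0) \<le> R * T powr \<alpha>" if "s \<in> {0..T}" for s
    proof -
      have "norm (y s - y 0) \<le> R * s powr \<alpha>" using holder_ball_abs[OF y, of 0 s] that assms(1) by simp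
      also have "\<dots> \<le> R * T powr \<alpha>" using that assms by (intro mult_left_mono powr_mono2) auto
      finally show ?thesis using y by (simp add: holder_ball_def)
    qed
    moreover have "y s = undefined" if "s \<notin> {0..T}" for s
      using y that by (auto simp: holder_ball_def extensional_def)
    ultimately show "y \<in> PiE UNIV C" by (auto simp: C_def dist_norm norm_minus_commute)
  qed
  moreover have "closed (holder_ball \<alpha> T y\<^sub>0 R)"
  proof -
    have [continuous_intros]: "continuous_on UNIV (\<lambda>y. y s)" for s :: real by simp
    have "holder_ball \<alpha> T y\<^sub>0 R = (\<Inter>s\<in>-{0..T}. {y. y s = undefined}) \<inter> {y. y 0 = y\<^sub>0} \<inter>
        (\<Inter>(s, t)\<in>{(s, t). 0 \<le> s \<and> s \<le> t \<and> t \<le> T}. {y. norm (y t - y s) \<le> R * (t - s) powr \<alpha>})"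
      by (auto simp: holder_ball_def extensional_def)
    also have "closed \<dots>"
      by (intro closed_Int closed_INT ballI)
        (auto intro!: closed_Collect_eq closed_Collect_le continuous_intros)
    finally show ?thesis .
  qed
  ultimately show ?thesis by (metis compact_Int_closed inf.absorb_iff2)
qed

text \<open>For pointwise convergence alone, evaluation is not jointly continuous in time and path.
  The common Hoelder modulus of the ball makes the error of moving the time uniform over the
  paths.\<close>

lemma continuous_on_evaluation:
  assumes "0 < \<alpha>"
  shows "continuous_on ({0..T} \<times> holder_ball \<alpha> T y\<^sub>0 R) (\<lambda>p. snd p (fst p))"
  unfolding continuous_on_def
proof
  let ?A = "{0..T} \<times> holder_ball \<alpha> T y\<^sub>0 R"
  fix p assume p: "p \<in> ?A"
  let ?F = "at p within ?A"
  have fst: "((\<lambda>q. fst q) \<longlongrightarrow> fst p) ?F" by (intro tendsto_intros)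
  have "continuous_on ?A (\<lambda>q. snd q (fst p))"
    by (rule continuous_on_compose2[OF continuous_on_product_coordinates[of "fst p"]
          continuous_on_snd[OF continuous_on_id]]) auto
  then have ev: "((\<lambda>q. snd q (fst p)) \<longlongrightarrow> snd p (fst p)) ?F"
    using p unfolding continuous_on_def by blast
  have "((\<lambda>q. \<bar>fst q - fst p\<bar> powr \<alpha>) \<longlongrightarrow> \<bar>fst p - fst p\<bar> powr \<alpha>) ?F"
    using assms by (intro tendsto_powr' tendsto_intros) auto
  then have "((\<lambda>q. R * \<bar>fst q - fst p\<bar> powr \<alpha>) \<longlongrightarrow> 0) ?F"
    by (intro tendsto_mult_right_zero) simp
  moreover have "eventually (\<lambda>q. norm (snd q (fst q) - snd q (fst p)) \<le> R * \<bar>fst q - fst p\<bar> powr \<alpha>) ?F"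
    using p by (auto simp: eventually_at_filter intro!: holder_ball_abs always_eventually)
  ultimately have "((\<lambda>q. snd q (fst q) - snd q (fst p)) \<longlongrightarrow> 0) ?F"
    by (rule Lim_null_comparison[rotated])
  from tendsto_add[OF this ev] show "((\<lambda>q. snd q (fst q)) \<longlongrightarrow> snd p (fst p)) ?F" by simp
qed

section \<open>Stopped paths and the comparison of topologies\<close>

lemma stopped_in_holder_ball:
  assumes "0 \<le> \<alpha>" "0 \<le> R" "t \<in> {0..T}" "y \<in> holder_ball \<alpha> T y\<^sub>0 R"
  shows "stopped T t y \<in> holder_ball \<alpha> T y\<^sub>0 R"
proof -
  have "norm (y (min r t) - y (min s t)) \<le> R * (r - s) powr \<alpha>" if "0 \<le> s" "s \<le> r" "r \<le> T" for s r
  proof -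
    have "norm (y (min r t) - y (min s t)) \<le> R * (min r t - min s t) powr \<alpha>"
      using holder_ball_abs[OF assms(4), of "min s t" "min r t"] assms(3) that by (auto simp: min_def)
    also have "\<dots> \<le> R * (r - s) powr \<alpha>"
      using assms that by (intro mult_left_mono powr_mono2) auto
    finally show ?thesis .
  qed
  then show ?thesis using assms by (auto simp: holder_ball_def stopped_def)
qed

definition stopped_ball ::
  "real \<Rightarrow> real \<Rightarrow> 'a::euclidean_space \<Rightarrow> real \<Rightarrow> (real \<times> (real \<Rightarrow> 'a)) set" where
  "stopped_ball \<alpha> T y\<^sub>0 R = (\<lambda>p. (fst p, stopped T (fst p) (snd p))) ` ({0..T} \<times> holder_ball \<alpha> T y\<^sub>0 R)"

lemma stopped_ball_subset:
  assumes "0 \<le> \<alpha>" "0 \<le> R"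
  shows "stopped_ball \<alpha> T y\<^sub>0 R \<subseteq> {0..T} \<times> holder_ball \<alpha> T y\<^sub>0 R"
  using stopped_in_holder_ball[OF assms, of _ T _ y\<^sub>0] by (auto simp: stopped_ball_def)

lemma stopped_ball_subset_stopped_paths: "stopped_ball \<alpha> T y\<^sub>0 R \<subseteq> stopped_paths \<alpha> T"
  using holder_ball_subset_paths by (fastforce simp: stopped_ball_def stopped_paths_def)

text \<open>Coordinate \<open>s\<close> of the path stopped at \<open>t\<close> is evaluation at
  \<open>min s t\<close>, so joint continuity of evaluation suffices. Compactness of
  \<open>stopped_ball\<close> follows because it is the image of a compact product.\<close>

lemma continuous_on_stopping:
  assumes "0 < \<alpha>" "0 \<le> T"
  shows "continuous_on ({0..T} \<times> holder_ball \<alpha> T y\<^sub>0 R) (\<lambda>p. (fst p, stopped T (fst p) (snd p)))"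
proof (intro continuous_on_Pair continuous_on_fst continuous_on_id continuous_on_coordinatewise_then_product)
  fix s
  show "continuous_on ({0..T} \<times> holder_ball \<alpha> T y\<^sub>0 R) (\<lambda>p. stopped T (fst p) (snd p) s)"
  proof (cases "s \<in> {0..T}")
    case True
    have "continuous_on ({0..T} \<times> holder_ball \<alpha> T y\<^sub>0 R)
        (\<lambda>p. snd (min s (fst p), snd p) (fst (min s (fst p), snd p)))"
      using True
      by (intro continuous_on_compose2[OF continuous_on_evaluation[OF assms(1), of T y\<^sub>0 R]] continuous_intros) auto
    then show ?thesis using True by (simp add: stopped_def)
  next
    case False
    then have "stopped T t y s = undefined" for t and y :: "real \<Rightarrow> 'a" by (auto simp: stopped_def)
    then show ?thesis by simp
  qed
qed

lemma compact_stopped_ball: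
  assumes "0 \<le> T" "0 < \<alpha>" "0 \<le> R"
  shows "compact (stopped_ball \<alpha> T y\<^sub>0 R)"
  unfolding stopped_ball_def
  using assms by (intro compact_continuous_image continuous_on_stopping compact_Times compact_holder_ball) auto

lemma powr_small:
  fixes C p e :: real
  assumes "0 < p" "0 < e" "0 \<le> C"
  shows "\<exists>\<delta>>0. \<forall>\<kappa>. 0 \<le> \<kappa> \<and> \<kappa> \<le> \<delta> \<longrightarrow> C * \<kappa> powr p \<le> e"
proof -
  define \<delta> where "\<delta> = (e / (C + 1)) powr (1 / p)"
  have "0 < \<delta>" using assms by (simp add: \<delta>_def)
  moreover have "C * \<kappa> powr p \<le> e" if "0 \<le> \<kappa>" "\<kappa> \<le> \<delta>" for \<kappa>
  proof -
    have "C * \<kappa> powr p \<le> C * \<delta> powr p" using that assms by (intro mult_left_mono powr_mono2) auto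
    also have "\<dots> = C * (e / (C + 1))" using assms by (simp add: \<delta>_def powr_powr)
    also have "\<dots> \<le> e" using assms by (simp add: field_simps)
    finally show ?thesis .
  qed
  ultimately show ?thesis by blast
qed

text \<open>
  Increments over short intervals are small because \<open>\<beta> < \<alpha>\<close>, those over long intervals because the
  paths are close at finitely many times and hence uniformly.
\<close>

lemma holder_dist_small_nbhd:
  assumes T: "0 < T" and \<beta>: "0 < \<beta>" "\<beta> < \<alpha>" and R: "0 \<le> R" and \<epsilon>: "0 < \<epsilon>"
    and y: "y \<in> holder_ball \<alpha> T y\<^sub>0 R"
  shows "\<exists>U. open U \<and> y \<in> U \<and> (\<forall>z \<in> U \<inter> holder_ball \<alpha> T y\<^sub>0 R. holder_dist \<beta> T z y < \<epsilon>)"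
proof -
  \<comment> \<open>\<open>\<kappa>\<close> separates short from long intervals,
    \<open>\<eta>\<close> is the uniform distance tolerated on the long ones, and
    \<open>\<delta>\<close> is a grid width below which the two paths together oscillate by at most
    \<open>\<eta> / 2\<close>. The other half of \<open>\<eta>\<close> is left for the distance at
    the grid points.\<close>
  obtain \<kappa> where \<kappa>: "0 < \<kappa>" "2 * R * \<kappa> powr (\<alpha> - \<beta>) \<le> \<epsilon> / 2"
    using powr_small[of "\<alpha> - \<beta>" "\<epsilon> / 2" "2 * R"] \<beta> R \<epsilon> by force
  define \<eta> where "\<eta> = \<kappa> powr \<beta> * \<epsilon> / 4"
  have \<eta>: "0 < \<eta>" "2 * \<eta> = \<epsilon> / 2 * \<kappa> powr \<beta>" using \<kappa> \<epsilon> by (auto simp: \<eta>_def)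
  obtain \<delta> where \<delta>: "0 < \<delta>" "\<And>\<kappa>. 0 \<le> \<kappa> \<Longrightarrow> \<kappa> \<le> \<delta> \<Longrightarrow> 2 * R * \<kappa> powr \<alpha> \<le> \<eta> / 2"
    using powr_small[of \<alpha> "\<eta> / 2" "2 * R"] \<beta> R \<eta>(1) by force
  obtain n :: nat where n: "T / \<delta> < real n" using reals_Archimedean2 by blast
  have "0 < T / \<delta>" using T \<delta>(1) by simp
  with n have n0: "0 < real n" by linarith
  define h where "h = T / real n"
  have h: "0 < h" "h \<le> \<delta>" "real n * h = T" using n n0 T \<delta>(1) by (auto simp: h_def field_simps)
  define U where "U = {z. \<forall>i\<in>{..n}. z (real i * h) \<in> ball (y (real i * h)) (\<eta> / 2)}"
  have "open U" unfolding U_def by (rule product_topology_basis') auto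
  moreover have "y \<in> U" using \<eta> by (simp add: U_def)
  moreover have "holder_dist \<beta> T z y < \<epsilon>" if z: "z \<in> U \<inter> holder_ball \<alpha> T y\<^sub>0 R" for z
  proof -
    have z': "z \<in> holder_ball \<alpha> T y\<^sub>0 R" using z by simp
    have sup: "norm (z t - y t) \<le> \<eta>" if t: "t \<in> {0..T}" for t
    proof -
      define i where "i = nat \<lfloor>t / h\<rfloor>"
      have fl: "real i = of_int \<lfloor>t / h\<rfloor>" using t h by (simp add: i_def)
      have i1: "real i \<le> t / h" "t / h < real i + 1" unfolding fl by linarith+
      have i: "real i * h \<le> t" "t - real i * h \<le> h" using i1 h(1) by (auto simp: field_simps)
      have "real i * h \<le> real n * h" using i(1) t h(3) by simp
      then have "i \<le> n" using h(1) by simp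
      then have c: "norm (z (real i * h) - y (real i * h)) \<le> \<eta> / 2"
        using z by (force simp: U_def dist_norm norm_minus_commute)
      have "norm (z t - z (real i * h)) \<le> R * (t - real i * h) powr \<alpha>"
        "norm (y t - y (real i * h)) \<le> R * (t - real i * h) powr \<alpha>"
        using z' y i t h(1) by (auto simp: holder_ball_def)
      moreover have "2 * R * (t - real i * h) powr \<alpha> \<le> \<eta> / 2" using i h(2) by (intro \<delta>(2)) auto
      moreover have "z t - y t = (z t - z (real i * h)) + (z (real i * h) - y (real i * h)) - (y t - y (real i * h))"
        by simp
      then have "norm (z t - y t) \<le> norm (z t - z (real i * h)) + norm (z (real i * h) - y (real i * h)) +
          norm (y t - y (real i * h))"
        using norm_triangle_ineq4[of "(z t - z (real i * h)) + (z (real i * h) - y (real i * h))" "y t - y (real i * h)"]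
          norm_triangle_ineq[of "z t - z (real i * h)" "z (real i * h) - y (real i * h)"] by simp
      ultimately show ?thesis using c by linarith
    qed
    have "holder_seminorm \<beta> T (\<lambda>t. z t - y t) \<le> \<epsilon> / 2"
    proof (rule holder_seminorm_leI)
      fix s t assume st: "0 \<le> s" "s < t" "t \<le> T"
      show "norm (z t - y t - (z s - y s)) \<le> \<epsilon> / 2 * (t - s) powr \<beta>"
      proof (cases "t - s \<le> \<kappa>")
        case True
        have "norm (z t - y t - (z s - y s)) \<le> norm (z t - z s) + norm (y t - y s)"
          using norm_triangle_ineq4[of "z t - z s" "y t - y s"] by (simp add: algebra_simps)
        also have "\<dots> \<le> 2 * R * (t - s) powr \<alpha>"
          using holder_ball_abs[OF z', of s t] holder_ball_abs[OF y, of s t] st by auto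
        also have "\<dots> = 2 * R * (t - s) powr (\<alpha> - \<beta>) * (t - s) powr \<beta>" by (simp flip: powr_add)
        also have "\<dots> \<le> 2 * R * \<kappa> powr (\<alpha> - \<beta>) * (t - s) powr \<beta>"
          using True st \<beta> R by (intro mult_right_mono mult_left_mono powr_mono2) auto
        also have "\<dots> \<le> \<epsilon> / 2 * (t - s) powr \<beta>" using \<kappa>(2) by (intro mult_right_mono) auto
        finally show ?thesis .
      next
        case False
        have "norm (z t - y t - (z s - y s)) \<le> 2 * \<eta>"
          using norm_triangle_ineq4[of "z t - y t" "z s - y s"] sup[of t] sup[of s] st by auto
        also have "\<dots> \<le> \<epsilon> / 2 * (t - s) powr \<beta>"
          unfolding \<eta>(2) using False \<kappa>(1) \<beta> \<epsilon> by (intro mult_left_mono powr_mono2) auto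
        finally show ?thesis .
      qed
    qed (use \<epsilon> in simp)
    moreover have "z 0 = y 0" using z' y by (simp add: holder_ball_def)
    ultimately show ?thesis using \<epsilon> by (simp add: holder_dist_def)
  qed
  ultimately show ?thesis by blast
qed

text \<open>On the ball the identity from the pointwise topology to the Hoelder metric is
  continuous, so compactness carries over. On these sets the local Lipschitz hypothesis on the
  functional is invoked.\<close>

lemma compactin_holder_ball:
  assumes T: "0 < T" and \<beta>: "0 < \<beta>" "\<beta> < \<alpha>" and R: "0 \<le> R"
  shows "compactin (holder_topology \<alpha> \<beta> T) (holder_ball \<alpha> T (y\<^sub>0 :: 'a::euclidean_space) R)"
proof -
  interpret M: Metric_space "holder_paths \<alpha> T :: (real \<Rightarrow> 'a) set" "holder_dist \<beta> T"
    using T \<beta> by (intro Metric_space_holder) auto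
  let ?B = "holder_ball \<alpha> T y\<^sub>0 R"
  have "continuous_map (top_of_set ?B) M.mtopology (\<lambda>y. y)"
    unfolding M.continuous_map_to_metric
  proof (intro ballI allI impI)
    fix y and \<epsilon> :: real assume y: "y \<in> topspace (top_of_set ?B)" and \<epsilon>: "0 < \<epsilon>"
    then obtain U where U: "open U" "y \<in> U" "\<And>z. z \<in> U \<inter> ?B \<Longrightarrow> holder_dist \<beta> T z y < \<epsilon>"
      using holder_dist_small_nbhd[OF T \<beta> R \<epsilon>, of y y\<^sub>0] by auto
    have "\<forall>z\<in>?B \<inter> U. z \<in> M.mball y \<epsilon>"
      using U(3) y holder_ball_subset_paths[of \<alpha> T y\<^sub>0 R] by (auto simp: M.commute)
    then show "\<exists>V. openin (top_of_set ?B) V \<and> y \<in> V \<and> (\<forall>z\<in>V. z \<in> M.mball y \<epsilon>)"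
      using U(1,2) y by (intro exI[of _ "?B \<inter> U"]) auto
  qed
  moreover have "compactin (top_of_set ?B) ?B"
    using compact_holder_ball[of T \<alpha> R] T \<beta> R by (simp add: compactin_subtopology)
  ultimately have "compactin M.mtopology ((\<lambda>y. y) ` ?B)" by (rule image_compactin[rotated])
  then show ?thesis by (simp add: holder_topology_def)
qed

text \<open>The same comparison of topologies turns continuity for the stopped metric into
  continuity for the product topology, in which Stone-Weierstrass is applied.\<close>

lemma continuous_on_stopped_ball:
  fixes f :: "real \<times> (real \<Rightarrow> 'a::euclidean_space) \<Rightarrow> 'b::topological_space"
  assumes T: "0 < T" and \<beta>: "0 < \<beta>" "\<beta> < \<alpha>" and R: "0 \<le> R"
    and f: "continuous_map (stopped_topology \<alpha> \<beta> T) euclidean f"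
  shows "continuous_on (stopped_ball \<alpha> T y\<^sub>0 R) f"
proof -
  interpret M: Metric_space "stopped_paths \<alpha> T :: (real \<times> (real \<Rightarrow> 'a)) set" "stopped_dist \<beta> T"
    using T \<beta> by (intro Metric_space_stopped) auto
  let ?B = "stopped_ball \<alpha> T y\<^sub>0 R"
  have "continuous_map (top_of_set ?B) M.mtopology (\<lambda>p. p)"
    unfolding M.continuous_map_to_metric
  proof (intro ballI allI impI)
    fix p and \<epsilon> :: real assume p: "p \<in> topspace (top_of_set ?B)" and \<epsilon>: "0 < \<epsilon>"
    have sub: "?B \<subseteq> {0..T} \<times> holder_ball \<alpha> T y\<^sub>0 R" using \<beta> R by (intro stopped_ball_subset) auto
    then have "snd p \<in> holder_ball \<alpha> T y\<^sub>0 R" using p by auto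
    then obtain U where U: "open U" "snd p \<in> U"
        "\<And>z. z \<in> U \<inter> holder_ball \<alpha> T y\<^sub>0 R \<Longrightarrow> holder_dist \<beta> T z (snd p) < \<epsilon> / 2"
      using holder_dist_small_nbhd[OF T \<beta> R, of "\<epsilon> / 2" "snd p" y\<^sub>0] \<epsilon> by auto
    let ?V = "ball (fst p) (\<epsilon> / 2) \<times> U"
    have "q \<in> M.mball p \<epsilon>" if q: "q \<in> ?B" "q \<in> ?V" for q
    proof -
      have "snd q \<in> U \<inter> holder_ball \<alpha> T y\<^sub>0 R" using q sub by auto
      then have "holder_dist \<beta> T (snd q) (snd p) < \<epsilon> / 2" by (rule U(3))
      moreover have "\<bar>fst q - fst p\<bar> < \<epsilon> / 2" using q by (auto simp: dist_real_def abs_minus_commute)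
      ultimately have "stopped_dist \<beta> T q p < \<epsilon>" by (simp add: stopped_dist_def case_prod_beta)
      then show ?thesis using p q stopped_ball_subset_stopped_paths[of \<alpha> T y\<^sub>0 R] by (auto simp: M.commute)
    qed
    then show "\<exists>V. openin (top_of_set ?B) V \<and> p \<in> V \<and> (\<forall>q\<in>V. q \<in> M.mball p \<epsilon>)"
      using U(1,2) p \<epsilon> by (intro exI[of _ "?B \<inter> ?V"]) (auto simp: mem_Times_iff intro!: open_Times)
  qed
  then have "continuous_map (top_of_set ?B) (stopped_topology \<alpha> \<beta> T) (\<lambda>p. p)"
    by (simp add: stopped_topology_def)
  from continuous_map_compose[OF this f] show ?thesis
    by (simp add: o_def continuous_map_iff_continuous)
qed

section \<open>Density of linear functionals of the signature\<close>

lemma has_rs_integral_cong: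
  assumes "\<And>r. r \<in> {a..b} \<Longrightarrow> f r = f' r" "\<And>r. r \<in> {a..b} \<Longrightarrow> g r = g' r"
  shows "has_rs_integral a b f g = has_rs_integral a b f' g'"
proof -
  have "(\<Sum>(\<xi>, K)\<in>p. f \<xi> * (g (Sup K) - g (Inf K))) = (\<Sum>(\<xi>, K)\<in>p. f' \<xi> * (g' (Sup K) - g' (Inf K)))"
    if p: "p tagged_division_of {a..b}" for p
  proof (rule sum.cong[OF refl], clarify)
    fix \<xi> K assume mem: "(\<xi>, K) \<in> p"
    obtain u v where K: "K = {u..v}" "\<xi> \<in> K"
      using tagged_division_ofD(2,4)[OF p mem] by auto
    moreover have "K \<subseteq> {a..b}" using tagged_division_ofD(3)[OF p mem] .
    ultimately have "\<xi> \<in> {a..b}" "Sup K \<in> {a..b}" "Inf K \<in> {a..b}" by auto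
    then show "f \<xi> * (g (Sup K) - g (Inf K)) = f' \<xi> * (g' (Sup K) - g' (Inf K))"
      using assms by simp
  qed
  then show ?thesis unfolding has_rs_integral_def by (intro ext) (simp cong: conj_cong)
qed

lemma rs_integral_cong:
  assumes "\<And>r. r \<in> {a..b} \<Longrightarrow> f r = f' r" "\<And>r. r \<in> {a..b} \<Longrightarrow> g r = g' r"
  shows "rs_integral a b f g = rs_integral a b f' g'" "rs_integrable a b f g = rs_integrable a b f' g'"
  unfolding rs_integral_def rs_integrable_def using has_rs_integral_cong[of a b f f' g g'] assms by simp_all

lemma rev_signature_cong:
  assumes "\<And>r. r \<in> {0..t} \<Longrightarrow> z r = z' r"
  shows "rev_signature z t v = rev_signature z' t v"
  using assms
proof (induction v arbitrary: t)
  case (Cons k v)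
  then show ?case by (auto intro!: rs_integral_cong)
qed simp

text \<open>Iterated integrals up to \<open>t\<close> use the path on \<open>{0..t}\<close> only,
  where stopping changes nothing.\<close>

lemma signature_stopped:
  assumes "t \<in> {0..T}"
  shows "signature (time_augmented (stopped T t y)) t v = signature (time_augmented y) t v"
  unfolding signature_def
  by (rule rev_signature_cong) (use assms in \<open>auto simp: time_augmented_def stopped_def\<close>)

lemma rev_signature_single:
  assumes "0 \<le> t"
  shows "rev_signature z t [k] = z t $ k - z 0 $ k"
  using rs_primitive_integral(2)[OF rs_primitive_const assms order_refl, of 1] by simp

lemma time_augmented_holder_coords:
  assumes "y \<in> holder_ball \<alpha> T y\<^sub>0 R" "\<alpha> \<le> 1" "0 \<le> R"
  shows "holder_coords \<alpha> (R + T powr (1 - \<alpha>)) T (time_augmented y)"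
  unfolding holder_coords_def
proof (intro allI impI)
  fix k s t assume st: "0 \<le> s \<and> s \<le> t \<and> t \<le> T"
  show "\<bar>time_augmented y t $ k - time_augmented y s $ k\<bar> \<le> (R + T powr (1 - \<alpha>)) * (t - s) powr \<alpha>"
  proof (cases k)
    case None
    have "t - s = (t - s) powr (1 - \<alpha>) * (t - s) powr \<alpha>"
      using st by (cases "s = t") (auto simp flip: powr_add)
    also have "\<dots> \<le> T powr (1 - \<alpha>) * (t - s) powr \<alpha>"
      using st assms by (intro mult_right_mono powr_mono2) auto
    also have "\<dots> \<le> (R + T powr (1 - \<alpha>)) * (t - s) powr \<alpha>" using assms by (intro mult_right_mono) auto
    finally show ?thesis using None st by (simp add: time_augmented_def)
  next
    case (Some i)
    have "\<bar>y t $ i - y s $ i\<bar> \<le> norm (y t - y s)" using component_le_norm_cart[of "y t - y s" i] by simp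
    also have "\<dots> \<le> R * (t - s) powr \<alpha>" using assms st by (auto simp: holder_ball_def)
    also have "\<dots> \<le> (R + T powr (1 - \<alpha>)) * (t - s) powr \<alpha>" by (intro mult_right_mono) auto
    finally show ?thesis using Some by (simp add: time_augmented_def)
  qed
qed

text \<open>A continuous injection of a compact set into a Hausdorff space is a homeomorphism onto
  its image. The algebra \<open>P\<close> is transported there, the approximation is made there, and
  the result is pulled back.\<close>

lemma Stone_Weierstrass_injection:
  fixes K :: "'a::topological_space set" and e :: "'a \<Rightarrow> 'b::t2_space"
  assumes K: "compact K" and e: "continuous_on K e" "inj_on e K"
    and const: "\<And>c. P (\<lambda>_. c :: real)"
    and cont: "\<And>h. P h \<Longrightarrow> continuous_on K h"
    and add: "\<And>h h'. P h \<Longrightarrow> P h' \<Longrightarrow> P (\<lambda>x. h x + h' x)"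
    and mult: "\<And>h h'. P h \<Longrightarrow> P h' \<Longrightarrow> P (\<lambda>x. h x * h' x)"
    and sep: "\<And>x y. x \<in> K \<Longrightarrow> y \<in> K \<Longrightarrow> x \<noteq> y \<Longrightarrow> \<exists>h. P h \<and> h x \<noteq> h y"
    and f: "continuous_on K f" and \<epsilon>: "0 < \<epsilon>"
  shows "\<exists>h. P h \<and> (\<forall>x\<in>K. \<bar>f x - h x\<bar> < \<epsilon>)"
proof -
  define e' where "e' = the_inv_into K e"
  have e': "e' (e x) = x" if "x \<in> K" for x using that e(2) by (simp add: e'_def the_inv_into_f_f)
  have ce': "continuous_on (e ` K) e'" using e' by (intro continuous_on_inv[OF e(1) K]) auto
  have im: "e' ` e ` K \<subseteq> K" using e' by auto
  define P' where "P' q \<longleftrightarrow> (\<exists>h. P h \<and> q = (\<lambda>x. h (e' x)))" for q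
  have "\<exists>q. P' q \<and> (\<forall>x\<in>e ` K. \<bar>f (e' x) - q x\<bar> < \<epsilon>)"
  proof (rule Stone_Weierstrass_HOL)
    show "compact (e ` K)" by (rule compact_continuous_image[OF e(1) K])
    show "P' (\<lambda>x. c)" for c unfolding P'_def using const by fast
    show "continuous_on (e ` K) q" if "P' q" for q
      using that cont continuous_on_compose2[OF _ ce' im] unfolding P'_def by blast
    show "P' (\<lambda>x. q x + q' x)" if "P' q \<and> P' q'" for q q'
    proof -
      obtain h h' where "P h" "P h'" "q = (\<lambda>x. h (e' x))" "q' = (\<lambda>x. h' (e' x))"
        using \<open>P' q \<and> P' q'\<close> unfolding P'_def by blast
      then show ?thesis unfolding P'_def using add[of h h'] by (intro exI[of _ "\<lambda>x. h x + h' x"]) auto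
    qed
    show "P' (\<lambda>x. q x * q' x)" if "P' q \<and> P' q'" for q q'
    proof -
      obtain h h' where "P h" "P h'" "q = (\<lambda>x. h (e' x))" "q' = (\<lambda>x. h' (e' x))"
        using \<open>P' q \<and> P' q'\<close> unfolding P'_def by blast
      then show ?thesis unfolding P'_def using mult[of h h'] by (intro exI[of _ "\<lambda>x. h x * h' x"]) auto
    qed
    show "\<exists>q. P' q \<and> q x \<noteq> q y" if xy: "x \<in> e ` K \<and> y \<in> e ` K \<and> x \<noteq> y" for x y
    proof -
      obtain u v where uv: "u \<in> K" "v \<in> K" "x = e u" "y = e v" "u \<noteq> v" using xy by auto
      then obtain h where "P h" "h u \<noteq> h v" using sep by blast
      then show ?thesis unfolding P'_def using uv e' by (intro exI[of _ "\<lambda>x. h (e' x)"]) auto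
    qed
    show "continuous_on (e ` K) (\<lambda>x. f (e' x))" by (rule continuous_on_compose2[OF f ce' im])
  qed (rule \<epsilon>)
  then obtain h where "P h" "\<forall>x\<in>e ` K. \<bar>f (e' x) - h (e' x)\<bar> < \<epsilon>" unfolding P'_def by blast
  then show ?thesis using e' by auto
qed

text \<open>All polynomials are orthogonal to \<open>\<phi>\<close>, so for a polynomial
  \<open>p\<close> within \<open>e\<close> of \<open>\<phi>\<close> the integral of
  \<open>\<phi> * \<phi>\<close> equals that of \<open>(\<phi> - p) * \<phi>\<close> and is at most
  \<open>e * M\<close>.\<close>

lemma continuous_moments_zero:
  fixes \<phi> :: "real \<Rightarrow> real"
  assumes t: "0 < t" and \<phi>: "continuous_on {0..t} \<phi>"
    and mom: "\<And>n::nat. integral {0..t} (\<lambda>r. r ^ n * \<phi> r) = 0"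
    and r: "r \<in> {0..t}"
  shows "\<phi> r = 0"
proof -
  have int: "(\<lambda>r. h r) integrable_on {0..t}" if "continuous_on {0..t} h" for h :: "real \<Rightarrow> real"
    using that by (rule integrable_continuous_interval)
  define M where "M = integral {0..t} (\<lambda>r. \<bar>\<phi> r\<bar>)"
  have M: "0 \<le> M" unfolding M_def by (intro Henstock_Kurzweil_Integration.integral_nonneg int continuous_intros \<phi>) auto
  have small: "integral {0..t} (\<lambda>r. \<phi> r * \<phi> r) \<le> e * M" if e: "0 < e" for e
  proof -
    obtain p where p: "real_polynomial_function p" "\<And>r. r \<in> {0..t} \<Longrightarrow> \<bar>\<phi> r - p r\<bar> < e"
      using Stone_Weierstrass_real_polynomial_function[OF compact_Icc \<phi> e] by auto
    then obtain a n where pa: "p = (\<lambda>x. \<Sum>i\<le>n. a i * x ^ i)"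
      unfolding real_polynomial_function_iff_sum by blast
    have cp: "continuous_on {0..t} p" unfolding pa by (intro continuous_intros)
    have "integral {0..t} (\<lambda>r. p r * \<phi> r) = integral {0..t} (\<lambda>r. \<Sum>i\<le>n. a i * (r ^ i * \<phi> r))"
      by (simp add: pa sum_distrib_right mult.assoc)
    also have "\<dots> = (\<Sum>i\<le>n. integral {0..t} (\<lambda>r. a i * (r ^ i * \<phi> r)))"
      by (intro Henstock_Kurzweil_Integration.integral_sum int continuous_intros \<phi>) auto
    also have "\<dots> = 0" by (simp add: mom)
    finally have "integral {0..t} (\<lambda>r. \<phi> r * \<phi> r) =
        integral {0..t} (\<lambda>r. \<phi> r * \<phi> r) - integral {0..t} (\<lambda>r. p r * \<phi> r)" by simp
    also have "\<dots> = integral {0..t} (\<lambda>r. \<phi> r * \<phi> r - p r * \<phi> r)"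
      by (intro Henstock_Kurzweil_Integration.integral_diff[symmetric] int continuous_intros \<phi> cp)
    also have "\<dots> \<le> integral {0..t} (\<lambda>r. e * \<bar>\<phi> r\<bar>)"
    proof (intro integral_le int continuous_intros \<phi> cp)
      fix r assume r: "r \<in> {0..t}"
      have "\<phi> r * \<phi> r - p r * \<phi> r \<le> \<bar>(\<phi> r - p r) * \<phi> r\<bar>" by (simp add: left_diff_distrib)
      also have "\<dots> \<le> e * \<bar>\<phi> r\<bar>" unfolding abs_mult using p(2)[OF r] by (intro mult_right_mono) auto
      finally show "\<phi> r * \<phi> r - p r * \<phi> r \<le> e * \<bar>\<phi> r\<bar>" .
    qed
    finally show ?thesis by (simp add: M_def)
  qed
  have "integral {0..t} (\<lambda>r. \<phi> r * \<phi> r) \<le> 0 + e" if "0 < e" for e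
  proof -
    have "integral {0..t} (\<lambda>r. \<phi> r * \<phi> r) \<le> e / (M + 1) * M" using that M by (intro small) auto
    also have "\<dots> \<le> e" using that M by (simp add: field_simps)
    finally show ?thesis by simp
  qed
  then have "integral {0..t} (\<lambda>r. \<phi> r * \<phi> r) \<le> 0" by (rule field_le_epsilon)
  moreover have "0 \<le> integral {0..t} (\<lambda>r. \<phi> r * \<phi> r)"
    by (intro Henstock_Kurzweil_Integration.integral_nonneg int continuous_intros \<phi>) auto
  ultimately have "integral {0..t} (\<lambda>r. \<phi> r * \<phi> r) = 0" by simp
  then have "\<forall>r\<in>{0..t}. \<phi> r * \<phi> r = 0"
    by (subst (asm) integral_eq_0_iff) (use t \<phi> in \<open>auto intro!: continuous_intros\<close>)
  then show ?thesis using r by simp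
qed

section \<open>The algebra of signature functionals on a ball\<close>

context
  fixes \<alpha> T R :: real and y\<^sub>0 :: "real ^ 'm::finite"
  assumes \<alpha>: "1 / 2 < \<alpha>" "\<alpha> \<le> 1" and T: "0 < T" and R: "0 \<le> R"
begin

definition aug_bound where "aug_bound = R + T powr (1 - \<alpha>)"

lemma aug_bound_nonneg: "0 \<le> aug_bound"
  using R by (simp add: aug_bound_def)

lemma aug_coords: "y \<in> holder_ball \<alpha> T y\<^sub>0 R \<Longrightarrow> holder_coords \<alpha> aug_bound T (time_augmented y)"
  unfolding aug_bound_def using time_augmented_holder_coords \<alpha> R by blast

text \<open>Integration against a path is not continuous under pointwise convergence as such. On the
  ball, left-point sums over the equidistant partition of \<open>{0..fst p}\<close> converge
  uniformly: there are \<open>Suc n\<close> errors of size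
  \<open>C * (T / real (Suc n)) powr (2 * \<alpha>)\<close>. Each sum uses finitely many
  evaluations, at times that vary continuously with \<open>p\<close>.\<close>

lemma continuous_on_signature_functional:
  "continuous_on ({0..T} \<times> holder_ball \<alpha> T y\<^sub>0 R) (\<lambda>p. rev_signature (time_augmented (snd p)) (fst p) w)"
proof (induction w)
  case (Cons k w)
  let ?A = "{0..T} \<times> holder_ball \<alpha> T y\<^sub>0 R"
  let ?z = "\<lambda>p. time_augmented (snd p)"
  obtain C where C: "0 \<le> C" "\<And>z :: real \<Rightarrow> real ^ 'm option. \<And>k s t. holder_coords \<alpha> aug_bound T z \<Longrightarrow>
      0 \<le> s \<Longrightarrow> s \<le> t \<Longrightarrow> t \<le> T \<Longrightarrow>
      \<bar>rev_signature z t (k # w) - rev_signature z s (k # w) - rev_signature z s w * (z t $ k - z s $ k)\<bar>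
      \<le> C * (t - s) powr (2 * \<alpha>)"
    using rev_signature_estimates[OF \<alpha> aug_bound_nonneg T, of w] by metis
  define s where "s n i p = real i * fst p / real (Suc n)" for n i and p :: "real \<times> (real \<Rightarrow> real ^ 'm)"
  define F where "F n p = (\<Sum>i<Suc n. rev_signature (?z p) (s n i p) w * (?z p (s n (Suc i) p) $ k - ?z p (s n i p) $ k))"
    for n p
  have s_range: "s n i p \<in> {0..T}" if "p \<in> ?A" "i \<le> Suc n" for n i p
  proof -
    have "real i * fst p \<le> real (Suc n) * fst p" using that by (intro mult_right_mono) auto
    also have "\<dots> \<le> real (Suc n) * T" using that by (intro mult_left_mono) auto
    finally show ?thesis using that by (auto simp: s_def field_simps)
  qed
  have cont_s': "continuous_on ?A (s n i)" for n i
    unfolding s_def[abs_def]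
    by (intro continuous_on_divide continuous_on_mult continuous_on_const continuous_on_fst continuous_on_id) simp
  have cont_s: "continuous_on ?A (\<lambda>p. (s n i p, snd p))" for n i
    by (rule continuous_on_Pair[OF cont_s' continuous_on_snd[OF continuous_on_id]])
  have img: "(\<lambda>p. (s n i p, snd p)) ` ?A \<subseteq> ?A" if "i \<le> Suc n" for n i
    using s_range[OF _ that] by (auto simp: mem_Times_iff)
  have cont_sig: "continuous_on ?A (\<lambda>p. rev_signature (?z p) (s n i p) w)" if "i \<le> Suc n" for n i
    using continuous_on_compose2[OF Cons.IH cont_s[of n i] img[OF that]] unfolding fst_conv snd_conv .
  have cont_z: "continuous_on ?A (\<lambda>p. ?z p (s n i p) $ k)" if i: "i \<le> Suc n" for n i
  proof (cases k)
    case None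
    then show ?thesis using cont_s'[of n i] by (simp add: time_augmented_def)
  next
    case (Some j)
    have "0 < \<alpha>" using \<alpha> by simp
    from continuous_on_compose2[OF continuous_on_evaluation[OF this, of T y\<^sub>0 R] cont_s[of n i] img[OF i]]
    have "continuous_on ?A (\<lambda>p. snd p (s n i p))" unfolding fst_conv snd_conv .
    then show ?thesis using Some by (simp add: time_augmented_def continuous_on_component)
  qed
  have cont_F: "continuous_on ?A (F n)" for n
    unfolding F_def
    by (rule continuous_on_sum, rule continuous_on_mult[OF cont_sig continuous_on_diff[OF cont_z cont_z]]) simp_all
  have err: "\<bar>F n p - rev_signature (?z p) (fst p) (k # w)\<bar> \<le> C * T powr (2 * \<alpha>) * real (Suc n) powr (1 - 2 * \<alpha>)"
    if p: "p \<in> ?A" for n p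
  proof -
    have z: "holder_coords \<alpha> aug_bound T (?z p)" using aug_coords p by auto
    let ?S = "\<lambda>i. rev_signature (?z p) (s n i p) (k # w)"
    let ?t = "\<lambda>i. rev_signature (?z p) (s n i p) w * (?z p (s n (Suc i) p) $ k - ?z p (s n i p) $ k)"
    have "rev_signature (?z p) (fst p) (k # w) = (\<Sum>i<Suc n. ?S (Suc i) - ?S i)"
    proof -
      have "s n (Suc n) p = fst p" "s n 0 p = 0" by (simp_all add: s_def del: of_nat_Suc)
      then show ?thesis
        using sum_lessThan_telescope[of ?S "Suc n"] by (simp only: rev_signature_0 diff_zero)
    qed
    then have tele: "F n p - rev_signature (?z p) (fst p) (k # w) = (\<Sum>i<Suc n. ?t i - (?S (Suc i) - ?S i))"
      by (simp only: F_def sum_subtractf)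
    have sum: "\<bar>\<Sum>i<Suc n. ?t i - (?S (Suc i) - ?S i)\<bar> \<le> (\<Sum>i<Suc n. C * (T / real (Suc n)) powr (2 * \<alpha>))"
    proof (rule order_trans[OF sum_abs], rule sum_mono)
      fix i assume i: "i \<in> {..<Suc n}"
      have d: "s n (Suc i) p - s n i p = fst p / real (Suc n)"
        unfolding s_def diff_divide_distrib[symmetric] left_diff_distrib[symmetric] by simp
      have "0 \<le> fst p / real (Suc n)" using p by auto
      then have le: "s n i p \<le> s n (Suc i) p" using d by linarith
      have "\<bar>?t i - (?S (Suc i) - ?S i)\<bar> = \<bar>?S (Suc i) - ?S i - ?t i\<bar>" by (rule abs_minus_commute)
      also have "\<dots> \<le> C * (s n (Suc i) p - s n i p) powr (2 * \<alpha>)"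
        using s_range[OF p, of i n] s_range[OF p, of "Suc i" n] i le by (intro C(2)[OF z]) auto
      also have "\<dots> \<le> C * (T / real (Suc n)) powr (2 * \<alpha>)"
        unfolding d using p C(1) \<alpha> by (intro mult_left_mono powr_mono2 divide_right_mono) auto
      finally show "\<bar>?t i - (?S (Suc i) - ?S i)\<bar> \<le> C * (T / real (Suc n)) powr (2 * \<alpha>)" .
    qed
    have "(\<Sum>i<Suc n. C * (T / real (Suc n)) powr (2 * \<alpha>)) = C * T powr (2 * \<alpha>) * (real (Suc n) powr (1 - 2 * \<alpha>))"
    proof -
      have "(T / real (Suc n)) powr (2 * \<alpha>) = T powr (2 * \<alpha>) / real (Suc n) powr (2 * \<alpha>)"
        using T by (simp add: powr_divide)
      moreover have "real (Suc n) powr (1 - 2 * \<alpha>) = real (Suc n) / real (Suc n) powr (2 * \<alpha>)"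
        by (simp add: powr_diff del: of_nat_Suc)
      ultimately show ?thesis by (simp del: of_nat_Suc)
    qed
    with sum show ?thesis unfolding tele by (rule ord_le_eq_trans)
  qed
  have lim: "(\<lambda>n. C * T powr (2 * \<alpha>) * real (Suc n) powr (1 - 2 * \<alpha>)) \<longlonglongrightarrow> 0"
  proof (rule tendsto_mult_right_zero)
    have "1 - 2 * \<alpha> < 0" using \<alpha> by simp
    from LIMSEQ_Suc[OF tendsto_neg_powr[OF this filterlim_real_sequentially]]
    show "(\<lambda>n. real (Suc n) powr (1 - 2 * \<alpha>)) \<longlonglongrightarrow> 0" .
  qed
  have "uniform_limit ?A F (\<lambda>p. rev_signature (?z p) (fst p) (k # w)) sequentially"
  proof (rule uniform_limitI)
    fix e :: real assume "0 < e"
    from order_tendstoD(2)[OF lim this]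
    show "eventually (\<lambda>n. \<forall>p\<in>?A. dist (F n p) (rev_signature (?z p) (fst p) (k # w)) < e) sequentially"
    proof eventually_elim
      case (elim n)
      show ?case unfolding dist_real_def using le_less_trans[OF err elim] by blast
    qed
  qed
  from uniform_limit_theorem[OF always_eventually[OF allI[OF cont_F]] this sequentially_bot] show ?case .
qed simp

text \<open>A list of coefficients and reversed words stands for an element of the tensor algebra.
  Repeated words are allowed, so that addition is concatenation; they are merged only in
  \<open>sig_poly_tensor_pairing\<close>.\<close>

definition sig_poly where
  "sig_poly L p = (\<Sum>(c, w)\<leftarrow>L. c * rev_signature (time_augmented (snd p)) (fst p) w)"

lemma sig_poly_Nil [simp]: "sig_poly [] p = 0"
  and sig_poly_Cons: "sig_poly ((c, w) # L) p = c * rev_signature (time_augmented (snd p)) (fst p) w + sig_poly L p"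
  and sig_poly_append: "sig_poly (L @ L') p = sig_poly L p + sig_poly L' p"
  by (simp_all add: sig_poly_def)

lemma continuous_on_sig_poly: "continuous_on ({0..T} \<times> holder_ball \<alpha> T y\<^sub>0 R) (sig_poly L)"
proof (induction L)
  case (Cons a L)
  then show ?case
    by (cases a) (auto simp: sig_poly_Cons[abs_def] intro!: continuous_intros continuous_on_signature_functional)
qed (simp add: sig_poly_def)

lemma sig_poly_word_mult:
  "\<exists>L'. \<forall>p \<in> {0..T} \<times> holder_ball \<alpha> T y\<^sub>0 R. c * rev_signature (time_augmented (snd p)) (fst p) w * sig_poly L p = sig_poly L' p"
proof (induction L)
  case Nil
  show ?case by (intro exI[of _ "[]"]) simp
next
  case (Cons a L)
  obtain d v where a: "a = (d, v)" by (cases a)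
  obtain L' where L': "\<forall>p \<in> {0..T} \<times> holder_ball \<alpha> T y\<^sub>0 R.
      c * rev_signature (time_augmented (snd p)) (fst p) w * sig_poly L p = sig_poly L' p"
    using Cons by blast
  obtain ws where ws: "\<And>z :: real \<Rightarrow> real ^ 'm option. \<And>t. holder_coords \<alpha> aug_bound T z \<Longrightarrow> 0 \<le> t \<Longrightarrow> t \<le> T \<Longrightarrow>
      rev_signature z t w * rev_signature z t v = (\<Sum>w\<leftarrow>ws. rev_signature z t w)"
    using rev_signature_product[OF \<alpha> aug_bound_nonneg T, of w v] by blast
  have scale: "c * d * (\<Sum>w\<leftarrow>ws. rev_signature z t w) = sig_poly (map (Pair (c * d)) ws) (t, y)"
    if "z = time_augmented y" for z t y
    using that by (induction ws) (simp_all add: sig_poly_Cons distrib_left)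
  have "c * rev_signature (time_augmented (snd p)) (fst p) w * sig_poly (a # L) p =
      sig_poly (map (Pair (c * d)) ws @ L') p" if p: "p \<in> {0..T} \<times> holder_ball \<alpha> T y\<^sub>0 R" for p
  proof -
    have "c * rev_signature (time_augmented (snd p)) (fst p) w * sig_poly (a # L) p =
        c * d * (rev_signature (time_augmented (snd p)) (fst p) w * rev_signature (time_augmented (snd p)) (fst p) v) +
        c * rev_signature (time_augmented (snd p)) (fst p) w * sig_poly L p"
      by (simp add: a sig_poly_Cons algebra_simps)
    also have "\<dots> = sig_poly (map (Pair (c * d)) ws @ L') p"
      using p L' ws[OF aug_coords, of "snd p" "fst p"] scale[of "time_augmented (snd p)" "snd p" "fst p", OF refl]
      by (auto simp: sig_poly_append)
    finally show ?thesis .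
  qed
  then show ?case by blast
qed

lemma sig_poly_mult:
  "\<exists>L''. \<forall>p \<in> {0..T} \<times> holder_ball \<alpha> T y\<^sub>0 R. sig_poly L p * sig_poly L' p = sig_poly L'' p"
proof (induction L)
  case Nil
  show ?case by (intro exI[of _ "[]"]) simp
next
  case (Cons a L)
  obtain c w where a: "a = (c, w)" by (cases a)
  obtain L1 where L1: "\<forall>p \<in> {0..T} \<times> holder_ball \<alpha> T y\<^sub>0 R. sig_poly L p * sig_poly L' p = sig_poly L1 p"
    using Cons by blast
  obtain L2 where L2: "\<forall>p \<in> {0..T} \<times> holder_ball \<alpha> T y\<^sub>0 R.
      c * rev_signature (time_augmented (snd p)) (fst p) w * sig_poly L' p = sig_poly L2 p"
    using sig_poly_word_mult by blast
  show ?case using L1 L2 by (intro exI[of _ "L2 @ L1"]) (simp add: a sig_poly_Cons sig_poly_append distrib_right)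
qed

text \<open>The time letter in outermost position is integration in time, so time integrals of
  signature functionals are signature functionals again.\<close>

lemma sig_poly_time_integral:
  assumes p: "p \<in> {0..T} \<times> holder_ball \<alpha> T y\<^sub>0 R"
  shows "((\<lambda>r. sig_poly L (r, snd p)) has_integral sig_poly (map (\<lambda>(c, w). (c, None # w)) L) p) {0..fst p}"
proof (induction L)
  case (Cons a L)
  obtain c w where a: "a = (c, w)" by (cases a)
  let ?z = "time_augmented (snd p)"
  have z: "holder_coords \<alpha> aug_bound T ?z" using aug_coords p by auto
  obtain A where A: "0 \<le> A" "\<And>s t. 0 \<le> s \<Longrightarrow> s \<le> t \<Longrightarrow> t \<le> T \<Longrightarrow>
      \<bar>rev_signature ?z t w - rev_signature ?z s w\<bar> \<le> A * (t - s) powr \<alpha>"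
    using rev_signature_estimates[OF \<alpha> aug_bound_nonneg T, of w] z by metis
  have "rs_primitive 0 T (\<lambda>s. rev_signature ?z s w) (\<lambda>s. ?z s $ None) (\<lambda>t. rev_signature ?z t (None # w))"
    by (rule rev_signature_Cons_local(1)[OF \<alpha> aug_bound_nonneg T z A(1)]) (use A(2) in auto)
  moreover have "(\<lambda>s. ?z s $ None) = (\<lambda>t. t)" by (simp add: time_augmented_def)
  ultimately have "rs_primitive 0 T (\<lambda>s. rev_signature ?z s w) (\<lambda>t. t) (\<lambda>t. rev_signature ?z t (None # w))"
    by (simp only:)
  then have "rs_primitive 0 (fst p) (\<lambda>s. rev_signature ?z s w) (\<lambda>t. t) (\<lambda>t. rev_signature ?z t (None # w))"
    by (rule rs_primitive_subinterval) (use p in auto)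
  from rs_primitive_time_has_integral[OF _ this] p
  have "((\<lambda>s. rev_signature ?z s w) has_integral rev_signature ?z (fst p) (None # w)) {0..fst p}"
    by (auto simp: rev_signature_0 simp del: rev_signature.simps(2))
  from has_integral_add[OF has_integral_mult_right[OF this, of c] Cons.IH] show ?case
    by (simp add: a sig_poly_Cons del: rev_signature.simps(2))
qed simp

text \<open>Time is the word \<open>[None]\<close> and the increment of coordinate \<open>k\<close>
  is the word \<open>[Some k]\<close>; shuffle products supply the powers of time.\<close>

lemma sig_poly_moment:
  "\<exists>L. \<forall>p \<in> {0..T} \<times> holder_ball \<alpha> T y\<^sub>0 R. sig_poly L p = fst p ^ n * (snd p (fst p) $ k - y\<^sub>0 $ k)"
proof (induction n)
  case 0
  have "sig_poly [(1, [Some k])] p = snd p (fst p) $ k - y\<^sub>0 $ k" if "p \<in> {0..T} \<times> holder_ball \<alpha> T y\<^sub>0 R" for p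
    using that by (auto simp: sig_poly_Cons rev_signature_single time_augmented_def holder_ball_def
        simp del: rev_signature.simps(2))
  then show ?case by (intro exI[of _ "[(1, [Some k])]"]) simp
next
  case (Suc n)
  obtain L where L: "\<forall>p \<in> {0..T} \<times> holder_ball \<alpha> T y\<^sub>0 R. sig_poly L p = fst p ^ n * (snd p (fst p) $ k - y\<^sub>0 $ k)"
    using Suc by blast
  obtain L' where L': "\<forall>p \<in> {0..T} \<times> holder_ball \<alpha> T y\<^sub>0 R.
      1 * rev_signature (time_augmented (snd p)) (fst p) [None] * sig_poly L p = sig_poly L' p"
    using sig_poly_word_mult by blast
  have "rev_signature (time_augmented (snd p)) (fst p) [None] = fst p" if "p \<in> {0..T} \<times> holder_ball \<alpha> T y\<^sub>0 R" for p
    using that by (auto simp: rev_signature_single time_augmented_def simp del: rev_signature.simps(2))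
  then have "sig_poly L' p = fst p ^ Suc n * (snd p (fst p) $ k - y\<^sub>0 $ k)"
    if "p \<in> {0..T} \<times> holder_ball \<alpha> T y\<^sub>0 R" for p
    using L L' that by (metis (no_types, lifting) mult.assoc mult_1 power_Suc)
  then show ?case by blast
qed

text \<open>The word \<open>[None]\<close> recovers the time. Integrating the functionals of
  \<open>sig_poly_moment\<close> in time yields all moments of each coordinate over
  \<open>{0..fst p}\<close>, up to the common starting value, and these determine a continuous path
  there. After its time a stopped path is constant.\<close>

lemma sig_poly_separates:
  assumes p: "p \<in> stopped_ball \<alpha> T y\<^sub>0 R" and q: "q \<in> stopped_ball \<alpha> T y\<^sub>0 R" and "p \<noteq> q"
  shows "\<exists>L. sig_poly L p \<noteq> sig_poly L q"
proof (rule ccontr)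
  assume "\<not> ?thesis"
  then have eq: "sig_poly L p = sig_poly L q" for L by blast
  have sub: "stopped_ball \<alpha> T y\<^sub>0 R \<subseteq> {0..T} \<times> holder_ball \<alpha> T y\<^sub>0 R"
    using \<alpha> R by (intro stopped_ball_subset) auto
  have p': "p \<in> {0..T} \<times> holder_ball \<alpha> T y\<^sub>0 R" and q': "q \<in> {0..T} \<times> holder_ball \<alpha> T y\<^sub>0 R"
    using p q sub by auto
  have t: "fst p = fst q"
    using eq[of "[(1, [None])]"] p' q'
    by (auto simp: sig_poly_Cons rev_signature_single time_augmented_def simp del: rev_signature.simps(2))
  have agree: "snd p r = snd q r" if r: "r \<in> {0..fst p}" for r
  proof (cases "fst p = 0")
    case True
    then show ?thesis using r p' q' by (auto simp: holder_ball_def)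
  next
    case False
    then have t0: "0 < fst p" using p' by auto
    show ?thesis
    proof (rule vec_eq_iff[THEN iffD2, rule_format])
      fix k
      let ?\<phi> = "\<lambda>r. snd p r $ k - snd q r $ k"
      have cont: "continuous_on {0..fst p} (snd p)" "continuous_on {0..fst p} (snd q)"
        using p' q' t \<alpha> continuous_on_holder_ball[of \<alpha> _ T y\<^sub>0 R]
        by (auto intro: continuous_on_subset[where s = "{0..T}"])
      have "?\<phi> r = 0"
      proof (rule continuous_moments_zero[OF t0 _ _ r])
        show "continuous_on {0..fst p} ?\<phi>" by (intro continuous_intros continuous_on_component cont)
        fix n
        obtain L where L: "\<And>p. p \<in> {0..T} \<times> holder_ball \<alpha> T y\<^sub>0 R \<Longrightarrow>
            sig_poly L p = fst p ^ n * (snd p (fst p) $ k - y\<^sub>0 $ k)"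
          using sig_poly_moment by blast
        have int: "((\<lambda>r. r ^ n * (snd u r $ k - y\<^sub>0 $ k)) has_integral
            sig_poly (map (\<lambda>(c, w). (c, None # w)) L) u) {0..fst u}"
          if u: "u \<in> {0..T} \<times> holder_ball \<alpha> T y\<^sub>0 R" for u
        proof (rule has_integral_eq[OF _ sig_poly_time_integral[OF u, of L]])
          fix r assume "r \<in> {0..fst u}"
          then show "sig_poly L (r, snd u) = r ^ n * (snd u r $ k - y\<^sub>0 $ k)"
            using L[of "(r, snd u)"] u by auto
        qed
        have "((\<lambda>r. r ^ n * (snd p r $ k - y\<^sub>0 $ k) - r ^ n * (snd q r $ k - y\<^sub>0 $ k)) has_integral
            sig_poly (map (\<lambda>(c, w). (c, None # w)) L) p - sig_poly (map (\<lambda>(c, w). (c, None # w)) L) q) {0..fst p}"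
          using int[OF q'] unfolding t[symmetric] by (intro has_integral_diff int[OF p'])
        then have "((\<lambda>r. r ^ n * ?\<phi> r) has_integral 0) {0..fst p}"
          unfolding eq by (simp add: algebra_simps)
        then show "integral {0..fst p} (\<lambda>r. r ^ n * ?\<phi> r) = 0" by (rule integral_unique)
      qed
      then show "snd p r $ k = snd q r $ k" by simp
    qed
  qed
  have stop: "snd u r = snd u (min r (fst u))" if u: "u \<in> stopped_ball \<alpha> T y\<^sub>0 R" and r: "r \<in> {0..T}" for u r
  proof -
    obtain t y where y: "t \<in> {0..T}" "u = (t, stopped T t y)" using u unfolding stopped_ball_def by auto
    then show ?thesis using r by (simp add: stopped_def min_def)
  qed
  have "snd p r = snd q r" if r: "r \<in> {0..T}" for r
  proof -
    have "min r (fst p) \<in> {0..fst p}" using r p' by auto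
    then show ?thesis using stop[OF p r] stop[OF q r] agree t by simp
  qed
  moreover have "snd p \<in> extensional {0..T}" "snd q \<in> extensional {0..T}"
    using p' q' by (auto simp: holder_ball_def)
  ultimately have "snd p = snd q" by (intro extensionalityI[of _ "{0..T}"]) auto
  then show False using t \<open>p \<noteq> q\<close> by (simp add: prod_eq_iff)
qed

text \<open>
  Evaluation at the rationals embeds the paths into a countable product, which is metrizable; the
  uncountable product has no \<^class>\<open>t2_space\<close> instance in the library.
\<close>

lemma inj_on_rational_evaluation:
  "inj_on (\<lambda>p. (fst p, \<lambda>q::rat. snd p (of_rat q))) ({0..T} \<times> holder_ball \<alpha> T y\<^sub>0 R)"
proof (rule inj_onI)
  fix p p' assume p: "p \<in> {0..T} \<times> holder_ball \<alpha> T y\<^sub>0 R" and p': "p' \<in> {0..T} \<times> holder_ball \<alpha> T y\<^sub>0 R"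
    and eq: "(fst p, \<lambda>q::rat. snd p (of_rat q)) = (fst p', \<lambda>q::rat. snd p' (of_rat q))"
  have fst: "fst p = fst p'" using eq by (rule Pair_inject)
  have "(\<lambda>q::rat. snd p (of_rat q)) = (\<lambda>q::rat. snd p' (of_rat q))" using eq by (rule Pair_inject)
  then have rat: "snd p (of_rat q) = snd p' (of_rat q)" for q :: rat by (rule fun_cong)
  have "snd p t = snd p' t" if t: "t \<in> {0..T}" for t
  proof (rule ccontr)
    assume ne: "snd p t \<noteq> snd p' t"
    define e where "e = norm (snd p t - snd p' t) / 2"
    have e: "0 < e" using ne by (simp add: e_def)
    obtain \<delta> where \<delta>: "0 < \<delta>" "\<And>\<kappa>. 0 \<le> \<kappa> \<Longrightarrow> \<kappa> \<le> \<delta> \<Longrightarrow> 2 * R * \<kappa> powr \<alpha> \<le> e"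
      using powr_small[of \<alpha> e "2 * R"] \<alpha> e R by force
    have "max 0 (t - \<delta>) < min T (t + \<delta>)" using t T \<delta>(1) by auto
    then obtain q :: rat where q: "max 0 (t - \<delta>) < of_rat q" "of_rat q < min T (t + \<delta>)"
      using of_rat_dense by blast
    then have qT: "of_rat q \<in> {0..T}" "\<bar>t - of_rat q\<bar> \<le> \<delta>" by auto
    have "norm (snd p t - snd p (of_rat q)) \<le> R * \<bar>t - of_rat q\<bar> powr \<alpha>"
      "norm (snd p' t - snd p' (of_rat q)) \<le> R * \<bar>t - of_rat q\<bar> powr \<alpha>"
      using p p' qT(1) t by (auto intro!: holder_ball_abs)
    moreover have "norm (snd p t - snd p' t) \<le> norm (snd p t - snd p (of_rat q)) + norm (snd p' t - snd p' (of_rat q))"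
      using norm_triangle_ineq4[of "snd p t - snd p (of_rat q)" "snd p' t - snd p' (of_rat q)"] rat[of q] by simp
    ultimately have "2 * e \<le> 2 * R * \<bar>t - of_rat q\<bar> powr \<alpha>" by (simp add: e_def)
    also have "\<dots> \<le> e" using qT(2) by (intro \<delta>(2)) auto
    finally show False using e by simp
  qed
  moreover have "snd p \<in> extensional {0..T}" "snd p' \<in> extensional {0..T}"
    using p p' by (auto simp: holder_ball_def)
  ultimately have "snd p = snd p'" by (intro extensionalityI[of _ "{0..T}"]) auto
  then show "p = p'" using fst by (simp add: prod_eq_iff)
qed

text \<open>The words are reversed back into the order used by \<open>signature\<close>, and the
  coefficients of equal words are added up.\<close>

lemma sig_poly_tensor_pairing:
  "\<exists>a\<in>tensor_algebra. \<forall>t y. tensor_pairing a (signature (time_augmented y) t) = sig_poly L (t, y)"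
proof -
  define a where "a v = (\<Sum>(c, w)\<leftarrow>L. if rev w = v then c else 0)" for v
  define V where "V = rev ` snd ` set L"
  have V: "finite V" by (simp add: V_def)
  have supp: "{v. a v \<noteq> 0} \<subseteq> V"
  proof
    fix v assume v: "v \<in> {v. a v \<noteq> 0}"
    show "v \<in> V"
    proof (rule ccontr)
      assume "v \<notin> V"
      then have "map (\<lambda>(c, w). if rev w = v then c else 0) L = map (\<lambda>_. 0) L"
      proof (intro map_cong refl)
        fix x assume "x \<in> set L"
        then have "rev (snd x) \<in> V" by (simp add: V_def)
        then show "(case x of (c, w) \<Rightarrow> if rev w = v then c else 0) = 0"
          using \<open>v \<notin> V\<close> by (auto simp: case_prod_beta)
      qed
      then have "a v = sum_list (map (\<lambda>_. 0) L)" unfolding a_def by (simp only:)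
      then show False using v by simp
    qed
  qed
  have "{n. \<exists>v. length v = n \<and> a v \<noteq> 0} \<subseteq> length ` V" using supp by blast
  from finite_subset[OF this finite_imageI[OF V]] have "a \<in> tensor_algebra"
    unfolding tensor_algebra_def by blast
  moreover have "\<forall>t y. tensor_pairing a (signature (time_augmented y) t) = sig_poly L (t, y)"
  proof (intro allI)
    fix t y
    show "tensor_pairing a (signature (time_augmented y) t) = sig_poly L (t, y)"
  proof -
    let ?S = "signature (time_augmented y) t"
    \<comment> \<open>Cancellation may make the support of \<open>a\<close> smaller than
      \<open>V\<close>. Summing over the fixed set \<open>V\<close> permits an induction on lists
      with entries from \<open>L\<close>.\<close>
    have pair: "tensor_pairing a ?S = (\<Sum>v\<in>V. a v * ?S v)"
      unfolding tensor_pairing_def by (rule sum.mono_neutral_left[OF V supp]) simp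
    have "(\<Sum>v\<in>V. (\<Sum>(c, w)\<leftarrow>M. if rev w = v then c else 0) * ?S v) = sig_poly M (t, y)"
      if "set M \<subseteq> set L" for M
      using that
    proof (induction M)
      case (Cons b M)
      obtain c w where b: "b = (c, w)" by (cases b)
      have "b \<in> set L" using Cons.prems by simp
      then have "rev (snd b) \<in> V" unfolding V_def by (intro imageI)
      then have w: "rev w \<in> V" by (simp add: b)
      have IH: "(\<Sum>v\<in>V. (\<Sum>(c, w)\<leftarrow>M. if rev w = v then c else 0) * ?S v) = sig_poly M (t, y)"
        using Cons.prems by (intro Cons.IH) simp
      have "(\<Sum>v\<in>V. (\<Sum>(c, w)\<leftarrow>b # M. if rev w = v then c else 0) * ?S v) =
          (\<Sum>v\<in>V. (if rev w = v then c * ?S v else 0)) +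
          (\<Sum>v\<in>V. (\<Sum>(c, w)\<leftarrow>M. if rev w = v then c else 0) * ?S v)"
        unfolding sum.distrib[symmetric] by (intro sum.cong refl) (simp add: b distrib_right)
      also have "(\<Sum>v\<in>V. (if rev w = v then c * ?S v else 0)) = c * ?S (rev w)"
        using V w by simp
      also have "c * ?S (rev w) = c * rev_signature (time_augmented y) t w" by (simp add: signature_def)
      finally show ?case unfolding IH by (simp only: b sig_poly_Cons fst_conv snd_conv)
    qed simp
    from this[OF order_refl] show ?thesis unfolding pair a_def .
  qed
  qed
  ultimately show ?thesis by blast
qed

lemma signature_functionals_dense:
  assumes g: "continuous_on (stopped_ball \<alpha> T y\<^sub>0 R) g" and \<epsilon>: "0 < \<epsilon>"
  shows "\<exists>a\<in>tensor_algebra. \<forall>(t, y) \<in> stopped_ball \<alpha> T y\<^sub>0 R.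
    \<bar>g (t, y) - tensor_pairing a (signature (time_augmented y) t)\<bar> < \<epsilon>"
proof -
  have sub: "stopped_ball \<alpha> T y\<^sub>0 R \<subseteq> {0..T} \<times> holder_ball \<alpha> T y\<^sub>0 R"
    using \<alpha> R by (intro stopped_ball_subset) auto
  \<comment> \<open>Agreement is required only on the ball, because the shuffle identity holds only
    under its Hoelder bound.\<close>
  define P where "P h \<longleftrightarrow> (\<exists>L. \<forall>p \<in> {0..T} \<times> holder_ball \<alpha> T y\<^sub>0 R. h p = sig_poly L p)" for h
  have PI: "P h" if "\<And>p. p \<in> {0..T} \<times> holder_ball \<alpha> T y\<^sub>0 R \<Longrightarrow> h p = sig_poly L p" for h L
    using that unfolding P_def by blast
  have PE: "\<exists>L. \<forall>p. p \<in> {0..T} \<times> holder_ball \<alpha> T y\<^sub>0 R \<longrightarrow> h p = sig_poly L p" if "P h" for h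
    using that unfolding P_def by blast
  have "\<exists>h. P h \<and> (\<forall>p\<in>stopped_ball \<alpha> T y\<^sub>0 R. \<bar>g p - h p\<bar> < \<epsilon>)"
  proof (rule Stone_Weierstrass_injection[OF compact_stopped_ball _ inj_on_subset[OF inj_on_rational_evaluation sub]])
    have "continuous_on (stopped_ball \<alpha> T y\<^sub>0 R) (\<lambda>p. snd p r)" for r
      by (rule continuous_on_compose2[OF continuous_on_product_coordinates[of r]
            continuous_on_snd[OF continuous_on_id]]) auto
    then show "continuous_on (stopped_ball \<alpha> T y\<^sub>0 R) (\<lambda>p. (fst p, \<lambda>q::rat. snd p (of_rat q)))"
      by (intro continuous_on_Pair continuous_on_fst continuous_on_id continuous_on_coordinatewise_then_product)
    show "P (\<lambda>_. c)" for c
      by (rule PI[of _ "[(c, [])]"]) (simp add: sig_poly_Cons)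
    show "continuous_on (stopped_ball \<alpha> T y\<^sub>0 R) h" if h: "P h" for h
    proof -
      obtain L where L: "\<And>p. p \<in> {0..T} \<times> holder_ball \<alpha> T y\<^sub>0 R \<Longrightarrow> h p = sig_poly L p"
        using PE[OF h] by blast
      have "continuous_on ({0..T} \<times> holder_ball \<alpha> T y\<^sub>0 R) h"
        by (rule continuous_on_eq[OF continuous_on_sig_poly[of L] L[symmetric]])
      then show ?thesis using sub by (rule continuous_on_subset)
    qed
    show "P (\<lambda>x. h x + h' x)" if h: "P h" "P h'" for h h'
    proof -
      obtain L L' where "\<And>p. p \<in> {0..T} \<times> holder_ball \<alpha> T y\<^sub>0 R \<Longrightarrow> h p = sig_poly L p"
        "\<And>p. p \<in> {0..T} \<times> holder_ball \<alpha> T y\<^sub>0 R \<Longrightarrow> h' p = sig_poly L' p"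
        using PE[OF h(1)] PE[OF h(2)] by blast
      then show ?thesis by (intro PI[of _ "L @ L'"]) (simp only: sig_poly_append)
    qed
    show "P (\<lambda>x. h x * h' x)" if h: "P h" "P h'" for h h'
    proof -
      obtain L L' where L: "\<And>p. p \<in> {0..T} \<times> holder_ball \<alpha> T y\<^sub>0 R \<Longrightarrow> h p = sig_poly L p"
        "\<And>p. p \<in> {0..T} \<times> holder_ball \<alpha> T y\<^sub>0 R \<Longrightarrow> h' p = sig_poly L' p"
        using PE[OF h(1)] PE[OF h(2)] by blast
      obtain L'' where "\<And>p. p \<in> {0..T} \<times> holder_ball \<alpha> T y\<^sub>0 R \<Longrightarrow> sig_poly L p * sig_poly L' p = sig_poly L'' p"
        using sig_poly_mult by blast
      with L show ?thesis by (intro PI[of _ L'']) (simp only:)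
    qed
    show "\<exists>h. P h \<and> h p \<noteq> h q" if "p \<in> stopped_ball \<alpha> T y\<^sub>0 R" "q \<in> stopped_ball \<alpha> T y\<^sub>0 R" "p \<noteq> q" for p q
      using sig_poly_separates[OF that] PI by blast
  qed (use \<alpha> T R g \<epsilon> in auto)
  then obtain h where h: "P h" "\<And>p. p \<in> stopped_ball \<alpha> T y\<^sub>0 R \<Longrightarrow> \<bar>g p - h p\<bar> < \<epsilon>" by blast
  obtain L where L: "\<And>p. p \<in> {0..T} \<times> holder_ball \<alpha> T y\<^sub>0 R \<Longrightarrow> h p = sig_poly L p"
    using PE[OF h(1)] by blast
  have *: "\<bar>g p - sig_poly L p\<bar> < \<epsilon>" if "p \<in> stopped_ball \<alpha> T y\<^sub>0 R" for p
    using h(2)[OF that] L[OF subsetD[OF sub that]] by (simp only:)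
  obtain a where "a \<in> tensor_algebra"
    "\<And>t y. tensor_pairing a (signature (time_augmented y) t) = sig_poly L (t, y)"
    using sig_poly_tensor_pairing by blast
  then show ?thesis using * by (intro bexI[of _ a]) auto
qed

end

section \<open>Controlled equations\<close>

text \<open>A predicate with an explicit constant, in which \<open>t\<close> can vary: coefficients
  at time \<open>t\<close> may use the path up to \<open>t\<close> only, and no supremum has to be
  known to be finite.\<close>

definition holder_upto :: "real \<Rightarrow> real \<Rightarrow> real \<Rightarrow> (real \<Rightarrow> 'a::real_normed_vector) \<Rightarrow> bool" where
  "holder_upto \<beta> t c v \<longleftrightarrow>
     (\<forall>r s. 0 \<le> r \<and> r < s \<and> s \<le> t \<longrightarrow> norm (v s - v r) \<le> c * (s - r) powr \<beta>)"

lemma holder_upto_mono: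
  assumes "holder_upto \<beta> t c v" "s \<le> t" "c \<le> c'"
  shows "holder_upto \<beta> s c' v"
  unfolding holder_upto_def
proof (intro allI impI)
  fix p q assume pq: "0 \<le> p \<and> p < q \<and> q \<le> s"
  then have "norm (v q - v p) \<le> c * (q - p) powr \<beta>" using assms(1,2) by (auto simp: holder_upto_def)
  also have "\<dots> \<le> c' * (q - p) powr \<beta>" using assms(3) by (intro mult_right_mono) auto
  finally show "norm (v q - v p) \<le> c' * (q - p) powr \<beta>" .
qed

text \<open>Chosen such that its power with exponent \<open>\<beta> - 1\<close> is
  \<open>1 / (2 * A + 1)\<close>; multiplied by \<open>A\<close> this stays below
  \<open>1 / 2\<close>, also for \<open>A = 0\<close>.\<close>

definition weight_rate :: "real \<Rightarrow> real \<Rightarrow> real" where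
  "weight_rate A \<beta> = (2 * A + 1) powr (1 / (1 - \<beta>))"

lemma weight_rate_pos: "0 \<le> A \<Longrightarrow> 0 < weight_rate A \<beta>"
  by (simp add: weight_rate_def)

text \<open>
  The weight \<open>exp (\<rho> * t)\<close> turns the integral operator into a contraction by \<open>1 / 2\<close>: integrating
  it over \<open>{s..t}\<close> gains \<open>exp (\<rho> * t) * min (t - s) (1 / \<rho>)\<close>, which is at most
  \<open>exp (\<rho> * t) * (t - s) powr \<beta> * \<rho> powr (\<beta> - 1)\<close>.
\<close>

lemma weighted_step:
  fixes v :: "real \<Rightarrow> 'a::real_normed_vector"
  assumes \<beta>: "0 < \<beta>" "\<beta> < 1" and T: "0 \<le> T\<^sub>0" "T\<^sub>0 \<le> T"
    and nn: "0 \<le> A" "0 \<le> b" "0 \<le> \<epsilon>" "0 \<le> M"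
    and b: "holder_upto \<beta> T\<^sub>0 b v"
    and step: "\<And>s t. T\<^sub>0 \<le> s \<Longrightarrow> s \<le> t \<Longrightarrow> t \<le> T \<Longrightarrow> norm (v t - v s) \<le>
      A * M * (exp (weight_rate A \<beta> * t) - exp (weight_rate A \<beta> * s)) / weight_rate A \<beta> + \<epsilon> * (t - s)"
    and r: "r \<in> {0..T}"
  shows "holder_upto \<beta> r ((b + \<epsilon> * T powr (1 - \<beta>) + M / 2) * exp (weight_rate A \<beta> * r)) v"
  unfolding holder_upto_def
proof (intro allI impI)
  let ?\<rho> = "weight_rate A \<beta>"
  have \<rho>: "0 < ?\<rho>" using nn(1) by (rule weight_rate_pos)
  fix p q assume pq: "0 \<le> p \<and> p < q \<and> q \<le> r"
  define b' where "b' = \<epsilon> * T powr (1 - \<beta>)"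
  have b': "0 \<le> b'" using nn by (simp add: b'_def)
  have late: "norm (v t - v s) \<le> (b' + M / 2 * exp (?\<rho> * t)) * (t - s) powr \<beta>"
    if st: "T\<^sub>0 \<le> s" "s < t" "t \<le> T" for s t
  proof -
    define u where "u = ?\<rho> * (t - s)"
    have u: "0 < u" using \<rho> st by (simp add: u_def)
    \<comment> \<open>The left side is at most \<open>min u 1\<close>, and
      \<open>u powr \<beta>\<close> dominates this minimum on both sides of
      \<open>u = 1\<close>.\<close>
    have "1 - exp (- u) \<le> u powr \<beta>"
    proof (cases "u \<le> 1")
      case True
      have "1 - exp (- u) \<le> u" using exp_ge_add_one_self[of "- u"] by simp
      also have "u = u powr 1" using u by simp
      also have "\<dots> \<le> u powr \<beta>" using u True \<beta> by (intro powr_mono') auto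
      finally show ?thesis .
    next
      case False
      have "1 - exp (- u) \<le> 1" by simp
      also have "1 \<le> u powr \<beta>" using False \<beta> by (intro ge_one_powr_ge_zero) auto
      finally show ?thesis .
    qed
    then have "exp (?\<rho> * t) * (1 - exp (- u)) \<le> exp (?\<rho> * t) * u powr \<beta>" by (intro mult_left_mono) auto
    moreover have "exp (?\<rho> * t) * exp (- u) = exp (?\<rho> * s)"
      by (simp add: u_def exp_add[symmetric] right_diff_distrib)
    ultimately have "exp (?\<rho> * t) - exp (?\<rho> * s) \<le> exp (?\<rho> * t) * u powr \<beta>" by (simp add: right_diff_distrib)
    also have "u powr \<beta> = ?\<rho> powr \<beta> * (t - s) powr \<beta>" using \<rho> st by (simp add: u_def powr_mult)
    finally have "A * M * (exp (?\<rho> * t) - exp (?\<rho> * s)) / ?\<rho> \<le>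
        A * M * (exp (?\<rho> * t) * (?\<rho> powr \<beta> * (t - s) powr \<beta>)) / ?\<rho>"
      using nn \<rho> by (intro divide_right_mono mult_left_mono) auto
    also have "\<dots> = (A * ?\<rho> powr (\<beta> - 1)) * (M * exp (?\<rho> * t) * (t - s) powr \<beta>)"
      using \<rho> by (simp add: powr_diff)
    also have "?\<rho> powr (\<beta> - 1) = 1 / (2 * A + 1)"
    proof -
      have "1 / (1 - \<beta>) * (\<beta> - 1) = - 1" using \<beta> by (simp add: field_simps)
      then have "?\<rho> powr (\<beta> - 1) = (2 * A + 1) powr (- 1)" by (simp add: weight_rate_def powr_powr)
      then show ?thesis using nn(1) by (simp add: powr_minus_divide)
    qed
    also have "A * (1 / (2 * A + 1)) * (M * exp (?\<rho> * t) * (t - s) powr \<beta>) \<le>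
        1 / 2 * (M * exp (?\<rho> * t) * (t - s) powr \<beta>)"
      using nn by (intro mult_right_mono) (auto simp: field_simps)
    finally have 1: "A * M * (exp (?\<rho> * t) - exp (?\<rho> * s)) / ?\<rho> \<le> M / 2 * exp (?\<rho> * t) * (t - s) powr \<beta>"
      by simp
    have "t - s = (t - s) powr (1 - \<beta>) * (t - s) powr \<beta>" using st by (simp flip: powr_add)
    also have "\<dots> \<le> T powr (1 - \<beta>) * (t - s) powr \<beta>"
      using st T \<beta> by (intro mult_right_mono powr_mono2) auto
    finally have "\<epsilon> * (t - s) \<le> b' * (t - s) powr \<beta>" unfolding b'_def mult.assoc using nn by (intro mult_left_mono) auto
    moreover have "norm (v t - v s) \<le> A * M * (exp (?\<rho> * t) - exp (?\<rho> * s)) / ?\<rho> + \<epsilon> * (t - s)"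
      using st by (intro step) auto
    ultimately show ?thesis using 1 unfolding distrib_right by linarith
  qed
  have early: "norm (v t - v s) \<le> b * (t - s) powr \<beta>" if "0 \<le> s" "s < t" "t \<le> T\<^sub>0" for s t
    using b that by (auto simp: holder_upto_def)
  have qT: "q \<le> T" using pq r by auto
  have e1: "1 \<le> exp (?\<rho> * r)" using \<rho> r by simp
  have eq: "exp (?\<rho> * q) \<le> exp (?\<rho> * r)" using \<rho> pq by simp
  have "norm (v q - v p) \<le> (b + b' + M / 2 * exp (?\<rho> * q)) * (q - p) powr \<beta>"
  proof -
    consider "q \<le> T\<^sub>0" | "T\<^sub>0 \<le> p" | "p < T\<^sub>0" "T\<^sub>0 < q" by linarith
    then show ?thesis
    proof cases
      case 1
      then have "norm (v q - v p) \<le> b * (q - p) powr \<beta>" using early pq by auto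
      also have "\<dots> \<le> (b + b' + M / 2 * exp (?\<rho> * q)) * (q - p) powr \<beta>"
        using nn b' by (intro mult_right_mono) auto
      finally show ?thesis .
    next
      case 2
      then have "norm (v q - v p) \<le> (b' + M / 2 * exp (?\<rho> * q)) * (q - p) powr \<beta>" using late pq qT by auto
      also have "\<dots> \<le> (b + b' + M / 2 * exp (?\<rho> * q)) * (q - p) powr \<beta>"
        using nn b' by (intro mult_right_mono) auto
      finally show ?thesis .
    next
      case 3
      \<comment> \<open>An interval across \<open>T\<^sub>0\<close> is cut there. The constants of
        the two parts add, which is why \<open>b\<close> enters as a summand and not through a
        maximum.\<close>
      have "norm (v q - v p) \<le> norm (v q - v T\<^sub>0) + norm (v T\<^sub>0 - v p)"
        using norm_triangle_ineq[of "v q - v T\<^sub>0" "v T\<^sub>0 - v p"] by simp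
      also have "\<dots> \<le> (b' + M / 2 * exp (?\<rho> * q)) * (q - T\<^sub>0) powr \<beta> + b * (T\<^sub>0 - p) powr \<beta>"
        using 3 pq qT by (intro add_mono late early) auto
      also have "\<dots> \<le> (b' + M / 2 * exp (?\<rho> * q)) * (q - p) powr \<beta> + b * (q - p) powr \<beta>"
        using 3 pq nn b' \<beta> by (intro add_mono mult_left_mono powr_mono2) auto
      finally show ?thesis by (simp add: algebra_simps)
    qed
  qed
  also have "\<dots> \<le> ((b + b' + M / 2) * exp (?\<rho> * r)) * (q - p) powr \<beta>"
  proof (intro mult_right_mono)
    have "(b + b') * 1 \<le> (b + b') * exp (?\<rho> * r)" using e1 nn b' by (intro mult_left_mono) auto
    moreover have "M / 2 * exp (?\<rho> * q) \<le> M / 2 * exp (?\<rho> * r)" using eq nn by (intro mult_left_mono) auto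
    ultimately show "b + b' + M / 2 * exp (?\<rho> * q) \<le> (b + b' + M / 2) * exp (?\<rho> * r)"
      unfolding distrib_right mult_1_right by linarith
  qed simp
  finally show "norm (v q - v p) \<le> (b + \<epsilon> * T powr (1 - \<beta>) + M / 2) * exp (?\<rho> * r) * (q - p) powr \<beta>"
    by (simp add: b'_def)
qed

text \<open>The factor \<open>2\<close> comes from the fixed point of \<open>M = b' + M / 2\<close>,
  the maximum absorbs the factor \<open>T powr (1 - \<beta>)\<close> of \<open>\<epsilon>\<close>,
  and the exponential is the weight at the final time.\<close>

definition gronwall_const :: "real \<Rightarrow> real \<Rightarrow> real \<Rightarrow> real" where
  "gronwall_const A \<beta> T = 2 * max 1 (T powr (1 - \<beta>)) * exp (weight_rate A \<beta> * T)"

lemma gronwall_const_nonneg: "0 \<le> gronwall_const A \<beta> T"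
  by (simp add: gronwall_const_def)

text \<open>\<open>weighted_step\<close> sends the weighted constant \<open>M\<close> to
  \<open>b' + M / 2\<close>. Iteration from any finite \<open>M\<^sub>0\<close> leaves
  \<open>2 * b'\<close> in the limit, so \<open>M\<^sub>0\<close> only certifies finiteness and is
  absent from the bound.\<close>

lemma weighted_bound:
  fixes v :: "real \<Rightarrow> 'a::real_normed_vector"
  assumes \<beta>: "0 < \<beta>" "\<beta> < 1" and T: "0 \<le> T\<^sub>0" "T\<^sub>0 \<le> T"
    and nn: "0 \<le> A" "0 \<le> b" "0 \<le> \<epsilon>"
    and b: "holder_upto \<beta> T\<^sub>0 b v" and fin: "holder_upto \<beta> T M\<^sub>0 v"
    and step: "\<And>M \<rho> s t. 0 < \<rho> \<Longrightarrow> 0 \<le> M \<Longrightarrow> (\<And>r. r \<in> {T\<^sub>0..T} \<Longrightarrow> holder_upto \<beta> r (M * exp (\<rho> * r)) v) \<Longrightarrow>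
      T\<^sub>0 \<le> s \<Longrightarrow> s \<le> t \<Longrightarrow> t \<le> T \<Longrightarrow>
      norm (v t - v s) \<le> A * M * (exp (\<rho> * t) - exp (\<rho> * s)) / \<rho> + \<epsilon> * (t - s)"
  shows "holder_upto \<beta> T (gronwall_const A \<beta> T * (b + \<epsilon>)) v"
proof -
  let ?\<rho> = "weight_rate A \<beta>"
  define b' where "b' = b + \<epsilon> * T powr (1 - \<beta>)"
  have b': "0 \<le> b'" using nn by (simp add: b'_def)
  define M\<^sub>1 where "M\<^sub>1 = max 0 M\<^sub>0"
  have iter: "\<forall>r\<in>{0..T}. holder_upto \<beta> r ((2 * b' + M\<^sub>1 / 2 ^ n) * exp (?\<rho> * r)) v" for n
  proof (induction n)
    case 0
    show ?case
    proof
      fix r assume r: "r \<in> {0..T}"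
      have "M\<^sub>0 \<le> (2 * b' + M\<^sub>1) * 1" using b' by (simp add: M\<^sub>1_def)
      also have "\<dots> \<le> (2 * b' + M\<^sub>1) * exp (?\<rho> * r)"
        using b' r weight_rate_pos[OF nn(1), of \<beta>] by (intro mult_left_mono) (auto simp: M\<^sub>1_def)
      finally show "holder_upto \<beta> r ((2 * b' + M\<^sub>1 / 2 ^ 0) * exp (?\<rho> * r)) v"
        using holder_upto_mono[OF fin] r by simp
    qed
  next
    case (Suc n)
    show ?case
    proof
      fix r assume r: "r \<in> {0..T}"
      have M: "0 \<le> 2 * b' + M\<^sub>1 / 2 ^ n" using b' by (simp add: M\<^sub>1_def)
      have "holder_upto \<beta> r ((b + \<epsilon> * T powr (1 - \<beta>) + (2 * b' + M\<^sub>1 / 2 ^ n) / 2) * exp (?\<rho> * r)) v"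
        using Suc T by (intro weighted_step[OF \<beta> T nn M b _ r] step[OF weight_rate_pos[OF nn(1)] M]) auto
      then show "holder_upto \<beta> r ((2 * b' + M\<^sub>1 / 2 ^ Suc n) * exp (?\<rho> * r)) v"
        by (simp add: b'_def[symmetric] add_divide_distrib mult.commute)
    qed
  qed
  have "norm (v q - v p) \<le> gronwall_const A \<beta> T * (b + \<epsilon>) * (q - p) powr \<beta>"
    if pq: "0 \<le> p" "p < q" "q \<le> T" for p q
  proof -
    have "norm (v q - v p) \<le> (2 * b' + M\<^sub>1 / 2 ^ n) * exp (?\<rho> * T) * (q - p) powr \<beta>" for n
      using iter[of n] pq by (auto simp: holder_upto_def)
    moreover have "(\<lambda>n. (2 * b' + M\<^sub>1 / 2 ^ n) * exp (?\<rho> * T) * (q - p) powr \<beta>) \<longlonglongrightarrow>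
        (2 * b' + M\<^sub>1 * 0) * exp (?\<rho> * T) * (q - p) powr \<beta>"
      unfolding divide_inverse by (intro tendsto_intros LIMSEQ_inverse_realpow_zero) auto
    ultimately have "norm (v q - v p) \<le> (2 * b' + M\<^sub>1 * 0) * exp (?\<rho> * T) * (q - p) powr \<beta>"
      by (intro LIMSEQ_le_const) auto
    also have "\<dots> \<le> gronwall_const A \<beta> T * (b + \<epsilon>) * (q - p) powr \<beta>"
    proof (intro mult_right_mono)
      have "b' \<le> max 1 (T powr (1 - \<beta>)) * (b + \<epsilon>)"
      proof -
        have "b * 1 \<le> b * max 1 (T powr (1 - \<beta>))" "\<epsilon> * T powr (1 - \<beta>) \<le> \<epsilon> * max 1 (T powr (1 - \<beta>))"
          using nn by (intro mult_left_mono; simp)+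
        then show ?thesis by (simp add: b'_def algebra_simps)
      qed
      then have "b' * exp (?\<rho> * T) \<le> max 1 (T powr (1 - \<beta>)) * (b + \<epsilon>) * exp (?\<rho> * T)"
        by (intro mult_right_mono) auto
      then show "(2 * b' + M\<^sub>1 * 0) * exp (?\<rho> * T) \<le> gronwall_const A \<beta> T * (b + \<epsilon>)"
        by (simp add: gronwall_const_def mult_ac)
    qed simp
    finally show ?thesis .
  qed
  then show ?thesis unfolding holder_upto_def by blast
qed

section \<open>Equations driven by a Lipschitz path\<close>

definition driven_path ::
  "real \<Rightarrow> real \<Rightarrow> (real \<Rightarrow> real ^ 'd::finite) \<Rightarrow> (real \<Rightarrow> real ^ 'm::finite) \<Rightarrow>
   (real \<Rightarrow> 'm \<Rightarrow> 'd \<Rightarrow> real) \<Rightarrow> real \<Rightarrow> real ^ 'm" where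
  "driven_path T\<^sub>0 T\<^sub>1 x w H t =
     (if t \<in> {0..T\<^sub>0} then w t
      else if t \<in> {T\<^sub>0..T\<^sub>1} then \<chi> i. w T\<^sub>0 $ i + (\<Sum>j\<in>UNIV. rs_integral T\<^sub>0 t (\<lambda>s. H s i j) (\<lambda>s. x s $ j))
      else undefined)"

locale driven =
  fixes T\<^sub>0 T\<^sub>1 \<alpha> \<beta> B\<^sub>x B\<^sub>w :: real and x :: "real \<Rightarrow> real ^ 'd::finite" and w :: "real \<Rightarrow> real ^ 'm::finite"
  assumes T: "0 \<le> T\<^sub>0" "T\<^sub>0 < T\<^sub>1" and \<alpha>: "0 < \<alpha>" "\<alpha> < 1" and \<beta>: "0 < \<beta>" "\<beta> < \<alpha>"
    and B: "0 \<le> B\<^sub>x" "0 \<le> B\<^sub>w"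
    and x_lip: "\<And>s t. 0 \<le> s \<Longrightarrow> s \<le> t \<Longrightarrow> t \<le> T\<^sub>1 \<Longrightarrow> norm (x t - x s) \<le> B\<^sub>x * (t - s)"
    and w_holder: "\<And>s t. 0 \<le> s \<Longrightarrow> s \<le> t \<Longrightarrow> t \<le> T\<^sub>0 \<Longrightarrow> norm (w t - w s) \<le> B\<^sub>w * (t - s) powr \<alpha>"
begin

abbreviation "driven_by \<equiv> driven_path T\<^sub>0 T\<^sub>1 x w"

text \<open>The norm is bounded by the sum of the coordinates, and each coordinate is a sum of
  \<open>CARD('d)\<close> integrals; hence the two cardinalities.\<close>

definition \<kappa> where "\<kappa> = real CARD('m) * real CARD('d) * B\<^sub>x"

lemma \<kappa>_nonneg: "0 \<le> \<kappa>" using B by (simp add: \<kappa>_def)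

text \<open>Since \<open>x\<close> is Lipschitz, integrals of bounded coefficients against it are
  Lipschitz after \<open>T\<^sub>0\<close>, although the initial piece \<open>w\<close> is only
  Hoelder continuous. Differences of such paths vanish up to \<open>T\<^sub>0\<close>.\<close>

definition continued :: "real \<Rightarrow> (real \<Rightarrow> real ^ 'm) set" where
  "continued R = {y \<in> extensional {0..T\<^sub>1}. (\<forall>t\<in>{0..T\<^sub>0}. y t = w t) \<and>
     (\<forall>s t. T\<^sub>0 \<le> s \<and> s \<le> t \<and> t \<le> T\<^sub>1 \<longrightarrow> norm (y t - y s) \<le> R * (t - s))}"

lemma x_component: "T\<^sub>0 \<le> s \<Longrightarrow> s \<le> t \<Longrightarrow> t \<le> T\<^sub>1 \<Longrightarrow> \<bar>x t $ j - x s $ j\<bar> \<le> B\<^sub>x * (t - s)"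
  using x_lip[of s t] T component_le_norm_cart[of "x t - x s" j] by simp

lemma driven_by_primitives:
  assumes "\<And>i j. continuous_on {T\<^sub>0..T\<^sub>1} (\<lambda>s. H s i j)"
  obtains F where "\<And>i j. rs_primitive T\<^sub>0 T\<^sub>1 (\<lambda>s. H s i j) (\<lambda>s. x s $ j) (F i j)"
    and "\<And>t i. t \<in> {T\<^sub>0..T\<^sub>1} \<Longrightarrow> driven_by H t $ i = w T\<^sub>0 $ i + (\<Sum>j\<in>UNIV. F i j t - F i j T\<^sub>0)"
proof -
  have "\<exists>F. rs_primitive T\<^sub>0 T\<^sub>1 (\<lambda>s. H s i j) (\<lambda>s. x s $ j) F" for i j
    using rs_primitive_exists[OF T(2) assms x_component] by blast
  then obtain F where F: "\<And>i j. rs_primitive T\<^sub>0 T\<^sub>1 (\<lambda>s. H s i j) (\<lambda>s. x s $ j) (F i j)" by metis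
  have "driven_by H t $ i = w T\<^sub>0 $ i + (\<Sum>j\<in>UNIV. F i j t - F i j T\<^sub>0)" if t: "t \<in> {T\<^sub>0..T\<^sub>1}" for t i
  proof (cases "t = T\<^sub>0")
    case False
    then show ?thesis using t rs_primitive_integral(2)[OF F] by (simp add: driven_path_def)
  qed (use T in \<open>simp add: driven_path_def\<close>)
  with F show thesis by (rule that)
qed

text \<open>Continuity of the coefficient along \<open>y\<close> supplies the integrability that a
  solution must have, so what remains is a fixed point equation for
  \<open>driven_by\<close>.\<close>

lemma controlled_solution_iff:
  assumes "\<And>i j. continuous_on {T\<^sub>0..T\<^sub>1} (\<lambda>s. G s y i j)"
  shows "controlled_solution \<alpha> T\<^sub>0 T\<^sub>1 G x w y \<longleftrightarrow> y \<in> holder_paths \<alpha> T\<^sub>1 \<and> y = driven_by (\<lambda>s. G s y)"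
proof
  assume sol: "controlled_solution \<alpha> T\<^sub>0 T\<^sub>1 G x w y"
  then have y: "y \<in> holder_paths \<alpha> T\<^sub>1" by (simp add: controlled_solution_def)
  have "y t = driven_by (\<lambda>s. G s y) t" for t
  proof -
    consider "t \<in> {0..T\<^sub>0}" | "t \<notin> {0..T\<^sub>0}" "t \<in> {T\<^sub>0..T\<^sub>1}" | "t \<notin> {0..T\<^sub>1}" "t \<notin> {0..T\<^sub>0}" "t \<notin> {T\<^sub>0..T\<^sub>1}"
      using T by fastforce
    then show ?thesis
    proof cases
      case 3
      then show ?thesis using y by (auto simp: holder_paths_def extensional_def driven_path_def)
    qed (use sol in \<open>auto simp: controlled_solution_def driven_path_def vec_eq_iff\<close>)
  qed
  with y show "y \<in> holder_paths \<alpha> T\<^sub>1 \<and> y = driven_by (\<lambda>s. G s y)" by auto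
next
  assume *: "y \<in> holder_paths \<alpha> T\<^sub>1 \<and> y = driven_by (\<lambda>s. G s y)"
  then have y: "y t = driven_by (\<lambda>s. G s y) t" for t by metis
  obtain F where F: "\<And>i j. rs_primitive T\<^sub>0 T\<^sub>1 (\<lambda>s. G s y i j) (\<lambda>s. x s $ j) (F i j)"
    "\<And>t i. t \<in> {T\<^sub>0..T\<^sub>1} \<Longrightarrow> driven_by (\<lambda>s. G s y) t $ i = w T\<^sub>0 $ i + (\<Sum>j\<in>UNIV. F i j t - F i j T\<^sub>0)"
    using driven_by_primitives[of "\<lambda>s. G s y", OF assms] by blast
  show "controlled_solution \<alpha> T\<^sub>0 T\<^sub>1 G x w y"
    unfolding controlled_solution_def
  proof (intro conjI ballI allI)
    show "y \<in> holder_paths \<alpha> T\<^sub>1" using * by blast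
    show "y t = w t" if "t \<in> {0..T\<^sub>0}" for t using y[of t] that by (simp add: driven_path_def)
    fix t i assume t: "t \<in> {T\<^sub>0..T\<^sub>1}"
    show "rs_integrable T\<^sub>0 t (\<lambda>s. G s y i j) (\<lambda>s. x s $ j)" for j
      using rs_primitive_integral(1)[OF F(1)] t by auto
    show "y t $ i = w T\<^sub>0 $ i + (\<Sum>j\<in>UNIV. rs_integral T\<^sub>0 t (\<lambda>s. G s y i j) (\<lambda>s. x s $ j))"
      using rs_primitive_integral(2)[OF F(1)] F(2)[OF t, of i] t y[of t] by simp
  qed
qed

lemma driven_by_diff_increment:
  assumes H: "\<And>i j. continuous_on {T\<^sub>0..T\<^sub>1} (\<lambda>s. H s i j)" "\<And>i j. continuous_on {T\<^sub>0..T\<^sub>1} (\<lambda>s. H' s i j)"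
    and st: "T\<^sub>0 \<le> s" "s \<le> t" "t \<le> T\<^sub>1"
    and der: "\<And>r. s \<le> r \<Longrightarrow> r \<le> t \<Longrightarrow> (\<Phi> has_real_derivative \<phi> r) (at r)"
    and bd: "\<And>r i j. s \<le> r \<Longrightarrow> r \<le> t \<Longrightarrow> \<bar>H r i j - H' r i j\<bar> \<le> \<phi> r"
  shows "norm ((driven_by H t - driven_by H' t) - (driven_by H s - driven_by H' s)) \<le> \<kappa> * (\<Phi> t - \<Phi> s)"
proof -
  obtain F where F: "\<And>i j. rs_primitive T\<^sub>0 T\<^sub>1 (\<lambda>s. H s i j) (\<lambda>s. x s $ j) (F i j)"
    "\<And>t i. t \<in> {T\<^sub>0..T\<^sub>1} \<Longrightarrow> driven_by H t $ i = w T\<^sub>0 $ i + (\<Sum>j\<in>UNIV. F i j t - F i j T\<^sub>0)"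
    using driven_by_primitives[of H, OF H(1)] by blast
  obtain F' where F': "\<And>i j. rs_primitive T\<^sub>0 T\<^sub>1 (\<lambda>s. H' s i j) (\<lambda>s. x s $ j) (F' i j)"
    "\<And>t i. t \<in> {T\<^sub>0..T\<^sub>1} \<Longrightarrow> driven_by H' t $ i = w T\<^sub>0 $ i + (\<Sum>j\<in>UNIV. F' i j t - F' i j T\<^sub>0)"
    using driven_by_primitives[of H', OF H(2)] by blast
  let ?v = "(driven_by H t - driven_by H' t) - (driven_by H s - driven_by H' s)"
  have comp: "\<bar>(F i j t - F' i j t) - (F i j s - F' i j s)\<bar> \<le> B\<^sub>x * (\<Phi> t - \<Phi> s)" for i j
  proof (rule rs_primitive_increment_bound[OF st(2)])
    show "rs_primitive s t (\<lambda>r. H r i j - H' r i j) (\<lambda>r. x r $ j) (\<lambda>r. F i j r - F' i j r)"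
      by (rule rs_primitive_subinterval[OF rs_primitive_diff[OF F(1) F'(1)]]) (use st in auto)
  qed (use st der bd x_component in auto)
  have "norm ?v \<le> (\<Sum>i\<in>UNIV. \<bar>?v $ i\<bar>)" by (rule norm_le_l1_cart)
  also have "\<dots> \<le> (\<Sum>i\<in>(UNIV :: 'm set). \<Sum>j\<in>(UNIV :: 'd set). B\<^sub>x * (\<Phi> t - \<Phi> s))"
  proof (rule sum_mono)
    fix i
    have "?v $ i = (\<Sum>j\<in>UNIV. (F i j t - F' i j t) - (F i j s - F' i j s))"
      using F(2)[of t i] F(2)[of s i] F'(2)[of t i] F'(2)[of s i] st by (simp add: sum_subtractf)
    then show "\<bar>?v $ i\<bar> \<le> (\<Sum>j\<in>(UNIV :: 'd set). B\<^sub>x * (\<Phi> t - \<Phi> s))"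
      by (simp only:) (rule order_trans[OF sum_abs], rule sum_mono, rule comp)
  qed
  also have "\<dots> = \<kappa> * (\<Phi> t - \<Phi> s)" by (simp add: \<kappa>_def)
  finally show ?thesis .
qed

lemma driven_by_zero: "t \<in> {T\<^sub>0..T\<^sub>1} \<Longrightarrow> driven_by (\<lambda>_ _ _. 0) t = w T\<^sub>0"
proof -
  assume t: "t \<in> {T\<^sub>0..T\<^sub>1}"
  have "rs_primitive T\<^sub>0 t (\<lambda>_. 0) g (\<lambda>_. 0)" for g using rs_primitive_const[of T\<^sub>0 t 0 g] by simp
  from rs_primitive_integral(2)[OF this] t have "rs_integral T\<^sub>0 t (\<lambda>_. 0) g = 0" for g by auto
  then show ?thesis using t by (auto simp: driven_path_def vec_eq_iff)
qed

text \<open>The zero coefficient drives a path that is constant after \<open>T\<^sub>0\<close>, so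
  this is the difference estimate against it.\<close>

lemma driven_by_increment:
  assumes H: "\<And>i j. continuous_on {T\<^sub>0..T\<^sub>1} (\<lambda>s. H s i j)"
    and st: "T\<^sub>0 \<le> s" "s \<le> t" "t \<le> T\<^sub>1"
    and der: "\<And>r. s \<le> r \<Longrightarrow> r \<le> t \<Longrightarrow> (\<Phi> has_real_derivative \<phi> r) (at r)"
    and bd: "\<And>r i j. s \<le> r \<Longrightarrow> r \<le> t \<Longrightarrow> \<bar>H r i j\<bar> \<le> \<phi> r"
  shows "norm (driven_by H t - driven_by H s) \<le> \<kappa> * (\<Phi> t - \<Phi> s)"
proof -
  have "norm ((driven_by H t - driven_by (\<lambda>_ _ _. 0) t) - (driven_by H s - driven_by (\<lambda>_ _ _. 0) s)) \<le>
      \<kappa> * (\<Phi> t - \<Phi> s)"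
    by (rule driven_by_diff_increment[OF H _ st der]) (use bd in auto)
  then show ?thesis using st by (simp add: driven_by_zero)
qed

lemma driven_by_continued:
  assumes H: "\<And>i j. continuous_on {T\<^sub>0..T\<^sub>1} (\<lambda>s. H s i j)"
    and bd: "\<And>s i j. s \<in> {T\<^sub>0..T\<^sub>1} \<Longrightarrow> \<bar>H s i j\<bar> \<le> N"
  shows "driven_by H \<in> continued (\<kappa> * N)"
proof -
  have "norm (driven_by H t - driven_by H s) \<le> \<kappa> * N * (t - s)" if st: "T\<^sub>0 \<le> s" "s \<le> t" "t \<le> T\<^sub>1" for s t
  proof -
    have "norm (driven_by H t - driven_by H s) \<le> \<kappa> * (N * t - N * s)"
      by (rule driven_by_increment[OF H st, where \<phi> = "\<lambda>_. N"])
        (use st bd in \<open>auto intro!: derivative_eq_intros\<close>)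
    then show ?thesis by (simp add: algebra_simps)
  qed
  moreover have "driven_by H \<in> extensional {0..T\<^sub>1}"
    using T by (auto simp: extensional_def driven_path_def)
  moreover have "driven_by H t = w t" if "t \<in> {0..T\<^sub>0}" for t using that by (simp add: driven_path_def)
  ultimately show ?thesis by (simp add: continued_def)
qed

lemma holder_from_pieces:
  assumes y: "y \<in> continued R" and R: "0 \<le> R" and st: "0 \<le> s" "s \<le> t" "t \<le> T\<^sub>1"
  shows "norm (y t - y s) \<le> (B\<^sub>w + R * T\<^sub>1 powr (1 - \<alpha>)) * (t - s) powr \<alpha>"
proof -
  have late: "norm (y t - y s) \<le> (R * T\<^sub>1 powr (1 - \<alpha>)) * (t - s) powr \<alpha>"
    if st: "T\<^sub>0 \<le> s" "s \<le> t" "t \<le> T\<^sub>1" for s t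
  proof -
    have "norm (y t - y s) \<le> R * (t - s)" using y st by (auto simp: continued_def)
    also have "t - s = (t - s) powr (1 - \<alpha>) * (t - s) powr \<alpha>"
      using st by (cases "s = t") (auto simp flip: powr_add)
    also have "R * \<dots> \<le> R * (T\<^sub>1 powr (1 - \<alpha>) * (t - s) powr \<alpha>)"
      using st R T \<alpha> by (intro mult_left_mono mult_right_mono powr_mono2) auto
    finally show ?thesis by (simp add: mult.assoc)
  qed
  have early: "norm (y t - y s) \<le> B\<^sub>w * (t - s) powr \<alpha>" if "0 \<le> s" "s \<le> t" "t \<le> T\<^sub>0" for s t
    using y w_holder[OF that] that by (auto simp: continued_def)
  consider "t \<le> T\<^sub>0" | "T\<^sub>0 \<le> s" | "s \<le> T\<^sub>0" "T\<^sub>0 \<le> t" by linarith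
  then show ?thesis
  proof cases
    case 1
    then have "norm (y t - y s) \<le> B\<^sub>w * (t - s) powr \<alpha>" using early st by auto
    also have "\<dots> \<le> (B\<^sub>w + R * T\<^sub>1 powr (1 - \<alpha>)) * (t - s) powr \<alpha>" using R by (intro mult_right_mono) auto
    finally show ?thesis .
  next
    case 2
    then have "norm (y t - y s) \<le> (R * T\<^sub>1 powr (1 - \<alpha>)) * (t - s) powr \<alpha>" using late st by auto
    also have "\<dots> \<le> (B\<^sub>w + R * T\<^sub>1 powr (1 - \<alpha>)) * (t - s) powr \<alpha>" using B by (intro mult_right_mono) auto
    finally show ?thesis .
  next
    case 3
    have "norm (y t - y s) \<le> norm (y t - y T\<^sub>0) + norm (y T\<^sub>0 - y s)"
      using norm_triangle_ineq[of "y t - y T\<^sub>0" "y T\<^sub>0 - y s"] by simp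
    also have "\<dots> \<le> (R * T\<^sub>1 powr (1 - \<alpha>)) * (t - T\<^sub>0) powr \<alpha> + B\<^sub>w * (T\<^sub>0 - s) powr \<alpha>"
      using 3 st by (intro add_mono late early) auto
    also have "\<dots> \<le> (R * T\<^sub>1 powr (1 - \<alpha>)) * (t - s) powr \<alpha> + B\<^sub>w * (t - s) powr \<alpha>"
      using 3 st B R \<alpha> by (intro add_mono mult_left_mono powr_mono2) auto
    finally show ?thesis by (simp add: algebra_simps)
  qed
qed

lemma continued_subset_holder_ball:
  assumes "0 \<le> R"
  shows "continued R \<subseteq> holder_ball \<alpha> T\<^sub>1 (w 0) (B\<^sub>w + R * T\<^sub>1 powr (1 - \<alpha>))"
proof
  fix y assume y: "y \<in> continued R"
  then have "y \<in> extensional {0..T\<^sub>1}" "y 0 = w 0" using T by (auto simp: continued_def)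
  then show "y \<in> holder_ball \<alpha> T\<^sub>1 (w 0) (B\<^sub>w + R * T\<^sub>1 powr (1 - \<alpha>))"
    using holder_from_pieces[OF y assms] by (simp add: holder_ball_def)
qed

text \<open>The difference is zero up to \<open>T\<^sub>0\<close>, so both times can be raised to at
  least \<open>T\<^sub>0\<close> without changing its values; there the Lipschitz bounds
  apply.\<close>

lemma continued_diff_holder:
  assumes y: "y \<in> continued R" and z: "z \<in> continued R" and R: "0 \<le> R"
  shows "holder_upto \<beta> T\<^sub>0 0 (\<lambda>t. y t - z t)"
    and "holder_upto \<beta> T\<^sub>1 (2 * R * T\<^sub>1 powr (1 - \<beta>)) (\<lambda>t. y t - z t)"
proof -
  have early: "y t - z t = 0" if "t \<in> {0..T\<^sub>0}" for t using y z that by (simp add: continued_def)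
  then show "holder_upto \<beta> T\<^sub>0 0 (\<lambda>t. y t - z t)" by (auto simp: holder_upto_def)
  have "norm ((y t - z t) - (y s - z s)) \<le> 2 * R * T\<^sub>1 powr (1 - \<beta>) * (t - s) powr \<beta>"
    if st: "0 \<le> s" "s < t" "t \<le> T\<^sub>1" for s t
  proof -
    define s' t' where "s' = max s T\<^sub>0" and "t' = max t T\<^sub>0"
    have s': "y s - z s = y s' - z s'" "y t - z t = y t' - z t'" "T\<^sub>0 \<le> s'" "s' \<le> t'" "t' \<le> T\<^sub>1" "t' - s' \<le> t - s"
      using early[of s] early[of t] early[of T\<^sub>0] st T by (auto simp: s'_def t'_def max_def)
    have "norm ((y t - z t) - (y s - z s)) \<le> norm (y t' - y s') + norm (z t' - z s')"
      unfolding s' using norm_triangle_ineq4[of "y t' - y s'" "z t' - z s'"] by (simp add: algebra_simps)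
    also have "\<dots> \<le> R * (t' - s') + R * (t' - s')"
      using y z s' by (intro add_mono) (auto simp: continued_def)
    also have "\<dots> \<le> 2 * R * (t - s)" using s'(6) R by (simp add: mult_left_mono)
    also have "t - s = (t - s) powr (1 - \<beta>) * (t - s) powr \<beta>" using st by (simp flip: powr_add)
    also have "2 * R * \<dots> \<le> 2 * R * (T\<^sub>1 powr (1 - \<beta>) * (t - s) powr \<beta>)"
      using st R \<alpha> \<beta> by (intro mult_left_mono mult_right_mono powr_mono2) auto
    finally show ?thesis by (simp add: mult.assoc)
  qed
  then show "holder_upto \<beta> T\<^sub>1 (2 * R * T\<^sub>1 powr (1 - \<beta>)) (\<lambda>t. y t - z t)" by (auto simp: holder_upto_def)
qed

lemma exp_antiderivative:
  assumes "0 < \<rho>"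
  shows "((\<lambda>r. L * M * exp (\<rho> * r) / \<rho> + \<epsilon> * r) has_real_derivative L * (M * exp (\<rho> * r)) + \<epsilon>) (at r)"
  using assms by (auto intro!: derivative_eq_intros)

text \<open>Inserting a weighted bound on the difference into \<open>lip\<close> and integrating
  gives the hypothesis \<open>step\<close> of \<open>weighted_bound\<close>, with
  \<open>b = 0\<close>. The estimate \<open>lip\<close> concerns this one pair of paths and may mix
  \<open>G\<close> and \<open>G'\<close>, so only one of the two coefficients needs a Lipschitz
  constant.\<close>

lemma stability:
  assumes y: "y \<in> continued R" "y = driven_by (\<lambda>s. G s y)" and z: "z \<in> continued R" "z = driven_by (\<lambda>s. G' s z)"
    and R: "0 \<le> R" and L: "0 \<le> L" "0 \<le> \<epsilon>"
    and cont: "\<And>i j. continuous_on {T\<^sub>0..T\<^sub>1} (\<lambda>s. G s y i j)" "\<And>i j. continuous_on {T\<^sub>0..T\<^sub>1} (\<lambda>s. G' s z i j)"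
    and lip: "\<And>s c i j. s \<in> {T\<^sub>0..T\<^sub>1} \<Longrightarrow> 0 \<le> c \<Longrightarrow> holder_upto \<beta> s c (\<lambda>t. y t - z t) \<Longrightarrow>
      \<bar>G s y i j - G' s z i j\<bar> \<le> L * c + \<epsilon>"
  shows "holder_upto \<beta> T\<^sub>1 (gronwall_const (\<kappa> * L) \<beta> T\<^sub>1 * (0 + \<kappa> * \<epsilon>)) (\<lambda>t. y t - z t)"
proof (rule weighted_bound[where T\<^sub>0 = T\<^sub>0])
  show "holder_upto \<beta> T\<^sub>0 0 (\<lambda>t. y t - z t)"
    "holder_upto \<beta> T\<^sub>1 (2 * R * T\<^sub>1 powr (1 - \<beta>)) (\<lambda>t. y t - z t)"
    using continued_diff_holder[OF y(1) z(1) R] by auto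
  fix M \<rho> s t :: real
  assume \<rho>: "0 < \<rho>" and M: "0 \<le> M" and h: "\<And>r. r \<in> {T\<^sub>0..T\<^sub>1} \<Longrightarrow> holder_upto \<beta> r (M * exp (\<rho> * r)) (\<lambda>t. y t - z t)"
    and st: "T\<^sub>0 \<le> s" "s \<le> t" "t \<le> T\<^sub>1"
  have "norm ((driven_by (\<lambda>s. G s y) t - driven_by (\<lambda>s. G' s z) t) - (driven_by (\<lambda>s. G s y) s - driven_by (\<lambda>s. G' s z) s)) \<le>
      \<kappa> * ((L * M * exp (\<rho> * t) / \<rho> + \<epsilon> * t) - (L * M * exp (\<rho> * s) / \<rho> + \<epsilon> * s))"
    using M st by (intro driven_by_diff_increment[OF cont st exp_antiderivative[OF \<rho>]] lip h) auto
  then show "norm ((y t - z t) - (y s - z s)) \<le>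
      \<kappa> * L * M * (exp (\<rho> * t) - exp (\<rho> * s)) / \<rho> + \<kappa> * \<epsilon> * (t - s)"
    unfolding y(2)[symmetric] z(2)[symmetric] by (simp add: algebra_simps diff_divide_distrib)
qed (use \<alpha> \<beta> T L \<kappa>_nonneg in auto)

text \<open>The scheme of \<open>stability\<close> for \<open>y\<close> itself, with the initial
  piece contributing \<open>B\<^sub>w\<close>. The constant \<open>R\<close> only ensures that some
  Hoelder constant exists; it is absent from the conclusion, which makes the bound fit for choosing
  a truncation level.\<close>

lemma a_priori_bound:
  assumes y: "y \<in> continued R" "y = driven_by H" and R: "0 \<le> R" and A: "0 \<le> A" "0 \<le> A'"
    and cont: "\<And>i j. continuous_on {T\<^sub>0..T\<^sub>1} (\<lambda>s. H s i j)"
    and growth: "\<And>s c i j. s \<in> {T\<^sub>0..T\<^sub>1} \<Longrightarrow> 0 \<le> c \<Longrightarrow> holder_upto \<beta> s c y \<Longrightarrow> \<bar>H s i j\<bar> \<le> A * c + A'"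
  shows "holder_upto \<beta> T\<^sub>1 (gronwall_const (\<kappa> * A) \<beta> T\<^sub>1 * (B\<^sub>w * T\<^sub>1 powr (\<alpha> - \<beta>) + \<kappa> * A')) y"
proof (rule weighted_bound[where T\<^sub>0 = T\<^sub>0])
  have conv: "C * (t - s) powr \<alpha> \<le> C * T\<^sub>1 powr (\<alpha> - \<beta>) * (t - s) powr \<beta>"
    if "0 \<le> C" "0 \<le> s" "s < t" "t \<le> T\<^sub>1" for C s t
  proof -
    have "(t - s) powr \<alpha> = (t - s) powr (\<alpha> - \<beta>) * (t - s) powr \<beta>" by (simp flip: powr_add)
    also have "\<dots> \<le> T\<^sub>1 powr (\<alpha> - \<beta>) * (t - s) powr \<beta>"
      using that \<beta> by (intro mult_right_mono powr_mono2) auto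
    finally show ?thesis unfolding mult.assoc using that by (intro mult_left_mono)
  qed
  show "holder_upto \<beta> T\<^sub>0 (B\<^sub>w * T\<^sub>1 powr (\<alpha> - \<beta>)) y"
    unfolding holder_upto_def
  proof (intro allI impI)
    fix s t assume st: "0 \<le> s \<and> s < t \<and> t \<le> T\<^sub>0"
    have "norm (y t - y s) = norm (w t - w s)" using y(1) st by (auto simp: continued_def)
    also have "\<dots> \<le> B\<^sub>w * (t - s) powr \<alpha>" using w_holder st by auto
    also have "\<dots> \<le> B\<^sub>w * T\<^sub>1 powr (\<alpha> - \<beta>) * (t - s) powr \<beta>" using st T B by (intro conv) auto
    finally show "norm (y t - y s) \<le> B\<^sub>w * T\<^sub>1 powr (\<alpha> - \<beta>) * (t - s) powr \<beta>" .
  qed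
  show "holder_upto \<beta> T\<^sub>1 ((B\<^sub>w + R * T\<^sub>1 powr (1 - \<alpha>)) * T\<^sub>1 powr (\<alpha> - \<beta>)) y"
    unfolding holder_upto_def
  proof (intro allI impI)
    fix s t assume st: "0 \<le> s \<and> s < t \<and> t \<le> T\<^sub>1"
    have "norm (y t - y s) \<le> (B\<^sub>w + R * T\<^sub>1 powr (1 - \<alpha>)) * (t - s) powr \<alpha>"
      using holder_from_pieces[OF y(1) R, of s t] st by auto
    also have "\<dots> \<le> (B\<^sub>w + R * T\<^sub>1 powr (1 - \<alpha>)) * T\<^sub>1 powr (\<alpha> - \<beta>) * (t - s) powr \<beta>"
      using st R B by (intro conv) auto
    finally show "norm (y t - y s) \<le> (B\<^sub>w + R * T\<^sub>1 powr (1 - \<alpha>)) * T\<^sub>1 powr (\<alpha> - \<beta>) * (t - s) powr \<beta>" .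
  qed
  fix M \<rho> s t :: real
  assume \<rho>: "0 < \<rho>" and M: "0 \<le> M" and h: "\<And>r. r \<in> {T\<^sub>0..T\<^sub>1} \<Longrightarrow> holder_upto \<beta> r (M * exp (\<rho> * r)) y"
    and st: "T\<^sub>0 \<le> s" "s \<le> t" "t \<le> T\<^sub>1"
  have "norm (driven_by H t - driven_by H s) \<le>
      \<kappa> * ((A * M * exp (\<rho> * t) / \<rho> + A' * t) - (A * M * exp (\<rho> * s) / \<rho> + A' * s))"
    using M st by (intro driven_by_increment[OF cont st exp_antiderivative[OF \<rho>]] growth h) auto
  then show "norm (y t - y s) \<le> \<kappa> * A * M * (exp (\<rho> * t) - exp (\<rho> * s)) / \<rho> + \<kappa> * A' * (t - s)"
    unfolding y(2)[symmetric] by (simp add: algebra_simps diff_divide_distrib)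
qed (use \<alpha> \<beta> T A B \<kappa>_nonneg in auto)

end

section \<open>Truncation, Picard iteration and uniqueness\<close>

definition level_clamp :: "real \<Rightarrow> real \<Rightarrow> real" where
  "level_clamp N r = max (- N) (min N r)"

lemma level_clamp_bound: "0 \<le> N \<Longrightarrow> \<bar>level_clamp N r\<bar> \<le> N"
  by (auto simp: level_clamp_def)

lemma level_clamp_lipschitz: "\<bar>level_clamp N r - level_clamp N s\<bar> \<le> \<bar>r - s\<bar>"
  by (auto simp: level_clamp_def max_def min_def)

lemma level_clamp_id: "\<bar>r\<bar> \<le> N \<Longrightarrow> level_clamp N r = r"
  by (auto simp: level_clamp_def)

lemma level_clamp_abs_le: "0 \<le> N \<Longrightarrow> \<bar>level_clamp N r\<bar> \<le> \<bar>r\<bar>"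
  by (auto simp: level_clamp_def max_def min_def)

lemma continuous_on_level_clamp: "continuous_on S f \<Longrightarrow> continuous_on S (\<lambda>t. level_clamp N (f t))"
  unfolding level_clamp_def by (intro continuous_intros)

context driven
begin

lemma continued_iff:
  "y \<in> continued R \<longleftrightarrow> y \<in> extensional {0..T\<^sub>1} \<and> (\<forall>t\<in>{0..T\<^sub>0}. y t = w t) \<and>
     (\<forall>s t. T\<^sub>0 \<le> s \<and> s \<le> t \<and> t \<le> T\<^sub>1 \<longrightarrow> norm (y t - y s) \<le> R * (t - s))"
  by (simp add: continued_def)

lemma driven_by_cong:
  assumes "\<And>s i j. s \<in> {T\<^sub>0..T\<^sub>1} \<Longrightarrow> H s i j = H' s i j"
  shows "driven_by H = driven_by H'"
proof
  fix t
  have "rs_integral T\<^sub>0 t (\<lambda>s. H s i j) g = rs_integral T\<^sub>0 t (\<lambda>s. H' s i j) g" if "t \<le> T\<^sub>1" for i j g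
    by (rule rs_integral_cong) (use assms that in auto)
  then show "driven_by H t = driven_by H' t" by (simp add: driven_path_def)
qed

text \<open>Limits of the iterates are taken pointwise. Membership in
  \<open>continued (\<kappa> * N)\<close> and weighted bounds on differences both pass to pointwise
  limits, so completeness of a Hoelder space is never invoked.\<close>

lemma picard_fixed_point:
  assumes N: "0 \<le> N" and L: "0 \<le> L"
    and cont: "\<And>y i j. y \<in> continued (\<kappa> * N) \<Longrightarrow> continuous_on {T\<^sub>0..T\<^sub>1} (\<lambda>s. H s y i j)"
    and bd: "\<And>y s i j. y \<in> continued (\<kappa> * N) \<Longrightarrow> s \<in> {T\<^sub>0..T\<^sub>1} \<Longrightarrow> \<bar>H s y i j\<bar> \<le> N"
    and lip: "\<And>y z s c i j. y \<in> continued (\<kappa> * N) \<Longrightarrow> z \<in> continued (\<kappa> * N) \<Longrightarrow> s \<in> {T\<^sub>0..T\<^sub>1} \<Longrightarrow> 0 \<le> c \<Longrightarrow>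
      holder_upto \<beta> s c (\<lambda>t. y t - z t) \<Longrightarrow> \<bar>H s y i j - H s z i j\<bar> \<le> L * c"
  shows "\<exists>y \<in> continued (\<kappa> * N). y = driven_by (\<lambda>s. H s y)"
proof -
  define R where "R = \<kappa> * N"
  have R: "0 \<le> R" using \<kappa>_nonneg N by (simp add: R_def)
  define \<Gamma> where "\<Gamma> y = driven_by (\<lambda>s. H s y)" for y
  have \<Gamma>: "\<Gamma> y \<in> continued R" if "y \<in> continued R" for y
    unfolding R_def \<Gamma>_def using that[unfolded R_def] by (intro driven_by_continued cont bd)
  define \<rho> where "\<rho> = weight_rate (\<kappa> * L) \<beta>"
  have \<rho>: "0 < \<rho>" unfolding \<rho>_def using \<kappa>_nonneg L by (intro weight_rate_pos) auto
  \<comment> \<open>The bound is required up to every \<open>r\<close> with the weight at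
    \<open>r\<close>, the form in which the Lipschitz condition on a coefficient at time
    \<open>r\<close> can use it.\<close>
  define close where "close c a b \<longleftrightarrow> (\<forall>r\<in>{0..T\<^sub>1}. holder_upto \<beta> r (c * exp (\<rho> * r)) (\<lambda>t. a t - b t))"
    for c and a b :: "real \<Rightarrow> real ^ 'm"
  have contract: "close (c / 2) (\<Gamma> a) (\<Gamma> b)"
    if a: "a \<in> continued R" and b: "b \<in> continued R" and c: "0 \<le> c" and ab: "close c a b" for a b c
    unfolding close_def
  proof
    fix r assume r: "r \<in> {0..T\<^sub>1}"
    have "holder_upto \<beta> r ((0 + 0 * T\<^sub>1 powr (1 - \<beta>) + c / 2) * exp (\<rho> * r)) (\<lambda>t. \<Gamma> a t - \<Gamma> b t)"
      unfolding \<rho>_def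
    proof (rule weighted_step[where T\<^sub>0 = T\<^sub>0, OF _ _ _ _ _ _ _ c _ _ r])
      show "holder_upto \<beta> T\<^sub>0 0 (\<lambda>t. \<Gamma> a t - \<Gamma> b t)"
        by (rule continued_diff_holder(1)[OF \<Gamma>[OF a] \<Gamma>[OF b] R])
      fix s t assume st: "T\<^sub>0 \<le> s" "s \<le> t" "t \<le> T\<^sub>1"
      have "norm ((\<Gamma> a t - \<Gamma> b t) - (\<Gamma> a s - \<Gamma> b s)) \<le>
          \<kappa> * ((L * c * exp (\<rho> * t) / \<rho> + 0 * t) - (L * c * exp (\<rho> * s) / \<rho> + 0 * s))"
        unfolding \<Gamma>_def
      proof (rule driven_by_diff_increment[OF cont[OF a[unfolded R_def]] cont[OF b[unfolded R_def]] st exp_antiderivative[OF \<rho>]])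
        fix r i j assume "s \<le> r" "r \<le> t"
        then have r: "r \<in> {T\<^sub>0..T\<^sub>1}" "r \<in> {0..T\<^sub>1}" using st T by auto
        have "\<bar>H r a i j - H r b i j\<bar> \<le> L * (c * exp (\<rho> * r))"
          using ab r(2) c unfolding close_def
          by (intro lip[OF a[unfolded R_def] b[unfolded R_def] r(1)]) auto
        then show "\<bar>H r a i j - H r b i j\<bar> \<le> L * (c * exp (\<rho> * r)) + 0" by simp
      qed
      then show "norm (\<Gamma> a t - \<Gamma> b t - (\<Gamma> a s - \<Gamma> b s)) \<le>
          \<kappa> * L * c * (exp (weight_rate (\<kappa> * L) \<beta> * t) - exp (weight_rate (\<kappa> * L) \<beta> * s)) / weight_rate (\<kappa> * L) \<beta> + 0 * (t - s)"
        unfolding \<rho>_def[symmetric] by (simp add: algebra_simps diff_divide_distrib)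
    qed (use \<alpha> \<beta> T L \<kappa>_nonneg in auto)
    then show "holder_upto \<beta> r (c / 2 * exp (\<rho> * r)) (\<lambda>t. \<Gamma> a t - \<Gamma> b t)" by simp
  qed
  define K where "K = exp (\<rho> * T\<^sub>1) * T\<^sub>1 powr \<beta>"
  have pointwise: "norm (a t - b t) \<le> c * K"
    if a: "a \<in> continued R" and b: "b \<in> continued R" and c: "0 \<le> c" and ab: "close c a b" and t: "t \<in> {0..T\<^sub>1}" for a b c t
  proof -
    have 0: "a 0 - b 0 = 0" using a b T by (simp add: continued_iff)
    show ?thesis
    proof (cases "t = 0")
      case True
      then show ?thesis using 0 c by (simp add: K_def)
    next
      case False
      then have "norm ((a t - b t) - (a 0 - b 0)) \<le> c * exp (\<rho> * t) * (t - 0) powr \<beta>"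
        using ab[unfolded close_def holder_upto_def, rule_format, of t 0 t] t by simp
      also have "\<dots> \<le> c * exp (\<rho> * T\<^sub>1) * T\<^sub>1 powr \<beta>"
        using t c \<rho> \<beta> by (intro mult_mono powr_mono2) auto
      finally show ?thesis using 0 by (simp add: K_def mult.assoc)
    qed
  qed
  define u where "u n = (\<Gamma> ^^ n) (driven_by (\<lambda>_ _ _. 0))" for n
  have u: "u n \<in> continued R" for n
  proof (induction n)
    case 0
    show ?case unfolding u_def R_def using N by (simp add: driven_by_continued)
  next
    case (Suc n)
    then show ?case using \<Gamma> by (simp add: u_def)
  qed
  have u_Suc: "\<Gamma> (u n) = u (Suc n)" for n by (simp add: u_def)
  \<comment> \<open>This bounds the difference of any two members of \<open>continued R\<close>, in
    particular the first Picard step.\<close>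
  define M where "M = 2 * R * T\<^sub>1 powr (1 - \<beta>)"
  have M: "0 \<le> M" using R by (simp add: M_def)
  have step: "close (M / 2 ^ n) (u (Suc n)) (u n)" for n
  proof (induction n)
    case 0
    show ?case unfolding close_def
    proof
      fix r assume r: "r \<in> {0..T\<^sub>1}"
      have "M * 1 \<le> M * exp (\<rho> * r)" using r \<rho> M by (intro mult_left_mono) auto
      then show "holder_upto \<beta> r (M / 2 ^ 0 * exp (\<rho> * r)) (\<lambda>t. u (Suc 0) t - u 0 t)"
        using continued_diff_holder(2)[OF u u R, of "Suc 0" 0] r unfolding M_def[symmetric]
        by (elim holder_upto_mono) auto
    qed
  next
    case (Suc n)
    have "close (M / 2 ^ n / 2) (\<Gamma> (u (Suc n))) (\<Gamma> (u n))" using M by (intro contract u Suc) auto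
    moreover have "M / 2 ^ n / 2 = M / 2 ^ Suc n" by simp
    ultimately show ?case unfolding u_Suc by (simp only:)
  qed
  have add: "close (c + c') a d" if "close c a b" "close c' b d" for c c' and a b d :: "real \<Rightarrow> real ^ 'm"
    unfolding close_def holder_upto_def
  proof (intro ballI allI impI)
    fix r p q assume r: "r \<in> {0..T\<^sub>1}" and pq: "0 \<le> p \<and> p < q \<and> q \<le> r"
    have "norm ((a q - d q) - (a p - d p)) \<le> norm ((a q - b q) - (a p - b p)) + norm ((b q - d q) - (b p - d p))"
      using norm_triangle_ineq[of "(a q - b q) - (a p - b p)" "(b q - d q) - (b p - d p)"] by (simp add: algebra_simps)
    also have "\<dots> \<le> c * exp (\<rho> * r) * (q - p) powr \<beta> + c' * exp (\<rho> * r) * (q - p) powr \<beta>"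
      using that r pq unfolding close_def holder_upto_def by (intro add_mono) auto
    finally show "norm ((a q - d q) - (a p - d p)) \<le> (c + c') * exp (\<rho> * r) * (q - p) powr \<beta>"
      by (simp add: distrib_right)
  qed
  \<comment> \<open>The exact partial sums of the geometric series are kept so that the induction
    closes; the subtracted term is dropped afterwards.\<close>
  have tail: "close (2 * M / 2 ^ n - 2 * M / 2 ^ (n + k)) (u (n + k)) (u n)" for n k
  proof (induction k)
    case 0
    show ?case by (simp add: close_def holder_upto_def)
  next
    case (Suc k)
    have "close (M / 2 ^ (n + k) + (2 * M / 2 ^ n - 2 * M / 2 ^ (n + k))) (u (Suc (n + k))) (u n)"
      by (rule add[OF step Suc])
    then show ?case by (simp add: field_simps)
  qed
  have "\<exists>l. (\<lambda>n. u n t) \<longlonglongrightarrow> l" for t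
  proof (cases "t \<in> {0..T\<^sub>1}")
    case True
    have "summable (\<lambda>n. M * K * (1 / 2) ^ n)" by (intro summable_mult summable_geometric) auto
    then have "summable (\<lambda>n. u (Suc n) t - u n t)"
    proof (rule summable_comparison_test'[where N = 0])
      show "norm (u (Suc n) t - u n t) \<le> M * K * (1 / 2) ^ n" for n
        using pointwise[OF u u _ step True, of n] M by (simp add: power_divide)
    qed
    then have "convergent (\<lambda>n. u n t - u 0 t)" by (simp add: summable_iff_convergent sum_lessThan_telescope[of "\<lambda>n. u n t"])
    then have "convergent (\<lambda>n. u n t)" by (simp add: convergent_diff_const_right_iff)
    then show ?thesis by (simp add: convergent_def)
  next
    case False
    then have "u n t = undefined" for n using u[of n] by (auto simp: continued_iff extensional_def)
    then show ?thesis by auto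
  qed
  then obtain y where y: "\<And>t. (\<lambda>n. u n t) \<longlonglongrightarrow> y t" by metis
  have yR: "y \<in> continued R"
    unfolding continued_iff
  proof (intro conjI ballI allI impI)
    show "y \<in> extensional {0..T\<^sub>1}" unfolding extensional_def
    proof (intro CollectI allI impI)
      fix t assume "t \<notin> {0..T\<^sub>1}"
      then have "u n t = undefined" for n using u[of n] by (auto simp: continued_iff extensional_def)
      then show "y t = undefined" using y[of t] by (simp add: LIMSEQ_const_iff)
    qed
    show "y t = w t" if t: "t \<in> {0..T\<^sub>0}" for t
    proof -
      have "u n t = w t" for n using u[of n] t by (auto simp: continued_iff)
      then show ?thesis using y[of t] by (simp add: LIMSEQ_const_iff)
    qed
    show "norm (y t - y s) \<le> R * (t - s)" if "T\<^sub>0 \<le> s \<and> s \<le> t \<and> t \<le> T\<^sub>1" for s t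
    proof (rule LIMSEQ_le_const2[OF tendsto_norm[OF tendsto_diff[OF y y]]])
      show "\<exists>N. \<forall>n\<ge>N. norm (u n t - u n s) \<le> R * (t - s)"
        using u that by (auto simp: continued_iff)
    qed
  qed
  have near: "close (2 * M / 2 ^ n) y (u n)" for n
    unfolding close_def holder_upto_def
  proof (intro ballI allI impI)
    fix r p q assume r: "r \<in> {0..T\<^sub>1}" and pq: "0 \<le> p \<and> p < q \<and> q \<le> r"
    have "(\<lambda>k. u (n + k) t) \<longlonglongrightarrow> y t" for t using LIMSEQ_ignore_initial_segment[OF y[of t], of n] by (simp add: add.commute)
    then have "(\<lambda>k. norm ((u (n + k) q - u n q) - (u (n + k) p - u n p))) \<longlonglongrightarrow> norm ((y q - u n q) - (y p - u n p))"
      by (intro tendsto_intros)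
    moreover have "norm ((u (n + k) q - u n q) - (u (n + k) p - u n p)) \<le> 2 * M / 2 ^ n * exp (\<rho> * r) * (q - p) powr \<beta>" for k
    proof -
      have "norm ((u (n + k) q - u n q) - (u (n + k) p - u n p)) \<le>
          (2 * M / 2 ^ n - 2 * M / 2 ^ (n + k)) * exp (\<rho> * r) * (q - p) powr \<beta>"
        using tail[of n k] r pq unfolding close_def holder_upto_def by auto
      also have "\<dots> \<le> 2 * M / 2 ^ n * exp (\<rho> * r) * (q - p) powr \<beta>"
        using M by (intro mult_right_mono) auto
      finally show ?thesis .
    qed
    ultimately show "norm ((y q - u n q) - (y p - u n p)) \<le> 2 * M / 2 ^ n * exp (\<rho> * r) * (q - p) powr \<beta>"
      by (intro LIMSEQ_le_const2) auto
  qed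
  have "y t = \<Gamma> y t" for t
  proof (cases "t \<in> {0..T\<^sub>1}")
    case True
    have est: "norm (u (Suc n) t - \<Gamma> y t) \<le> M * K * (1 / 2) ^ n" for n
    proof -
      have "close (2 * M / 2 ^ n / 2) (\<Gamma> y) (\<Gamma> (u n))" using M by (intro contract yR u near) auto
      then have "close (M / 2 ^ n) (\<Gamma> y) (u (Suc n))" by (simp add: u_Suc)
      from pointwise[OF \<Gamma>[OF yR] u _ this True] M show ?thesis
        by (simp add: norm_minus_commute power_divide)
    qed
    have "(\<lambda>n. M * K * (1 / 2) ^ n) \<longlonglongrightarrow> 0" by (intro tendsto_mult_right_zero LIMSEQ_power_zero) auto
    then have "(\<lambda>n. u (Suc n) t - \<Gamma> y t) \<longlonglongrightarrow> 0"
      by (rule Lim_null_comparison[OF always_eventually[OF allI[OF est]]])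
    then have "(\<lambda>n. u (Suc n) t) \<longlonglongrightarrow> \<Gamma> y t" by (simp add: LIM_zero_iff)
    then show ?thesis using LIMSEQ_Suc[OF y[of t]] by (rule LIMSEQ_unique[rotated])
  next
    case False
    then show ?thesis using yR \<Gamma>[OF yR] by (auto simp: continued_iff extensional_def)
  qed
  then have "y = driven_by (\<lambda>s. H s y)" unfolding \<Gamma>_def by auto
  then show ?thesis using yR unfolding R_def by blast
qed

text \<open>The bound by \<open>N\<close> is demanded only along solutions of the truncated
  equation; on other paths of \<open>continued (\<kappa> * N)\<close> the coefficient may exceed
  it.\<close>

lemma clamped_solution_exists:
  assumes N: "0 \<le> N" and L: "0 \<le> L"
    and cont: "\<And>y i j. y \<in> continued (\<kappa> * N) \<Longrightarrow> continuous_on {T\<^sub>0..T\<^sub>1} (\<lambda>s. G s y i j)"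
    and lip: "\<And>y z s c i j. y \<in> continued (\<kappa> * N) \<Longrightarrow> z \<in> continued (\<kappa> * N) \<Longrightarrow> s \<in> {T\<^sub>0..T\<^sub>1} \<Longrightarrow> 0 \<le> c \<Longrightarrow>
      holder_upto \<beta> s c (\<lambda>t. y t - z t) \<Longrightarrow> \<bar>G s y i j - G s z i j\<bar> \<le> L * c"
    and bound: "\<And>y s i j. y \<in> continued (\<kappa> * N) \<Longrightarrow> y = driven_by (\<lambda>s i j. level_clamp N (G s y i j)) \<Longrightarrow>
      s \<in> {T\<^sub>0..T\<^sub>1} \<Longrightarrow> \<bar>G s y i j\<bar> \<le> N"
  shows "\<exists>y \<in> continued (\<kappa> * N). y = driven_by (\<lambda>s. G s y)"
proof -
  have "\<exists>y \<in> continued (\<kappa> * N). y = driven_by (\<lambda>s i j. level_clamp N (G s y i j))"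
  proof (rule picard_fixed_point[OF N L])
    show "\<bar>level_clamp N (G s y i j) - level_clamp N (G s z i j)\<bar> \<le> L * c"
      if "y \<in> continued (\<kappa> * N)" "z \<in> continued (\<kappa> * N)" "s \<in> {T\<^sub>0..T\<^sub>1}" "0 \<le> c" "holder_upto \<beta> s c (\<lambda>t. y t - z t)" for y z s c i j
      using lip[OF that, of i j] level_clamp_lipschitz[of N "G s y i j" "G s z i j"] by linarith
  qed (use cont N in \<open>auto intro!: continuous_on_level_clamp level_clamp_bound\<close>)
  then obtain y where y: "y \<in> continued (\<kappa> * N)" "y = driven_by (\<lambda>s i j. level_clamp N (G s y i j))" by blast
  have "driven_by (\<lambda>s i j. level_clamp N (G s y i j)) = driven_by (\<lambda>s. G s y)"
    by (rule driven_by_cong) (use bound[OF y] in \<open>auto intro!: level_clamp_id\<close>)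
  then show ?thesis using y by metis
qed

text \<open>Truncation does not increase absolute values, so the truncated coefficient grows with
  the same \<open>A\<close> and \<open>A'\<close>. The resulting bound does not contain
  \<open>N\<close>; taking it as the value of \<open>N\<close> closes the argument.\<close>

lemma a_priori_coefficient_bound:
  assumes N: "0 \<le> N" and A: "0 \<le> A" "0 \<le> A'"
    and y: "y \<in> continued (\<kappa> * N)" "y = driven_by (\<lambda>s i j. level_clamp N (G s y i j))"
    and cont: "\<And>i j. continuous_on {T\<^sub>0..T\<^sub>1} (\<lambda>s. G s y i j)"
    and growth: "\<And>s c i j. s \<in> {T\<^sub>0..T\<^sub>1} \<Longrightarrow> 0 \<le> c \<Longrightarrow> holder_upto \<beta> s c y \<Longrightarrow> \<bar>G s y i j\<bar> \<le> A * c + A'"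
    and s: "s \<in> {T\<^sub>0..T\<^sub>1}"
  shows "\<bar>G s y i j\<bar> \<le> A * (gronwall_const (\<kappa> * A) \<beta> T\<^sub>1 * (B\<^sub>w * T\<^sub>1 powr (\<alpha> - \<beta>) + \<kappa> * A')) + A'"
proof (rule growth[OF s])
  have "holder_upto \<beta> T\<^sub>1 (gronwall_const (\<kappa> * A) \<beta> T\<^sub>1 * (B\<^sub>w * T\<^sub>1 powr (\<alpha> - \<beta>) + \<kappa> * A')) y"
  proof (rule a_priori_bound[OF y])
    show "\<bar>level_clamp N (G s y i j)\<bar> \<le> A * c + A'" if "s \<in> {T\<^sub>0..T\<^sub>1}" "0 \<le> c" "holder_upto \<beta> s c y" for s c i j
      using growth[OF that, of i j] level_clamp_abs_le[OF N, of "G s y i j"] by linarith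
  qed (use A N \<kappa>_nonneg cont in \<open>auto intro!: continuous_on_level_clamp\<close>)
  then show "holder_upto \<beta> s (gronwall_const (\<kappa> * A) \<beta> T\<^sub>1 * (B\<^sub>w * T\<^sub>1 powr (\<alpha> - \<beta>) + \<kappa> * A')) y"
    by (rule holder_upto_mono) (use s in auto)
  show "0 \<le> gronwall_const (\<kappa> * A) \<beta> T\<^sub>1 * (B\<^sub>w * T\<^sub>1 powr (\<alpha> - \<beta>) + \<kappa> * A')"
    using A B \<kappa>_nonneg by (intro mult_nonneg_nonneg gronwall_const_nonneg add_nonneg_nonneg) auto
qed

text \<open>A solution is a priori only Hoelder continuous. Its coefficient, continuous on a compact
  interval, is bounded, so the solution is Lipschitz after \<open>T\<^sub>0\<close> and comes within
  reach of \<open>stability\<close>.\<close>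

lemma solution_continued:
  assumes sol: "controlled_solution \<alpha> T\<^sub>0 T\<^sub>1 G x w y"
    and cont: "\<And>i j. continuous_on {T\<^sub>0..T\<^sub>1} (\<lambda>s. G s y i j)"
  shows "\<exists>R\<ge>0. y \<in> continued R"
proof -
  have "compact ((\<lambda>s. G s y i j) ` {T\<^sub>0..T\<^sub>1})" for i j
    by (intro compact_continuous_image cont) auto
  then have "\<exists>N. \<forall>s\<in>{T\<^sub>0..T\<^sub>1}. \<bar>G s y i j\<bar> \<le> N" for i j
    using compact_imp_bounded[of "(\<lambda>s. G s y i j) ` {T\<^sub>0..T\<^sub>1}"] unfolding bounded_iff by auto
  then obtain N where N: "\<And>i j s. s \<in> {T\<^sub>0..T\<^sub>1} \<Longrightarrow> \<bar>G s y i j\<bar> \<le> N i j" by metis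
  define N' where "N' = (\<Sum>i\<in>UNIV. \<Sum>j\<in>UNIV. \<bar>N i j\<bar>)"
  have "\<bar>G s y i j\<bar> \<le> N'" if "s \<in> {T\<^sub>0..T\<^sub>1}" for s i j
  proof -
    have "\<bar>G s y i j\<bar> \<le> \<bar>N i j\<bar>" using N[OF that, of i j] by simp
    also have "\<dots> \<le> (\<Sum>j\<in>UNIV. \<bar>N i j\<bar>)" by (rule member_le_sum) auto
    also have "\<dots> \<le> N'" unfolding N'_def by (rule member_le_sum) (auto intro: sum_nonneg)
    finally show ?thesis .
  qed
  then have "driven_by (\<lambda>s. G s y) \<in> continued (\<kappa> * N')" by (intro driven_by_continued cont)
  moreover have "y = driven_by (\<lambda>s. G s y)" using sol controlled_solution_iff[of G y, OF cont] by blast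
  moreover have "0 \<le> \<kappa> * N'" using \<kappa>_nonneg by (auto simp: N'_def intro!: mult_nonneg_nonneg sum_nonneg)
  ultimately show ?thesis by metis
qed

lemma continued_mono: "y \<in> continued R \<Longrightarrow> R \<le> R' \<Longrightarrow> y \<in> continued R'"
  unfolding continued_iff by (meson diff_ge_0_iff_ge mult_right_mono order_trans)

text \<open>The Lipschitz constant may depend on \<open>R\<close>, so a common \<open>R\<close> for
  the two solutions is fixed before \<open>stability\<close> is used with error
  \<open>0\<close>.\<close>

lemma solution_unique:
  assumes sol: "controlled_solution \<alpha> T\<^sub>0 T\<^sub>1 G x w y" "controlled_solution \<alpha> T\<^sub>0 T\<^sub>1 G x w z"
    and cont: "\<And>y i j. y \<in> holder_paths \<alpha> T\<^sub>1 \<Longrightarrow> continuous_on {T\<^sub>0..T\<^sub>1} (\<lambda>s. G s y i j)"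
    and lip: "\<And>R. 0 \<le> R \<Longrightarrow> \<exists>L\<ge>0. \<forall>y\<in>continued R. \<forall>z\<in>continued R. \<forall>s\<in>{T\<^sub>0..T\<^sub>1}. \<forall>c\<ge>0. \<forall>i j.
      holder_upto \<beta> s c (\<lambda>t. y t - z t) \<longrightarrow> \<bar>G s y i j - G s z i j\<bar> \<le> L * c"
  shows "y = z"
proof -
  have hol: "y \<in> holder_paths \<alpha> T\<^sub>1" "z \<in> holder_paths \<alpha> T\<^sub>1" using sol by (auto simp: controlled_solution_def)
  note cy = cont[OF hol(1)] and cz = cont[OF hol(2)]
  obtain R1 R2 where R: "0 \<le> R1" "y \<in> continued R1" "0 \<le> R2" "z \<in> continued R2"
    using solution_continued[OF sol(1) cy] solution_continued[OF sol(2) cz] by blast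
  define R where "R = max R1 R2"
  have R0: "0 \<le> R" and yz: "y \<in> continued R" "z \<in> continued R"
    using R continued_mono[of y R1 R] continued_mono[of z R2 R] by (auto simp: R_def)
  obtain L where L: "0 \<le> L" "\<And>s c i j. s \<in> {T\<^sub>0..T\<^sub>1} \<Longrightarrow> 0 \<le> c \<Longrightarrow> holder_upto \<beta> s c (\<lambda>t. y t - z t) \<Longrightarrow>
      \<bar>G s y i j - G s z i j\<bar> \<le> L * c"
    using lip[OF R0] yz by blast
  have eqs: "y = driven_by (\<lambda>s. G s y)" "z = driven_by (\<lambda>s. G s z)"
    using sol controlled_solution_iff[of G y, OF cy] controlled_solution_iff[of G z, OF cz] by blast+
  have "holder_upto \<beta> T\<^sub>1 (gronwall_const (\<kappa> * L) \<beta> T\<^sub>1 * (0 + \<kappa> * 0)) (\<lambda>t. y t - z t)"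
    by (rule stability[where G = G and G' = G, OF yz(1) eqs(1) yz(2) eqs(2) R0 L(1) order_refl cy cz])
      (use L(2) in auto)
  then have h: "holder_upto \<beta> T\<^sub>1 0 (\<lambda>t. y t - z t)" by simp
  have 0: "y 0 = z 0" using yz T by (auto simp: continued_iff)
  have "y t = z t" if "t \<in> {0..T\<^sub>1}" for t
    using h[unfolded holder_upto_def, rule_format, of 0 t] that 0 by (cases "t = 0") auto
  then show ?thesis using hol unfolding holder_paths_def by (blast intro: extensionalityI)
qed

end

section \<open>Lipschitz dependence of the signature on the driven path\<close>

context driven
begin

definition hball where "hball R = B\<^sub>w + R * T\<^sub>1 powr (1 - \<alpha>)"

definition acoord where "acoord R = hball R + T\<^sub>1 powr (1 - \<alpha>)"

lemma acoord_nonneg: "0 \<le> R \<Longrightarrow> 0 \<le> acoord R"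
  using B by (simp add: acoord_def hball_def)

lemma continued_coords:
  assumes "0 \<le> R" "y \<in> continued R"
  shows "holder_coords \<alpha> (acoord R) T\<^sub>1 (time_augmented y)"
  unfolding acoord_def
proof (rule time_augmented_holder_coords)
  show "y \<in> holder_ball \<alpha> T\<^sub>1 (w 0) (hball R)"
    using continued_subset_holder_ball[OF assms(1)] assms(2) by (auto simp: hball_def)
  show "0 \<le> hball R" using B assms(1) by (simp add: hball_def)
qed (use \<alpha> in simp)

lemma continued_augmented_lipschitz:
  assumes "0 \<le> R" "y \<in> continued R" "T\<^sub>0 \<le> s" "s \<le> t" "t \<le> T\<^sub>1"
  shows "\<bar>time_augmented y t $ k - time_augmented y s $ k\<bar> \<le> (R + 1) * (t - s)"
proof (cases k)
  case None
  have "0 \<le> R * (t - s)" using assms by simp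
  then show ?thesis using None assms by (simp add: time_augmented_def distrib_right)
next
  case (Some i)
  have "\<bar>y t $ i - y s $ i\<bar> \<le> norm (y t - y s)" using component_le_norm_cart[of "y t - y s" i] by simp
  also have "\<dots> \<le> R * (t - s)" using assms by (auto simp: continued_iff)
  also have "\<dots> \<le> (R + 1) * (t - s)" using assms by (intro mult_right_mono) auto
  finally show ?thesis using Some by (simp add: time_augmented_def)
qed

text \<open>To first order the increment is a bounded factor times a Lipschitz increment of the
  path, and \<open>increment_bound_powr\<close> removes the Young remainder.\<close>

lemma continued_signature_lipschitz:
  assumes a: "1 / 2 < \<alpha>" and R: "0 \<le> R"
  shows "\<exists>D\<ge>0. \<forall>y\<in>continued R. \<forall>s t. T\<^sub>0 \<le> s \<and> s \<le> t \<and> t \<le> T\<^sub>1 \<longrightarrow>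
    \<bar>rev_signature (time_augmented y) t v - rev_signature (time_augmented y) s v\<bar> \<le> D * (t - s)"
proof (cases v)
  case Nil
  then show ?thesis by (intro exI[of _ 0]) auto
next
  case (Cons k u)
  have a1: "\<alpha> \<le> 1" and T1: "0 < T\<^sub>1" using \<alpha> T by auto
  obtain C where C: "0 \<le> C"
    "\<And>z :: real \<Rightarrow> real ^ 'm option. \<And>t. holder_coords \<alpha> (acoord R) T\<^sub>1 z \<Longrightarrow> 0 \<le> t \<Longrightarrow> t \<le> T\<^sub>1 \<Longrightarrow> \<bar>rev_signature z t u\<bar> \<le> C"
    "\<And>z :: real \<Rightarrow> real ^ 'm option. \<And>k s t. holder_coords \<alpha> (acoord R) T\<^sub>1 z \<Longrightarrow> 0 \<le> s \<Longrightarrow> s \<le> t \<Longrightarrow> t \<le> T\<^sub>1 \<Longrightarrow>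
      \<bar>rev_signature z t (k # u) - rev_signature z s (k # u) - rev_signature z s u * (z t $ k - z s $ k)\<bar>
      \<le> C * (t - s) powr (2 * \<alpha>)"
    using rev_signature_estimates[OF a a1 acoord_nonneg[OF R] T1, of u] by metis
  have "\<bar>rev_signature (time_augmented y) t (k # u) - rev_signature (time_augmented y) s (k # u)\<bar> \<le> (C * (R + 1)) * (t - s)"
    if y: "y \<in> continued R" and st: "T\<^sub>0 \<le> s" "s \<le> t" "t \<le> T\<^sub>1" for y s t
  proof (rule increment_bound_powr[OF st(2)])
    show "1 < 2 * \<alpha>" using a by simp
    fix p q assume pq: "s \<le> p" "p \<le> q" "q \<le> t"
    let ?z = "time_augmented y"
    have "\<bar>rev_signature ?z p u * (?z q $ k - ?z p $ k)\<bar> \<le> C * ((R + 1) * (q - p))"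
      unfolding abs_mult
      using C(2)[OF continued_coords[OF R y], of p] continued_augmented_lipschitz[OF R y, of p q k] pq st T C(1)
      by (intro mult_mono) auto
    moreover have "\<bar>rev_signature ?z q (k # u) - rev_signature ?z p (k # u) - rev_signature ?z p u * (?z q $ k - ?z p $ k)\<bar>
        \<le> C * (q - p) powr (2 * \<alpha>)"
      using pq st T by (intro C(3)[OF continued_coords[OF R y]]) auto
    ultimately show "\<bar>rev_signature ?z q (k # u) - rev_signature ?z p (k # u)\<bar> \<le> C * (R + 1) * (q - p) + C * (q - p) powr (2 * \<alpha>)"
      unfolding mult.assoc by linarith
  qed
  then show ?thesis unfolding Cons using C(1) R by (intro exI[of _ "C * (R + 1)"]) auto
qed

text \<open>
  Writing \<open>\<delta> = y - z\<close>, the integral of the signature of \<open>z\<close> against \<open>\<delta>\<close> is integrated by parts;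
  only the supremum of \<open>\<delta>\<close> then enters, because the signature of \<open>z\<close> is Lipschitz after \<open>T\<^sub>0\<close>.
\<close>

lemma continued_signature_diff:
  assumes a: "1 / 2 < \<alpha>" and R: "0 \<le> R"
  shows "\<exists>D\<ge>0. \<forall>y\<in>continued R. \<forall>z\<in>continued R. \<forall>t\<in>{T\<^sub>0..T\<^sub>1}. \<forall>V. (\<forall>r\<in>{0..t}. norm (y r - z r) \<le> V) \<longrightarrow>
    \<bar>rev_signature (time_augmented y) t v - rev_signature (time_augmented z) t v\<bar> \<le> D * V"
proof (induction v)
  case Nil
  show ?case by (intro exI[of _ 0]) auto
next
  case (Cons k u)
  have a1: "\<alpha> \<le> 1" and T1: "0 < T\<^sub>1" using \<alpha> T by auto
  obtain C where C: "0 \<le> C"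
    "\<And>z :: real \<Rightarrow> real ^ 'm option. \<And>t. holder_coords \<alpha> (acoord R) T\<^sub>1 z \<Longrightarrow> 0 \<le> t \<Longrightarrow> t \<le> T\<^sub>1 \<Longrightarrow> \<bar>rev_signature z t u\<bar> \<le> C"
    "\<And>z :: real \<Rightarrow> real ^ 'm option. \<And>k s t. holder_coords \<alpha> (acoord R) T\<^sub>1 z \<Longrightarrow> 0 \<le> s \<Longrightarrow> s \<le> t \<Longrightarrow> t \<le> T\<^sub>1 \<Longrightarrow>
      \<bar>rev_signature z t (k # u) - rev_signature z s (k # u) - rev_signature z s u * (z t $ k - z s $ k)\<bar>
      \<le> C * (t - s) powr (2 * \<alpha>)"
    using rev_signature_estimates[OF a a1 acoord_nonneg[OF R] T1, of u] by metis
  obtain D where D: "0 \<le> D" "\<And>y z t V. y \<in> continued R \<Longrightarrow> z \<in> continued R \<Longrightarrow> t \<in> {T\<^sub>0..T\<^sub>1} \<Longrightarrow>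
      (\<And>r. r \<in> {0..t} \<Longrightarrow> norm (y r - z r) \<le> V) \<Longrightarrow>
      \<bar>rev_signature (time_augmented y) t u - rev_signature (time_augmented z) t u\<bar> \<le> D * V"
    using Cons by blast
  obtain E where E: "0 \<le> E" "\<And>y s t. y \<in> continued R \<Longrightarrow> T\<^sub>0 \<le> s \<and> s \<le> t \<and> t \<le> T\<^sub>1 \<Longrightarrow>
    \<bar>rev_signature (time_augmented y) t u - rev_signature (time_augmented y) s u\<bar> \<le> E * (t - s)"
    using continued_signature_lipschitz[OF a R, of u] by blast
  define D' where "D' = (D * (R + 1) + E) * T\<^sub>1 + C"
  have "\<bar>rev_signature (time_augmented y) t (k # u) - rev_signature (time_augmented z) t (k # u)\<bar> \<le> D' * V"
    if y: "y \<in> continued R" and z: "z \<in> continued R" and t: "t \<in> {T\<^sub>0..T\<^sub>1}"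
      and V: "\<And>r. r \<in> {0..t} \<Longrightarrow> norm (y r - z r) \<le> V" for y z t V
  proof -
    let ?y = "time_augmented y" and ?z = "time_augmented z"
    have V0: "0 \<le> V" using V[of 0] t T by (auto intro: order_trans[OF norm_ge_zero])
    define \<delta> where "\<delta> r = ?y r $ k - ?z r $ k" for r
    have \<delta>: "\<bar>\<delta> r\<bar> \<le> V" if "r \<in> {0..t}" for r
    proof (cases k)
      case (Some i)
      have "\<bar>\<delta> r\<bar> \<le> norm (y r - z r)"
        using component_le_norm_cart[of "y r - z r" i] Some by (simp add: \<delta>_def time_augmented_def)
      then show ?thesis using V[OF that] by simp
    qed (use V0 in \<open>simp add: \<delta>_def time_augmented_def\<close>)
    \<comment> \<open>With the boundary term subtracted, the increments of \<open>F\<close> contain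
      \<open>\<delta>\<close> itself and never an increment of \<open>\<delta>\<close>, for which
      \<open>V\<close> gives no bound proportional to \<open>q - p\<close>.\<close>
    define F where "F r = rev_signature ?y r (k # u) - rev_signature ?z r (k # u) - rev_signature ?z r u * \<delta> r" for r
    have "\<bar>F t - F T\<^sub>0\<bar> \<le> ((D * (R + 1) + E) * V) * (t - T\<^sub>0)"
    proof (rule increment_bound_powr)
      show "T\<^sub>0 \<le> t" "1 < 2 * \<alpha>" using t a by auto
      fix p q assume pq: "T\<^sub>0 \<le> p" "p \<le> q" "q \<le> t"
      let ?ey = "rev_signature ?y q (k # u) - rev_signature ?y p (k # u) - rev_signature ?y p u * (?y q $ k - ?y p $ k)"
      let ?ez = "rev_signature ?z q (k # u) - rev_signature ?z p (k # u) - rev_signature ?z p u * (?z q $ k - ?z p $ k)"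
      have "F q - F p = (rev_signature ?y p u - rev_signature ?z p u) * (?y q $ k - ?y p $ k) -
          (rev_signature ?z q u - rev_signature ?z p u) * \<delta> q + ?ey - ?ez"
        unfolding F_def \<delta>_def by (simp add: algebra_simps del: rev_signature.simps(2))
      moreover have "\<bar>(rev_signature ?y p u - rev_signature ?z p u) * (?y q $ k - ?y p $ k)\<bar> \<le> (D * V) * ((R + 1) * (q - p))"
        unfolding abs_mult
      proof (rule mult_mono)
        show "\<bar>rev_signature ?y p u - rev_signature ?z p u\<bar> \<le> D * V"
          using pq t T by (intro D(2)[OF y z] V) auto
        show "\<bar>?y q $ k - ?y p $ k\<bar> \<le> (R + 1) * (q - p)"
          using pq t by (intro continued_augmented_lipschitz[OF R y]) auto
      qed (use D(1) V0 in auto)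
      moreover have "\<bar>(rev_signature ?z q u - rev_signature ?z p u) * \<delta> q\<bar> \<le> (E * (q - p)) * V"
        unfolding abs_mult using E(2)[OF z, of p q] \<delta>[of q] pq t T E(1) by (intro mult_mono) auto
      moreover have "\<bar>?ey\<bar> \<le> C * (q - p) powr (2 * \<alpha>)" "\<bar>?ez\<bar> \<le> C * (q - p) powr (2 * \<alpha>)"
        using pq t T by (intro C(3) continued_coords[OF R] y z; simp)+
      ultimately have "\<bar>F q - F p\<bar> \<le> (D * V) * ((R + 1) * (q - p)) + (E * (q - p)) * V +
          (C * (q - p) powr (2 * \<alpha>) + C * (q - p) powr (2 * \<alpha>))" by linarith
      then show "\<bar>F q - F p\<bar> \<le> (D * (R + 1) + E) * V * (q - p) + (2 * C) * (q - p) powr (2 * \<alpha>)"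
        by (simp add: algebra_simps)
    qed
    also have "\<dots> \<le> ((D * (R + 1) + E) * V) * T\<^sub>1"
      using t T D(1) E(1) R V0 by (intro mult_left_mono) auto
    finally have F1: "\<bar>F t - F T\<^sub>0\<bar> \<le> ((D * (R + 1) + E) * V) * T\<^sub>1" .
    have agree: "?y r = ?z r" if "r \<in> {0..T\<^sub>0}" for r
    proof -
      have "y r = z r" using y z that by (simp add: continued_iff)
      then show ?thesis unfolding time_augmented_def by (simp only:)
    qed
    have "rev_signature ?y T\<^sub>0 (k # u) = rev_signature ?z T\<^sub>0 (k # u)"
      by (rule rev_signature_cong) (use agree in auto)
    moreover have "\<delta> T\<^sub>0 = 0" using agree T by (simp add: \<delta>_def)
    ultimately have F0: "F T\<^sub>0 = 0" by (simp add: F_def del: rev_signature.simps(2))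
    have "\<bar>rev_signature ?z t u * \<delta> t\<bar> \<le> C * V"
      unfolding abs_mult using C(1) C(2)[OF continued_coords[OF R z], of t] \<delta>[of t] t T by (intro mult_mono) auto
    then have "\<bar>rev_signature ?y t (k # u) - rev_signature ?z t (k # u)\<bar> \<le> ((D * (R + 1) + E) * V) * T\<^sub>1 + C * V"
      using F1 unfolding F0 unfolding F_def by linarith
    then show ?thesis by (simp add: D'_def algebra_simps del: rev_signature.simps(2))
  qed
  moreover have "0 \<le> D'" using C(1) D(1) E(1) R T1 by (simp add: D'_def)
  ultimately show ?case by blast
qed

lemma continued_diff_sup:
  assumes y: "y \<in> continued R" and z: "z \<in> continued R" and s: "s \<in> {T\<^sub>0..T\<^sub>1}" and c: "0 \<le> c"
    and h: "holder_upto \<beta> s c (\<lambda>t. y t - z t)" and r: "r \<in> {0..s}"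
  shows "norm (y r - z r) \<le> T\<^sub>1 powr \<beta> * c"
proof (cases "r = 0")
  case True
  then have "y r = z r" using y z T by (simp add: continued_iff)
  then show ?thesis using c by simp
next
  case False
  have "y 0 = z 0" using y z T by (simp add: continued_iff)
  then have "norm (y r - z r) \<le> c * r powr \<beta>"
    using h[unfolded holder_upto_def, rule_format, of 0 r] r False by simp
  also have "\<dots> \<le> c * T\<^sub>1 powr \<beta>" using r s c \<beta> by (intro mult_left_mono powr_mono2) auto
  finally show ?thesis by (simp add: mult.commute)
qed

text \<open>The constant depends on the tensor through its entries and words, so no uniformity along
  a sequence of tensors is obtained; existence and uniqueness for a single tensor do not ask for
  it.\<close>

lemma signature_coeff_lipschitz:
  fixes l :: "'m \<Rightarrow> 'd \<Rightarrow> 'm option list \<Rightarrow> real"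
  assumes a: "1 / 2 < \<alpha>" and R: "0 \<le> R" and \<sigma>: "K-lipschitz_on UNIV \<sigma>"
  shows "\<exists>L\<ge>0. \<forall>y\<in>continued R. \<forall>z\<in>continued R. \<forall>s\<in>{T\<^sub>0..T\<^sub>1}. \<forall>c\<ge>0. \<forall>i j.
    holder_upto \<beta> s c (\<lambda>t. y t - z t) \<longrightarrow>
    \<bar>signature_coeff \<sigma> c\<^sub>0 c\<^sub>1 l s y i j - signature_coeff \<sigma> c\<^sub>0 c\<^sub>1 l s z i j\<bar> \<le> L * c"
proof -
  have "\<forall>v. \<exists>D\<ge>0. \<forall>y\<in>continued R. \<forall>z\<in>continued R. \<forall>t\<in>{T\<^sub>0..T\<^sub>1}. \<forall>V. (\<forall>r\<in>{0..t}. norm (y r - z r) \<le> V) \<longrightarrow>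
      \<bar>rev_signature (time_augmented y) t v - rev_signature (time_augmented z) t v\<bar> \<le> D * V"
    using continued_signature_diff[OF a R] by blast
  then obtain D where D: "\<And>v. 0 \<le> D v" "\<And>v y z t V. y \<in> continued R \<Longrightarrow> z \<in> continued R \<Longrightarrow> t \<in> {T\<^sub>0..T\<^sub>1} \<Longrightarrow>
      (\<And>r. r \<in> {0..t} \<Longrightarrow> norm (y r - z r) \<le> V) \<Longrightarrow>
      \<bar>rev_signature (time_augmented y) t v - rev_signature (time_augmented z) t v\<bar> \<le> D v * V"
    by metis
  have K: "0 \<le> K" using \<sigma> by (rule lipschitz_on_nonneg)
  define E where "E i j = \<bar>c\<^sub>1\<bar> * K * (\<Sum>v | l i j v \<noteq> 0. \<bar>l i j v\<bar> * D (rev v)) * T\<^sub>1 powr \<beta>" for i j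
  have E0: "0 \<le> E i j" for i j unfolding E_def using K D(1) by (intro mult_nonneg_nonneg sum_nonneg) auto
  define L where "L = (\<Sum>i\<in>UNIV. \<Sum>j\<in>UNIV. E i j)"
  have EL: "E i j \<le> L" for i j
  proof -
    have "E i j \<le> (\<Sum>j\<in>UNIV. E i j)" by (rule member_le_sum) (use E0 in auto)
    also have "\<dots> \<le> L" unfolding L_def by (rule member_le_sum) (auto intro!: sum_nonneg E0)
    finally show ?thesis .
  qed
  have "\<bar>signature_coeff \<sigma> c\<^sub>0 c\<^sub>1 l s y i j - signature_coeff \<sigma> c\<^sub>0 c\<^sub>1 l s z i j\<bar> \<le> L * c"
    if y: "y \<in> continued R" and z: "z \<in> continued R" and s: "s \<in> {T\<^sub>0..T\<^sub>1}" and c: "0 \<le> c"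
      and h: "holder_upto \<beta> s c (\<lambda>t. y t - z t)" for y z s c i j
  proof -
    let ?p = "\<lambda>y. tensor_pairing (l i j) (signature (time_augmented y) s)"
    have "\<bar>?p y - ?p z\<bar> = \<bar>\<Sum>v | l i j v \<noteq> 0. l i j v *
        (rev_signature (time_augmented y) s (rev v) - rev_signature (time_augmented z) s (rev v))\<bar>"
      by (simp add: tensor_pairing_def signature_def sum_subtractf right_diff_distrib)
    also have "\<dots> \<le> (\<Sum>v | l i j v \<noteq> 0. \<bar>l i j v\<bar> * (D (rev v) * (T\<^sub>1 powr \<beta> * c)))"
    proof (rule order_trans[OF sum_abs], rule sum_mono)
      fix v
      have "\<bar>rev_signature (time_augmented y) s (rev v) - rev_signature (time_augmented z) s (rev v)\<bar> \<le> D (rev v) * (T\<^sub>1 powr \<beta> * c)"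
        by (rule D(2)[OF y z s continued_diff_sup[OF y z s c h]])
      then show "\<bar>l i j v * (rev_signature (time_augmented y) s (rev v) - rev_signature (time_augmented z) s (rev v))\<bar> \<le>
          \<bar>l i j v\<bar> * (D (rev v) * (T\<^sub>1 powr \<beta> * c))"
        unfolding abs_mult by (intro mult_left_mono) auto
    qed
    also have "\<dots> = (\<Sum>v | l i j v \<noteq> 0. \<bar>l i j v\<bar> * D (rev v)) * T\<^sub>1 powr \<beta> * c"
      by (simp add: sum_distrib_right mult.assoc)
    finally have pair: "\<bar>?p y - ?p z\<bar> \<le> (\<Sum>v | l i j v \<noteq> 0. \<bar>l i j v\<bar> * D (rev v)) * T\<^sub>1 powr \<beta> * c" .
    have "\<bar>signature_coeff \<sigma> c\<^sub>0 c\<^sub>1 l s y i j - signature_coeff \<sigma> c\<^sub>0 c\<^sub>1 l s z i j\<bar> = \<bar>c\<^sub>1\<bar> * \<bar>\<sigma> (?p y) - \<sigma> (?p z)\<bar>"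
      by (simp add: signature_coeff_def right_diff_distrib[symmetric] abs_mult)
    also have "\<dots> \<le> \<bar>c\<^sub>1\<bar> * (K * \<bar>?p y - ?p z\<bar>)"
      using lipschitz_onD[OF \<sigma>, of "?p y" "?p z"] by (intro mult_left_mono) (auto simp: dist_real_def)
    also have "\<dots> \<le> \<bar>c\<^sub>1\<bar> * (K * ((\<Sum>v | l i j v \<noteq> 0. \<bar>l i j v\<bar> * D (rev v)) * T\<^sub>1 powr \<beta> * c))"
      using K pair by (intro mult_left_mono) auto
    also have "\<dots> = E i j * c" by (simp add: E_def mult.assoc)
    also have "\<dots> \<le> L * c" using EL c by (intro mult_right_mono)
    finally show ?thesis .
  qed
  moreover have "0 \<le> L" unfolding L_def by (intro sum_nonneg E0)
  ultimately show ?thesis by blast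
qed

end

section \<open>Regularity of the coefficients along a path\<close>

lemma holder_paths_holder_ball:
  assumes "y \<in> holder_paths \<alpha> T"
  shows "y \<in> holder_ball \<alpha> T (y 0) (holder_seminorm \<alpha> T y)"
proof -
  have "norm (y t - y s) \<le> holder_seminorm \<alpha> T y * (t - s) powr \<alpha>" if "0 \<le> s" "s \<le> t" "t \<le> T" for s t
    using assms holder_seminorm_bound[of \<alpha> T y s t] that by (cases "s = t") (auto simp: holder_paths_def)
  then show ?thesis using assms by (simp add: holder_ball_def holder_paths_def)
qed

lemma continuous_on_signature_coeff:
  assumes \<alpha>: "1 / 2 < \<alpha>" "\<alpha> \<le> 1" and T: "0 < T" and y: "y \<in> holder_paths \<alpha> T" and \<sigma>: "continuous_on UNIV \<sigma>"
  shows "continuous_on {0..T} (\<lambda>s. signature_coeff \<sigma> c\<^sub>0 c\<^sub>1 l s y i j)"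
proof -
  have z: "holder_coords \<alpha> (holder_seminorm \<alpha> T y + T powr (1 - \<alpha>)) T (time_augmented y)"
    by (rule time_augmented_holder_coords[OF holder_paths_holder_ball[OF y] \<alpha>(2) holder_seminorm_nonneg])
  have "0 \<le> holder_seminorm \<alpha> T y + T powr (1 - \<alpha>)" by (simp add: holder_seminorm_nonneg)
  then have "continuous_on {0..T} (\<lambda>s. rev_signature (time_augmented y) s v)" for v
    by (rule continuous_on_rev_signature[OF \<alpha> _ T z])
  then have "continuous_on {0..T} (\<lambda>s. tensor_pairing (l i j) (signature (time_augmented y) s))"
    unfolding tensor_pairing_def signature_def by (intro continuous_on_sum continuous_on_mult continuous_on_const)
  then have "continuous_on {0..T} (\<lambda>s. \<sigma> (tensor_pairing (l i j) (signature (time_augmented y) s)))"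
    by (rule continuous_on_compose2[OF \<sigma>]) auto
  then show ?thesis unfolding signature_coeff_def by (intro continuous_on_add continuous_on_mult continuous_on_const)
qed

text \<open>Any Hoelder path lies in the ball given by its own seminorm, and \<open>s\<close> is
  sent continuously to \<open>(s, stopped T s y)\<close> in the corresponding stopped ball, where
  \<open>f\<close> is continuous.\<close>

lemma continuous_on_functional_coeff:
  assumes T: "0 < T" and \<beta>: "0 < \<beta>" "\<beta> < \<alpha>" and y: "y \<in> holder_paths \<alpha> T"
    and f: "continuous_map (stopped_topology \<alpha> \<beta> T) euclidean f"
  shows "continuous_on {0..T} (\<lambda>s. functional_coeff T f s y i j)"
proof -
  let ?R = "holder_seminorm \<alpha> T y"
  have cf: "continuous_on (stopped_ball \<alpha> T (y 0) ?R) f"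
    by (rule continuous_on_stopped_ball[OF T \<beta> holder_seminorm_nonneg f])
  have y': "y \<in> holder_ball \<alpha> T (y 0) ?R" by (rule holder_paths_holder_ball[OF y])
  have "continuous_on {0..T} (\<lambda>s. (s, y))" by (intro continuous_on_Pair continuous_on_id continuous_on_const)
  from continuous_on_compose2[OF continuous_on_stopping[of \<alpha> T "y 0" ?R] this] y' T \<beta>
  have s: "continuous_on {0..T} (\<lambda>s. (s, stopped T s y))" by auto
  have "continuous_on {0..T} (\<lambda>s. f (s, stopped T s y))"
  proof (rule continuous_on_compose2[OF cf s], rule image_subsetI)
    fix s assume "s \<in> {0..T}"
    then show "(s, stopped T s y) \<in> stopped_ball \<alpha> T (y 0) ?R"
      unfolding stopped_ball_def using y' by (intro image_eqI[where x = "(s, y)"]) auto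
  qed
  then show ?thesis unfolding functional_coeff_def
    by (intro continuous_on_component blinfun.continuous_on continuous_on_const)
qed

lemma functional_coeff_le_norm:
  fixes f :: "real \<times> (real \<Rightarrow> real ^ 'm) \<Rightarrow> (real ^ 'd::finite) \<Rightarrow>\<^sub>L (real ^ 'm::finite)"
  shows "\<bar>functional_coeff T f s y i j\<bar> \<le> norm (f (s, stopped T s y))"
proof -
  have "\<bar>functional_coeff T f s y i j\<bar> \<le> norm (blinfun_apply (f (s, stopped T s y)) (axis j 1))"
    unfolding functional_coeff_def by (rule component_le_norm_cart)
  also have "\<dots> \<le> norm (f (s, stopped T s y)) * norm (axis j 1 :: real ^ 'd)" by (rule norm_blinfun)
  finally show ?thesis by simp
qed

lemma functional_coeff_diff_le_norm:
  fixes f :: "real \<times> (real \<Rightarrow> real ^ 'm) \<Rightarrow> (real ^ 'd::finite) \<Rightarrow>\<^sub>L (real ^ 'm::finite)"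
  shows "\<bar>functional_coeff T f s y i j - functional_coeff T f s z i j\<bar> \<le> norm (f (s, stopped T s y) - f (s, stopped T s z))"
proof -
  have "functional_coeff T f s y i j - functional_coeff T f s z i j =
      blinfun_apply (f (s, stopped T s y) - f (s, stopped T s z)) (axis j 1) $ i"
    by (simp add: functional_coeff_def blinfun.diff_left)
  also have "\<bar>\<dots>\<bar> \<le> norm (blinfun_apply (f (s, stopped T s y) - f (s, stopped T s z)) (axis j 1))"
    by (rule component_le_norm_cart)
  also have "\<dots> \<le> norm (f (s, stopped T s y) - f (s, stopped T s z)) * norm (axis j 1 :: real ^ 'd)"
    by (rule norm_blinfun)
  finally show ?thesis by simp
qed

text \<open>After \<open>t\<close> a stopped path is constant, so a Hoelder bound up to
  \<open>t\<close> controls the seminorm on the whole interval. This links the hypotheses on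
  \<open>f\<close>, stated with seminorms over the whole interval, to the local predicate
  \<open>holder_upto\<close>.\<close>

lemma holder_seminorm_stopped_le:
  assumes h: "holder_upto \<beta> t c v" and c: "0 \<le> c" and t: "t \<in> {0..T}" and \<beta>: "0 \<le> \<beta>"
    and u: "\<And>s. s \<in> {0..T} \<Longrightarrow> u s = v (min s t)"
  shows "holder_seminorm \<beta> T u \<le> c"
proof (rule holder_seminorm_leI[OF _ c])
  fix r s assume rs: "0 \<le> r" "r < s" "s \<le> T"
  show "norm (u s - u r) \<le> c * (s - r) powr \<beta>"
  proof (cases "r < t")
    case True
    have "norm (u s - u r) = norm (v (min s t) - v r)" using rs True u[of s] u[of r] by (simp add: min_def)
    also have "\<dots> \<le> c * (min s t - r) powr \<beta>"
      using h[unfolded holder_upto_def, rule_format, of r "min s t"] rs True by simp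
    also have "\<dots> \<le> c * (s - r) powr \<beta>" using c rs True \<beta> by (intro mult_left_mono powr_mono2) auto
    finally show ?thesis .
  next
    case False
    then show ?thesis using rs u[of s] u[of r] c by (simp add: min_def)
  qed
qed

section \<open>The approximation theorem\<close>

context driven
begin

text \<open>The level \<open>N\<close> is the a priori bound itself, computed from \<open>A\<close>
  and \<open>A'\<close>. Growth is required only on \<open>continued (\<kappa> * N)\<close>, which
  admits coefficients that are controlled merely on a compact ball, as the signature approximations
  are.\<close>

lemma controlled_solution_ex1:
  assumes A: "0 \<le> A" "0 \<le> A'"
    and N: "N = A * (gronwall_const (\<kappa> * A) \<beta> T\<^sub>1 * (B\<^sub>w * T\<^sub>1 powr (\<alpha> - \<beta>) + \<kappa> * A')) + A'"
    and cont: "\<And>y i j. y \<in> holder_paths \<alpha> T\<^sub>1 \<Longrightarrow> continuous_on {T\<^sub>0..T\<^sub>1} (\<lambda>s. G s y i j)"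
    and lip: "\<And>R. 0 \<le> R \<Longrightarrow> \<exists>L\<ge>0. \<forall>y\<in>continued R. \<forall>z\<in>continued R. \<forall>s\<in>{T\<^sub>0..T\<^sub>1}. \<forall>c\<ge>0. \<forall>i j.
      holder_upto \<beta> s c (\<lambda>t. y t - z t) \<longrightarrow> \<bar>G s y i j - G s z i j\<bar> \<le> L * c"
    and growth: "\<And>y s c i j. y \<in> continued (\<kappa> * N) \<Longrightarrow> s \<in> {T\<^sub>0..T\<^sub>1} \<Longrightarrow> 0 \<le> c \<Longrightarrow> holder_upto \<beta> s c y \<Longrightarrow>
      \<bar>G s y i j\<bar> \<le> A * c + A'"
  shows "\<exists>y \<in> continued (\<kappa> * N). \<forall>z. controlled_solution \<alpha> T\<^sub>0 T\<^sub>1 G x w z \<longleftrightarrow> z = y"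
proof -
  have "0 \<le> gronwall_const (\<kappa> * A) \<beta> T\<^sub>1 * (B\<^sub>w * T\<^sub>1 powr (\<alpha> - \<beta>) + \<kappa> * A')"
    using A B \<kappa>_nonneg by (intro mult_nonneg_nonneg gronwall_const_nonneg add_nonneg_nonneg) auto
  then have N0: "0 \<le> N" using A unfolding N by simp
  then have R: "0 \<le> \<kappa> * N" using \<kappa>_nonneg by simp
  have hol: "y \<in> holder_paths \<alpha> T\<^sub>1" if "y \<in> continued (\<kappa> * N)" for y
    using continued_subset_holder_ball[OF R] holder_ball_subset_paths that by blast
  obtain L where L: "0 \<le> L" "\<And>y z s c i j. y \<in> continued (\<kappa> * N) \<Longrightarrow> z \<in> continued (\<kappa> * N) \<Longrightarrow> s \<in> {T\<^sub>0..T\<^sub>1} \<Longrightarrow> 0 \<le> c \<Longrightarrow>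
      holder_upto \<beta> s c (\<lambda>t. y t - z t) \<Longrightarrow> \<bar>G s y i j - G s z i j\<bar> \<le> L * c"
    using lip[OF R] by blast
  have "\<exists>y \<in> continued (\<kappa> * N). y = driven_by (\<lambda>s. G s y)"
  proof (rule clamped_solution_exists[OF N0 L(1) cont[OF hol] L(2)])
    fix y s i j assume y: "y \<in> continued (\<kappa> * N)" "y = driven_by (\<lambda>s i j. level_clamp N (G s y i j))" and s: "s \<in> {T\<^sub>0..T\<^sub>1}"
    show "\<bar>G s y i j\<bar> \<le> N"
      using a_priori_coefficient_bound[where G = G, OF N0 A y cont[OF hol[OF y(1)]] growth[OF y(1)] s] unfolding N .
  qed
  then obtain y where y: "y \<in> continued (\<kappa> * N)" "y = driven_by (\<lambda>s. G s y)" by blast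
  have sol: "controlled_solution \<alpha> T\<^sub>0 T\<^sub>1 G x w y"
    using controlled_solution_iff[of G y, OF cont[OF hol[OF y(1)]]] hol[OF y(1)] y(2) by blast
  have "z = y" if "controlled_solution \<alpha> T\<^sub>0 T\<^sub>1 G x w z" for z
    using solution_unique[OF that sol cont lip] by blast
  then show ?thesis using y(1) sol by blast
qed

lemma functional_coeff_growth:
  fixes f :: "real \<times> (real \<Rightarrow> real ^ 'm) \<Rightarrow> (real ^ 'd) \<Rightarrow>\<^sub>L (real ^ 'm)"
  assumes C: "0 \<le> C" and R: "0 \<le> R"
    and f: "\<And>t u. t \<in> {0..T\<^sub>1} \<Longrightarrow> u \<in> holder_paths \<alpha> T\<^sub>1 \<Longrightarrow>
      norm (f (t, stopped T\<^sub>1 t u)) \<le> C * (1 + norm (u 0) + holder_seminorm \<beta> T\<^sub>1 (stopped T\<^sub>1 t u))"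
    and y: "y \<in> continued R" and s: "s \<in> {T\<^sub>0..T\<^sub>1}" and c: "0 \<le> c" and h: "holder_upto \<beta> s c y"
  shows "\<bar>functional_coeff T\<^sub>1 f s y i j\<bar> \<le> C * c + C * (1 + norm (w 0))"
proof -
  have s': "s \<in> {0..T\<^sub>1}" using s T by auto
  have y': "y \<in> holder_paths \<alpha> T\<^sub>1" using continued_subset_holder_ball[OF R] holder_ball_subset_paths y by blast
  have y0: "y 0 = w 0" using y T by (simp add: continued_iff)
  have "holder_seminorm \<beta> T\<^sub>1 (stopped T\<^sub>1 s y) \<le> c"
    by (rule holder_seminorm_stopped_le[OF h c s']) (use \<beta> in \<open>auto simp: stopped_def\<close>)
  then have "C * (1 + norm (y 0) + holder_seminorm \<beta> T\<^sub>1 (stopped T\<^sub>1 s y)) \<le> C * (1 + norm (w 0) + c)"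
    using C unfolding y0 by (intro mult_left_mono) auto
  then have "norm (f (s, stopped T\<^sub>1 s y)) \<le> C * (1 + norm (w 0) + c)" using f[OF s' y'] by linarith
  then show ?thesis using functional_coeff_le_norm[of T\<^sub>1 f s y i j] by (simp add: algebra_simps)
qed

lemma functional_coeff_lipschitz:
  fixes f :: "real \<times> (real \<Rightarrow> real ^ 'm) \<Rightarrow> (real ^ 'd) \<Rightarrow>\<^sub>L (real ^ 'm)"
  assumes L: "0 \<le> L" and R: "0 \<le> R"
    and f: "\<And>t u v. t \<in> {0..T\<^sub>1} \<Longrightarrow> u \<in> holder_ball \<alpha> T\<^sub>1 (w 0) (B\<^sub>w + R * T\<^sub>1 powr (1 - \<alpha>)) \<Longrightarrow>
      v \<in> holder_ball \<alpha> T\<^sub>1 (w 0) (B\<^sub>w + R * T\<^sub>1 powr (1 - \<alpha>)) \<Longrightarrow>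
      norm (f (t, stopped T\<^sub>1 t u) - f (t, stopped T\<^sub>1 t v)) \<le>
      L * (norm (u 0 - v 0) + holder_seminorm \<beta> T\<^sub>1 (\<lambda>s. stopped T\<^sub>1 t u s - stopped T\<^sub>1 t v s))"
    and y: "y \<in> continued R" and z: "z \<in> continued R" and s: "s \<in> {T\<^sub>0..T\<^sub>1}" and c: "0 \<le> c"
    and h: "holder_upto \<beta> s c (\<lambda>t. y t - z t)"
  shows "\<bar>functional_coeff T\<^sub>1 f s y i j - functional_coeff T\<^sub>1 f s z i j\<bar> \<le> L * c"
proof -
  have s': "s \<in> {0..T\<^sub>1}" using s T by auto
  have "y 0 = z 0" using y z T by (simp add: continued_iff)
  moreover have "holder_seminorm \<beta> T\<^sub>1 (\<lambda>r. stopped T\<^sub>1 s y r - stopped T\<^sub>1 s z r) \<le> c"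
    by (rule holder_seminorm_stopped_le[OF h c s']) (use \<beta> in \<open>auto simp: stopped_def\<close>)
  ultimately have "L * (norm (y 0 - z 0) + holder_seminorm \<beta> T\<^sub>1 (\<lambda>r. stopped T\<^sub>1 s y r - stopped T\<^sub>1 s z r)) \<le> L * c"
    using L by (intro mult_left_mono) auto
  moreover have "norm (f (s, stopped T\<^sub>1 s y) - f (s, stopped T\<^sub>1 s z)) \<le>
      L * (norm (y 0 - z 0) + holder_seminorm \<beta> T\<^sub>1 (\<lambda>r. stopped T\<^sub>1 s y r - stopped T\<^sub>1 s z r))"
    using continued_subset_holder_ball[OF R] y z by (intro f s') auto
  ultimately show ?thesis using functional_coeff_diff_le_norm[of T\<^sub>1 f s y i j z] by linarith
qed

end

text \<open>No lower bound on the slope of \<open>\<sigma>\<close> is given, so the right inverse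
  \<open>\<psi>\<close> is merely continuous, by compactness of \<open>{-1..1}\<close>.
  Stone-Weierstrass asks for no more.\<close>

lemma activation_right_inverse:
  fixes \<sigma> :: "real \<Rightarrow> real"
  assumes mono: "strict_mono \<sigma> \<or> monotone (<) (>) \<sigma>" and cont: "continuous_on UNIV \<sigma>" and M: "0 < M"
  obtains c\<^sub>0 c\<^sub>1 \<psi> where "0 < c\<^sub>1" "continuous_on {-M..M} \<psi>" "\<And>r. r \<in> {-M..M} \<Longrightarrow> c\<^sub>1 * \<sigma> (\<psi> r) + c\<^sub>0 = r"
proof -
  have inj: "\<sigma> r \<noteq> \<sigma> s" if "r < s" for r s
    using mono that by (auto simp: strict_mono_def monotone_def) (metis less_irrefl)+
  \<comment> \<open>Affine normalisation: \<open>c\<^sub>1 * \<sigma> + c\<^sub>0\<close> takes the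
    values \<open>M\<close> and \<open>-M\<close> at the endpoints of \<open>{-1..1}\<close>. Their
    order depends on the direction of monotonicity, while the absolute value keeps
    \<open>c\<^sub>1\<close> positive.\<close>
  define D where "D = \<bar>\<sigma> 1 - \<sigma> (- 1)\<bar>"
  have D: "0 < D" using inj[of "-1" 1] by (simp add: D_def)
  define c\<^sub>1 where "c\<^sub>1 = 2 * M / D"
  have c1: "0 < c\<^sub>1" using M D by (simp add: c\<^sub>1_def)
  define c\<^sub>0 where "c\<^sub>0 = - c\<^sub>1 * (\<sigma> 1 + \<sigma> (- 1)) / 2"
  define \<phi> where "\<phi> r = c\<^sub>1 * \<sigma> r + c\<^sub>0" for r
  have cphi: "continuous_on S \<phi>" for S
    unfolding \<phi>_def using cont by (intro continuous_on_add continuous_on_mult continuous_on_const) (auto intro: continuous_on_subset)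
  have "\<phi> 1 = c\<^sub>1 * (\<sigma> 1 - \<sigma> (- 1)) / 2" "\<phi> (- 1) = - (c\<^sub>1 * (\<sigma> 1 - \<sigma> (- 1)) / 2)"
    by (simp_all add: \<phi>_def c\<^sub>0_def field_simps)
  moreover have "\<bar>c\<^sub>1 * (\<sigma> 1 - \<sigma> (- 1)) / 2\<bar> = M"
    using D M by (simp add: abs_mult c\<^sub>1_def D_def)
  ultimately have ends: "(\<phi> 1 = M \<and> \<phi> (- 1) = - M) \<or> (\<phi> 1 = - M \<and> \<phi> (- 1) = M)" by linarith
  have sub: "{-M..M} \<subseteq> \<phi> ` {-1..1}"
  proof
    fix r assume "r \<in> {-M..M}"
    then have "\<exists>x\<ge>-1. x \<le> 1 \<and> \<phi> x = r"
      using ends IVT'[of \<phi> "-1" r 1] IVT2'[of \<phi> 1 r "-1"] cphi by auto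
    then show "r \<in> \<phi> ` {-1..1}" by auto
  qed
  have inj_\<phi>: "inj_on \<phi> {-1..1}"
    using inj c1 by (intro linorder_inj_onI) (auto simp: \<phi>_def)
  then have "continuous_on (\<phi> ` {-1..1}) (the_inv_into {-1..1} \<phi>)"
    by (rule continuous_on_inv_into[OF cphi compact_Icc])
  then have "continuous_on {-M..M} (the_inv_into {-1..1} \<phi>)" using sub by (rule continuous_on_subset)
  moreover have "c\<^sub>1 * \<sigma> (the_inv_into {-1..1} \<phi> r) + c\<^sub>0 = r" if "r \<in> {-M..M}" for r
  proof -
    have "r \<in> \<phi> ` {-1..1}" using sub that by blast
    from f_the_inv_into_f[OF inj_\<phi> this] show ?thesis unfolding \<phi>_def .
  qed
  ultimately show thesis using c1 that by blast
qed

lemma driven_admissible: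
  assumes "(x, w) \<in> admissible_inputs \<alpha> T\<^sub>0 T\<^sub>1 B\<^sub>x B\<^sub>w w\<^sub>0"
    and "0 \<le> T\<^sub>0" "T\<^sub>0 < T\<^sub>1" "0 < \<alpha>" "\<alpha> < 1" "0 < \<beta>" "\<beta> < \<alpha>" "0 < B\<^sub>x" "0 < B\<^sub>w"
  shows "driven T\<^sub>0 T\<^sub>1 \<alpha> \<beta> B\<^sub>x B\<^sub>w x w" "w 0 = w\<^sub>0"
proof -
  have x1: "x \<in> holder_paths 1 T\<^sub>1" "norm (x 0) + holder_seminorm 1 T\<^sub>1 x \<le> B\<^sub>x"
    and w: "w \<in> holder_paths \<alpha> T\<^sub>0" "holder_seminorm \<alpha> T\<^sub>0 w \<le> B\<^sub>w" and w0: "w 0 = w\<^sub>0"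
    using assms(1) unfolding admissible_inputs_def by auto
  have x: "x \<in> holder_paths 1 T\<^sub>1" "holder_seminorm 1 T\<^sub>1 x \<le> B\<^sub>x"
    using x1 norm_ge_zero[of "x 0"] by linarith+
  have xl: "norm (x t - x s) \<le> B\<^sub>x * (t - s)" if "0 \<le> s" "s \<le> t" "t \<le> T\<^sub>1" for s t
  proof (cases "s = t")
    case False
    then have "norm (x t - x s) \<le> holder_seminorm 1 T\<^sub>1 x * (t - s) powr 1"
      using x(1) that by (intro holder_seminorm_bound) (auto simp: holder_paths_def)
    also have "\<dots> \<le> B\<^sub>x * (t - s)" using x(2) that by (auto intro!: mult_right_mono)
    finally show ?thesis .
  qed simp
  have wl: "norm (w t - w s) \<le> B\<^sub>w * (t - s) powr \<alpha>" if "0 \<le> s" "s \<le> t" "t \<le> T\<^sub>0" for s t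
  proof (cases "s = t")
    case False
    then have "norm (w t - w s) \<le> holder_seminorm \<alpha> T\<^sub>0 w * (t - s) powr \<alpha>"
      using w(1) that by (intro holder_seminorm_bound) (auto simp: holder_paths_def)
    also have "\<dots> \<le> B\<^sub>w * (t - s) powr \<alpha>" using w(2) by (intro mult_right_mono) auto
    finally show ?thesis .
  qed simp
  show "driven T\<^sub>0 T\<^sub>1 \<alpha> \<beta> B\<^sub>x B\<^sub>w x w"
    by unfold_locales (use assms xl wl in auto)
  show "w 0 = w\<^sub>0" by (rule w0)
qed

lemma signature_coeff_approximation:
  fixes f :: "real \<times> (real \<Rightarrow> real ^ 'm::finite) \<Rightarrow> (real ^ 'd::finite) \<Rightarrow>\<^sub>L (real ^ 'm)"
  assumes T: "0 < T" and \<alpha>: "1 / 2 < \<alpha>" "\<alpha> \<le> 1" and \<beta>: "0 < \<beta>" "\<beta> < \<alpha>" and R: "0 \<le> R"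
    and f: "continuous_map (stopped_topology \<alpha> \<beta> T) euclidean f"
    and mono: "strict_mono \<sigma> \<or> monotone (<) (>) \<sigma>" and lip: "K-lipschitz_on UNIV \<sigma>"
  shows "\<exists>(l :: nat \<Rightarrow> 'm \<Rightarrow> 'd \<Rightarrow> 'm option list \<Rightarrow> real) c\<^sub>0 c\<^sub>1. 0 < c\<^sub>1 \<and> (\<forall>n i j. l n i j \<in> tensor_algebra) \<and>
    (\<forall>n i j. \<forall>s\<in>{0..T}. \<forall>y\<in>holder_ball \<alpha> T y\<^sub>0 R.
      \<bar>signature_coeff \<sigma> c\<^sub>0 c\<^sub>1 (l n) s y i j - functional_coeff T f s y i j\<bar> \<le> 1 / real (Suc n))"
proof -
  let ?S = "stopped_ball \<alpha> T y\<^sub>0 R"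
  have cf: "continuous_on ?S f" by (rule continuous_on_stopped_ball[OF T \<beta> R f])
  have "bounded (f ` ?S)"
    using T \<beta> R by (intro compact_imp_bounded compact_continuous_image[OF cf] compact_stopped_ball) auto
  then obtain M where M: "0 < M" "\<And>p. p \<in> ?S \<Longrightarrow> norm (f p) \<le> M" unfolding bounded_pos by auto
  have K: "0 \<le> K" using lip by (rule lipschitz_on_nonneg)
  have c\<sigma>: "continuous_on UNIV \<sigma>" by (rule lipschitz_on_continuous_on[OF lip])
  obtain c\<^sub>0 c\<^sub>1 \<psi> where c: "0 < c\<^sub>1" "continuous_on {-M..M} \<psi>" "\<And>r. r \<in> {-M..M} \<Longrightarrow> c\<^sub>1 * \<sigma> (\<psi> r) + c\<^sub>0 = r"
    by (rule activation_right_inverse[OF mono c\<sigma> M(1)]) (rule that)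
  let ?e = "\<lambda>i j p. blinfun_apply (f p) (axis j 1) $ i"
  have e_range: "?e i j p \<in> {-M..M}" if "p \<in> ?S" for i j p
  proof -
    have "\<bar>?e i j p\<bar> \<le> norm (blinfun_apply (f p) (axis j 1))" by (rule component_le_norm_cart)
    also have "\<dots> \<le> norm (f p) * norm (axis j 1 :: real ^ 'd)" by (rule norm_blinfun)
    also have "\<dots> \<le> M" using M(2)[OF that] by simp
    finally show ?thesis by auto
  qed
  have ce: "continuous_on ?S (\<lambda>p. \<psi> (?e i j p))" for i j
    by (rule continuous_on_compose2[OF c(2)])
      (auto intro!: continuous_on_component blinfun.continuous_on continuous_on_const cf simp: e_range[simplified])
  have "\<exists>a\<in>tensor_algebra. \<forall>(t, y) \<in> ?S. \<bar>c\<^sub>1 * \<sigma> (tensor_pairing a (signature (time_augmented y) t)) + c\<^sub>0 - ?e i j (t, y)\<bar> \<le> 1 / real (Suc n)"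
    for n i j
  proof -
    \<comment> \<open>The map \<open>c\<^sub>1 * \<sigma> + c\<^sub>0\<close> multiplies errors by
      at most \<open>c\<^sub>1 * K\<close>; the \<open>+ 1\<close> keeps the denominator positive
      when \<open>K = 0\<close>.\<close>
    define \<epsilon> where "\<epsilon> = 1 / (real (Suc n) * (c\<^sub>1 * K + 1))"
    have pos: "0 < c\<^sub>1 * K + 1" using c(1) K by (simp add: add_nonneg_pos)
    then have \<epsilon>: "0 < \<epsilon>" by (simp add: \<epsilon>_def)
    obtain a where a: "a \<in> tensor_algebra" "\<And>t y. (t, y) \<in> ?S \<Longrightarrow>
        \<bar>\<psi> (?e i j (t, y)) - tensor_pairing a (signature (time_augmented y) t)\<bar> < \<epsilon>"
      using signature_functionals_dense[OF \<alpha> T R ce[where i = i and j = j] \<epsilon>] by auto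
    have "\<bar>c\<^sub>1 * \<sigma> (tensor_pairing a (signature (time_augmented y) t)) + c\<^sub>0 - ?e i j (t, y)\<bar> \<le> 1 / real (Suc n)"
      if p: "(t, y) \<in> ?S" for t y
    proof -
      let ?q = "tensor_pairing a (signature (time_augmented y) t)" and ?r = "\<psi> (?e i j (t, y))"
      have "c\<^sub>1 * \<sigma> ?q + c\<^sub>0 - ?e i j (t, y) = c\<^sub>1 * (\<sigma> ?q - \<sigma> ?r)"
        using c(3)[OF e_range[OF p, where i = i and j = j]] by (simp add: algebra_simps)
      also have "\<bar>\<dots>\<bar> = c\<^sub>1 * \<bar>\<sigma> ?q - \<sigma> ?r\<bar>" using c(1) by (simp add: abs_mult)
      also have "\<dots> \<le> c\<^sub>1 * (K * \<bar>?q - ?r\<bar>)"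
        using lipschitz_onD[OF lip, of ?q ?r] c(1) by (intro mult_left_mono) (auto simp: dist_real_def)
      also have "\<dots> \<le> c\<^sub>1 * (K * \<epsilon>)"
        using a(2)[OF p] c(1) K by (intro mult_left_mono) auto
      also have "\<dots> \<le> (c\<^sub>1 * K + 1) * \<epsilon>" using \<epsilon> by (simp add: distrib_right)
      also have "\<dots> = 1 / real (Suc n)" using pos by (simp add: \<epsilon>_def)
      finally show ?thesis .
    qed
    then show ?thesis using a(1) by blast
  qed
  then have ex: "\<exists>a. a \<in> tensor_algebra \<and> (\<forall>(t, y) \<in> ?S.
      \<bar>c\<^sub>1 * \<sigma> (tensor_pairing a (signature (time_augmented y) t)) + c\<^sub>0 - ?e i j (t, y)\<bar> \<le> 1 / real (Suc n))"
    for n i j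
    unfolding Bex_def .
  define l where "l n i j = (SOME a. a \<in> tensor_algebra \<and> (\<forall>(t, y) \<in> ?S.
      \<bar>c\<^sub>1 * \<sigma> (tensor_pairing a (signature (time_augmented y) t)) + c\<^sub>0 - ?e i j (t, y)\<bar> \<le> 1 / real (Suc n)))"
    for n i j
  have l: "l n i j \<in> tensor_algebra \<and> (\<forall>(t, y) \<in> ?S.
      \<bar>c\<^sub>1 * \<sigma> (tensor_pairing (l n i j) (signature (time_augmented y) t)) + c\<^sub>0 - ?e i j (t, y)\<bar> \<le> 1 / real (Suc n))"
    for n i j
    unfolding l_def by (rule someI_ex[OF ex])
  have "\<bar>signature_coeff \<sigma> c\<^sub>0 c\<^sub>1 (l n) s y i j - functional_coeff T f s y i j\<bar> \<le> 1 / real (Suc n)"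
    if s: "s \<in> {0..T}" and y: "y \<in> holder_ball \<alpha> T y\<^sub>0 R" for n i j s y
  proof -
    have "(s, stopped T s y) \<in> ?S"
      unfolding stopped_ball_def using s y by (intro image_eqI[where x = "(s, y)"]) auto
    then have "\<bar>c\<^sub>1 * \<sigma> (tensor_pairing (l n i j) (signature (time_augmented (stopped T s y)) s)) + c\<^sub>0 - ?e i j (s, stopped T s y)\<bar>
        \<le> 1 / real (Suc n)"
      using l[of n i j] by blast
    \<comment> \<open>The approximation was made on stopped paths; it transfers to the path itself
      because the signature at \<open>s\<close> ignores what follows.\<close>
    moreover have "signature (time_augmented (stopped T s y)) s = signature (time_augmented y) s"
      using signature_stopped[OF s] by (intro ext)
    ultimately show ?thesis by (simp only: signature_coeff_def functional_coeff_def)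
  qed
  then show ?thesis using c(1) l by blast
qed

theorem theorem4p7:
  fixes T\<^sub>0 T\<^sub>1 \<alpha> \<beta> B\<^sub>x B\<^sub>w :: real
    and w\<^sub>0 :: "real ^ 'm"
    and f :: "real \<times> (real \<Rightarrow> real ^ 'm) \<Rightarrow> (real ^ 'd) \<Rightarrow>\<^sub>L (real ^ 'm)"
    and \<sigma> :: "real \<Rightarrow> real"
  assumes "0 < T\<^sub>1" and "0 \<le> T\<^sub>0" and "T\<^sub>0 < T\<^sub>1"
    and "1 / 2 < \<alpha>" and "\<alpha> < 1"
    and "0 < \<beta>" and "\<beta> < \<alpha>"
    and "0 < B\<^sub>x" and "0 < B\<^sub>w"
    and f_continuous: "continuous_map (stopped_topology \<alpha> \<beta> T\<^sub>1) euclidean f"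
    and f_lipschitz: "\<And>K. compactin (holder_topology \<alpha> \<beta> T\<^sub>1) K \<Longrightarrow>
        \<exists>L>0. \<forall>t\<in>{0..T\<^sub>1}. \<forall>u\<in>K. \<forall>v\<in>K.
          norm (f (t, stopped T\<^sub>1 t u) - f (t, stopped T\<^sub>1 t v)) \<le>
          L * (norm (u 0 - v 0) +
               holder_seminorm \<beta> T\<^sub>1 (\<lambda>s. stopped T\<^sub>1 t u s - stopped T\<^sub>1 t v s))"
    and f_growth: "\<exists>C>0. \<forall>t\<in>{0..T\<^sub>1}. \<forall>u\<in>holder_paths \<alpha> T\<^sub>1.
        norm (f (t, stopped T\<^sub>1 t u)) \<le>
        C * (1 + norm (u 0) + holder_seminorm \<beta> T\<^sub>1 (stopped T\<^sub>1 t u))"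
    and \<sigma>_lipschitz: "\<exists>L. L-lipschitz_on UNIV \<sigma>"
    and \<sigma>_monotone: "strict_mono \<sigma> \<or> monotone (<) (>) \<sigma>"
    and \<sigma>_growth: "\<exists>C. \<forall>r. \<bar>\<sigma> r\<bar> \<le> C * (1 + ln (1 + \<bar>r\<bar>))"
  shows "\<exists>(l :: nat \<Rightarrow> 'm \<Rightarrow> 'd \<Rightarrow> 'm option list \<Rightarrow> real) c\<^sub>0 c\<^sub>1.
      (\<forall>n\<ge>1. \<forall>i j. l n i j \<in> tensor_algebra) \<and> 0 < c\<^sub>1 \<and>
      (\<forall>(x, w) \<in> admissible_inputs \<alpha> T\<^sub>0 T\<^sub>1 B\<^sub>x B\<^sub>w w\<^sub>0.
         (\<exists>!y. controlled_solution \<alpha> T\<^sub>0 T\<^sub>1 (functional_coeff T\<^sub>1 f) x w y) \<and>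
         (\<forall>n\<ge>1. \<exists>!y. controlled_solution \<alpha> T\<^sub>0 T\<^sub>1 (signature_coeff \<sigma> c\<^sub>0 c\<^sub>1 (l n)) x w y)) \<and>
      (\<forall>\<epsilon>>0. \<exists>N\<ge>1. \<forall>n\<ge>N. \<forall>(x, w) \<in> admissible_inputs \<alpha> T\<^sub>0 T\<^sub>1 B\<^sub>x B\<^sub>w w\<^sub>0. \<forall>y y'.
         controlled_solution \<alpha> T\<^sub>0 T\<^sub>1 (functional_coeff T\<^sub>1 f) x w y \<and>
         controlled_solution \<alpha> T\<^sub>0 T\<^sub>1 (signature_coeff \<sigma> c\<^sub>0 c\<^sub>1 (l n)) x w y' \<longrightarrow>
         holder_dist \<beta> T\<^sub>1 y' y < \<epsilon>)"
proof -
  have \<alpha>: "0 < \<alpha>" "\<alpha> \<le> 1" using assms by auto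
  obtain C where C: "0 < C" "\<And>t u. t \<in> {0..T\<^sub>1} \<Longrightarrow> u \<in> holder_paths \<alpha> T\<^sub>1 \<Longrightarrow>
      norm (f (t, stopped T\<^sub>1 t u)) \<le> C * (1 + norm (u 0) + holder_seminorm \<beta> T\<^sub>1 (stopped T\<^sub>1 t u))"
    using f_growth by blast
  obtain K where K: "K-lipschitz_on UNIV \<sigma>" using \<sigma>_lipschitz by blast
  have c\<sigma>: "continuous_on UNIV \<sigma>" by (rule lipschitz_on_continuous_on[OF K])
  text \<open>
    The a priori bound \<open>N\<close> on the coefficients holds for every functional within distance \<open>1\<close> of
    \<open>f\<close>, which covers \<open>f\<close> and its signature approximations alike.
  \<close>
  define \<kappa> where "\<kappa> = real CARD('m) * real CARD('d) * B\<^sub>x"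
  define A' where "A' = C * (1 + norm w\<^sub>0) + 1"
  define N where "N = C * (gronwall_const (\<kappa> * C) \<beta> T\<^sub>1 * (B\<^sub>w * T\<^sub>1 powr (\<alpha> - \<beta>) + \<kappa> * A')) + A'"
  \<comment> \<open>A path driven by coefficients bounded by \<open>N\<close> has Lipschitz constant
    \<open>\<kappa> * N\<close> after \<open>T\<^sub>0\<close>.\<close>
  define R where "R = \<kappa> * N"
  have nn: "0 \<le> \<kappa>" "0 \<le> A'" "0 \<le> C" using C(1) assms by (auto simp: \<kappa>_def A'_def intro!: add_nonneg_nonneg mult_nonneg_nonneg)
  have "0 \<le> N" unfolding N_def
    using nn assms by (intro add_nonneg_nonneg mult_nonneg_nonneg gronwall_const_nonneg) auto
  then have R: "0 \<le> R" using nn by (simp add: R_def)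
  define ball where "ball r = holder_ball \<alpha> T\<^sub>1 w\<^sub>0 (B\<^sub>w + r * T\<^sub>1 powr (1 - \<alpha>))" for r
  have f_lip: "\<exists>L>0. \<forall>t\<in>{0..T\<^sub>1}. \<forall>u\<in>ball r. \<forall>v\<in>ball r.
      norm (f (t, stopped T\<^sub>1 t u) - f (t, stopped T\<^sub>1 t v)) \<le>
      L * (norm (u 0 - v 0) + holder_seminorm \<beta> T\<^sub>1 (\<lambda>s. stopped T\<^sub>1 t u s - stopped T\<^sub>1 t v s))" if "0 \<le> r" for r
    unfolding ball_def using assms that by (intro f_lipschitz compactin_holder_ball) auto
  have "0 \<le> B\<^sub>w + R * T\<^sub>1 powr (1 - \<alpha>)" using R assms by simp
  note approx = signature_coeff_approximation[OF assms(1,4) \<alpha>(2) assms(6,7) this f_continuous \<sigma>_monotone K,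
      of w\<^sub>0, folded ball_def]
  \<comment> \<open>The radius is already fixed without reference to the tensors, so closeness can
    be demanded on exactly the ball that will contain all the solutions.\<close>
  obtain l :: "nat \<Rightarrow> 'm \<Rightarrow> 'd \<Rightarrow> 'm option list \<Rightarrow> real" and c\<^sub>0 c\<^sub>1 where l: "0 < c\<^sub>1" "\<And>n i j. l n i j \<in> tensor_algebra"
    "\<And>n i j s y. s \<in> {0..T\<^sub>1} \<Longrightarrow> y \<in> ball R \<Longrightarrow>
      \<bar>signature_coeff \<sigma> c\<^sub>0 c\<^sub>1 (l n) s y i j - functional_coeff T\<^sub>1 f s y i j\<bar> \<le> 1 / real (Suc n)"
    using approx by blast
  \<comment> \<open>One Lipschitz constant of \<open>f\<close> on the whole ball, independent of
    \<open>n\<close> and of \<open>(x, w)\<close>; it is the only Lipschitz constant of a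
    coefficient in the final rate.\<close>
  obtain L where L: "0 < L" "\<And>t u v. t \<in> {0..T\<^sub>1} \<Longrightarrow> u \<in> ball R \<Longrightarrow> v \<in> ball R \<Longrightarrow>
      norm (f (t, stopped T\<^sub>1 t u) - f (t, stopped T\<^sub>1 t v)) \<le>
      L * (norm (u 0 - v 0) + holder_seminorm \<beta> T\<^sub>1 (\<lambda>s. stopped T\<^sub>1 t u s - stopped T\<^sub>1 t v s))"
    using f_lip[OF R] by blast
  let ?F = "functional_coeff T\<^sub>1 f" and ?S = "\<lambda>n. signature_coeff \<sigma> c\<^sub>0 c\<^sub>1 (l n)"
  have main: "(\<exists>!y. controlled_solution \<alpha> T\<^sub>0 T\<^sub>1 ?F x w y) \<and> (\<exists>!y. controlled_solution \<alpha> T\<^sub>0 T\<^sub>1 (?S n) x w y) \<and>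
      (\<forall>y y'. controlled_solution \<alpha> T\<^sub>0 T\<^sub>1 ?F x w y \<and> controlled_solution \<alpha> T\<^sub>0 T\<^sub>1 (?S n) x w y' \<longrightarrow>
        holder_dist \<beta> T\<^sub>1 y' y \<le> gronwall_const (\<kappa> * L) \<beta> T\<^sub>1 * \<kappa> * (1 / real (Suc n)))"
    if xw: "(x, w) \<in> admissible_inputs \<alpha> T\<^sub>0 T\<^sub>1 B\<^sub>x B\<^sub>w w\<^sub>0" for x w n
  proof -
    interpret D: driven T\<^sub>0 T\<^sub>1 \<alpha> \<beta> B\<^sub>x B\<^sub>w x w
      using driven_admissible(1)[OF xw] assms \<alpha> by blast
    have w0: "w 0 = w\<^sub>0" using driven_admissible(2)[OF xw] assms \<alpha> by blast
    have \<kappa>: "D.\<kappa> = \<kappa>" by (simp add: D.\<kappa>_def \<kappa>_def)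
    have sub: "D.continued r \<subseteq> ball r" if "0 \<le> r" for r
      using D.continued_subset_holder_ball[OF that] by (simp add: ball_def w0)
    have T: "s \<in> {0..T\<^sub>1}" if "s \<in> {T\<^sub>0..T\<^sub>1}" for s using that assms by auto
    have near: "\<bar>?S n s y i j - ?F s y i j\<bar> \<le> 1 / real (Suc n)" if "y \<in> D.continued R" "s \<in> {T\<^sub>0..T\<^sub>1}" for y s i j
      using l(3) sub[OF R] T that by blast
    have le1: "1 / real (Suc n) \<le> 1" by simp
    have growthF: "\<bar>?F s y i j\<bar> \<le> C * c + C * (1 + norm w\<^sub>0)"
      if "y \<in> D.continued R" "s \<in> {T\<^sub>0..T\<^sub>1}" "0 \<le> c" "holder_upto \<beta> s c y" for y s c i j
      using D.functional_coeff_growth[OF nn(3) R C(2) that] by (simp add: w0)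
    have contF: "continuous_on {T\<^sub>0..T\<^sub>1} (\<lambda>s. ?F s y i j)" if "y \<in> holder_paths \<alpha> T\<^sub>1" for y i j
      using continuous_on_functional_coeff[OF assms(1,6,7) that f_continuous]
      by (rule continuous_on_subset) (use assms in auto)
    have contS: "continuous_on {T\<^sub>0..T\<^sub>1} (\<lambda>s. ?S n s y i j)" if "y \<in> holder_paths \<alpha> T\<^sub>1" for y i j
      using continuous_on_signature_coeff[OF assms(4) \<alpha>(2) assms(1) that c\<sigma>]
      by (rule continuous_on_subset) (use assms in auto)
    have lipF: "\<exists>L\<ge>0. \<forall>y\<in>D.continued r. \<forall>z\<in>D.continued r. \<forall>s\<in>{T\<^sub>0..T\<^sub>1}. \<forall>c\<ge>0. \<forall>i j.
        holder_upto \<beta> s c (\<lambda>t. y t - z t) \<longrightarrow> \<bar>?F s y i j - ?F s z i j\<bar> \<le> L * c" if r: "0 \<le> r" for r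
    proof -
      obtain L where L: "0 < L" "\<And>t u v. t \<in> {0..T\<^sub>1} \<Longrightarrow> u \<in> ball r \<Longrightarrow> v \<in> ball r \<Longrightarrow>
          norm (f (t, stopped T\<^sub>1 t u) - f (t, stopped T\<^sub>1 t v)) \<le>
          L * (norm (u 0 - v 0) + holder_seminorm \<beta> T\<^sub>1 (\<lambda>s. stopped T\<^sub>1 t u s - stopped T\<^sub>1 t v s))"
        using f_lip[OF r] by blast
      show ?thesis
        using D.functional_coeff_lipschitz[OF less_imp_le[OF L(1)] r, of f] L unfolding w0 ball_def
        by (intro exI[of _ L]) auto
    qed
    obtain y where y: "y \<in> D.continued R" "\<And>z. controlled_solution \<alpha> T\<^sub>0 T\<^sub>1 ?F x w z \<longleftrightarrow> z = y"
    proof -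
      have "\<exists>y \<in> D.continued (D.\<kappa> * N). \<forall>z. controlled_solution \<alpha> T\<^sub>0 T\<^sub>1 ?F x w z \<longleftrightarrow> z = y"
      proof (rule D.controlled_solution_ex1[OF nn(3,2) _ contF lipF])
        show "N = C * (gronwall_const (D.\<kappa> * C) \<beta> T\<^sub>1 * (B\<^sub>w * T\<^sub>1 powr (\<alpha> - \<beta>) + D.\<kappa> * A')) + A'"
          unfolding \<kappa> by (rule N_def)
        show "\<bar>?F s y i j\<bar> \<le> C * c + A'"
          if "y \<in> D.continued (D.\<kappa> * N)" "s \<in> {T\<^sub>0..T\<^sub>1}" "0 \<le> c" "holder_upto \<beta> s c y" for y s c i j
          using growthF[of y s c i j] that unfolding \<kappa> R_def[symmetric] A'_def by simp
      qed
      then show thesis using that unfolding \<kappa> R_def[symmetric] by blast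
    qed
    obtain y' where y': "y' \<in> D.continued R" "\<And>z. controlled_solution \<alpha> T\<^sub>0 T\<^sub>1 (?S n) x w z \<longleftrightarrow> z = y'"
    proof -
      have "\<exists>y \<in> D.continued (D.\<kappa> * N). \<forall>z. controlled_solution \<alpha> T\<^sub>0 T\<^sub>1 (?S n) x w z \<longleftrightarrow> z = y"
      proof (rule D.controlled_solution_ex1[OF nn(3,2) _ contS D.signature_coeff_lipschitz[OF assms(4) _ K]])
        show "N = C * (gronwall_const (D.\<kappa> * C) \<beta> T\<^sub>1 * (B\<^sub>w * T\<^sub>1 powr (\<alpha> - \<beta>) + D.\<kappa> * A')) + A'"
          unfolding \<kappa> by (rule N_def)
        show "\<bar>?S n s y i j\<bar> \<le> C * c + A'"
          if "y \<in> D.continued (D.\<kappa> * N)" "s \<in> {T\<^sub>0..T\<^sub>1}" "0 \<le> c" "holder_upto \<beta> s c y" for y s c i j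
        proof -
          \<comment> \<open>Membership in the ball permits comparison with \<open>f\<close>; the
            resulting error of at most \<open>1\<close> is the extra summand in
            \<open>A'\<close>.\<close>
          have yR: "y \<in> D.continued R" using that(1) unfolding \<kappa> R_def .
          show ?thesis
            using growthF[OF yR that(2-4), of i j] near[OF yR that(2), of i j] le1 unfolding A'_def by linarith
        qed
      qed
      then show thesis using that unfolding \<kappa> R_def[symmetric] by blast
    qed
    have hol: "y \<in> holder_paths \<alpha> T\<^sub>1" "y' \<in> holder_paths \<alpha> T\<^sub>1"
      using y(1) y'(1) sub[OF R] holder_ball_subset_paths unfolding ball_def by blast+
    have eqs: "y = D.driven_by (\<lambda>s. ?F s y)" "y' = D.driven_by (\<lambda>s. ?S n s y')"
      using D.controlled_solution_iff[of ?F y, OF contF[OF hol(1)]] y(2)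
        D.controlled_solution_iff[of "?S n" y', OF contS[OF hol(2)]] y'(2) by blast+
    let ?c = "gronwall_const (\<kappa> * L) \<beta> T\<^sub>1 * \<kappa> * (1 / real (Suc n))"
    have c0: "0 \<le> ?c" using nn gronwall_const_nonneg by (intro mult_nonneg_nonneg) auto
    \<comment> \<open>The signature coefficient along \<open>y'\<close> is compared with
      \<open>f\<close> along \<open>y'\<close>, at the cost of the approximation error, and then
      with \<open>f\<close> along \<open>y\<close>, at the cost of \<open>L\<close>. The Lipschitz
      constant of the signature coefficient is avoided.\<close>
    have "holder_upto \<beta> T\<^sub>1 (gronwall_const (D.\<kappa> * L) \<beta> T\<^sub>1 * (0 + D.\<kappa> * (1 / real (Suc n)))) (\<lambda>t. y' t - y t)"
    proof (rule D.stability[where G = "?S n" and G' = ?F, OF y'(1) eqs(2) y(1) eqs(1) R _ _ contS[OF hol(2)] contF[OF hol(1)]])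
      fix s c i j assume s: "s \<in> {T\<^sub>0..T\<^sub>1}" and c: "0 \<le> c" and h: "holder_upto \<beta> s c (\<lambda>t. y' t - y t)"
      have "\<bar>?F s y' i j - ?F s y i j\<bar> \<le> L * c"
        using L unfolding ball_def w0[symmetric]
        by (intro D.functional_coeff_lipschitz[OF less_imp_le[OF L(1)] R _ y'(1) y(1) s c h])
      then show "\<bar>?S n s y' i j - ?F s y i j\<bar> \<le> L * c + 1 / real (Suc n)"
        using near[OF y'(1) s, of i j] by linarith
    qed (use L(1) in auto)
    then have up: "holder_upto \<beta> T\<^sub>1 ?c (\<lambda>t. y' t - y t)" unfolding \<kappa> by (simp add: mult.assoc)
    have "holder_seminorm \<beta> T\<^sub>1 (\<lambda>t. y' t - y t) \<le> ?c"
      by (rule holder_seminorm_leI[OF _ c0]) (use up in \<open>auto simp: holder_upto_def\<close>)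
    moreover have "y' 0 = y 0" using y(1) y'(1) assms by (simp add: D.continued_iff)
    ultimately have "holder_dist \<beta> T\<^sub>1 y' y \<le> ?c" by (simp add: holder_dist_def)
    then show ?thesis unfolding y(2) y'(2) by simp
  qed
  have "\<exists>N\<ge>1. \<forall>n\<ge>N. \<forall>(x, w) \<in> admissible_inputs \<alpha> T\<^sub>0 T\<^sub>1 B\<^sub>x B\<^sub>w w\<^sub>0. \<forall>y y'.
      controlled_solution \<alpha> T\<^sub>0 T\<^sub>1 ?F x w y \<and> controlled_solution \<alpha> T\<^sub>0 T\<^sub>1 (?S n) x w y' \<longrightarrow>
      holder_dist \<beta> T\<^sub>1 y' y < \<epsilon>" if \<epsilon>: "0 < \<epsilon>" for \<epsilon>
  proof -
    let ?g = "gronwall_const (\<kappa> * L) \<beta> T\<^sub>1 * \<kappa>"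
    have g: "0 \<le> ?g" using nn gronwall_const_nonneg by (intro mult_nonneg_nonneg) auto
    obtain N :: nat where N: "?g / \<epsilon> < real N" using reals_Archimedean2 by blast
    have small: "?g * (1 / real (Suc n)) < \<epsilon>" if "Suc N \<le> n" for n
    proof -
      have "?g < \<epsilon> * real N" using N \<epsilon> by (simp add: field_simps)
      also have "\<dots> \<le> \<epsilon> * real (Suc n)" using that \<epsilon> by (intro mult_left_mono) auto
      finally show ?thesis by (simp add: field_simps)
    qed
    show ?thesis
    proof (intro exI[of _ "Suc N"] conjI allI impI ballI)
      fix n and p :: "(real \<Rightarrow> real ^ 'd) \<times> (real \<Rightarrow> real ^ 'm)"
      assume n: "Suc N \<le> n" and p: "p \<in> admissible_inputs \<alpha> T\<^sub>0 T\<^sub>1 B\<^sub>x B\<^sub>w w\<^sub>0"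
      obtain x w where xw: "p = (x, w)" by (cases p)
      show "case p of (x, w) \<Rightarrow> \<forall>y y'. controlled_solution \<alpha> T\<^sub>0 T\<^sub>1 ?F x w y \<and>
          controlled_solution \<alpha> T\<^sub>0 T\<^sub>1 (?S n) x w y' \<longrightarrow> holder_dist \<beta> T\<^sub>1 y' y < \<epsilon>"
        unfolding xw prod.case
      proof (intro allI impI)
        fix y y'
        assume "controlled_solution \<alpha> T\<^sub>0 T\<^sub>1 ?F x w y \<and> controlled_solution \<alpha> T\<^sub>0 T\<^sub>1 (?S n) x w y'"
        then have "holder_dist \<beta> T\<^sub>1 y' y \<le> ?g * (1 / real (Suc n))" using main[of x w n] p xw by blast
        then show "holder_dist \<beta> T\<^sub>1 y' y < \<epsilon>" using small[OF n] by linarith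
      qed
    qed simp
  qed
  moreover have "\<forall>(x, w) \<in> admissible_inputs \<alpha> T\<^sub>0 T\<^sub>1 B\<^sub>x B\<^sub>w w\<^sub>0.
      (\<exists>!y. controlled_solution \<alpha> T\<^sub>0 T\<^sub>1 ?F x w y) \<and> (\<forall>n\<ge>1. \<exists>!y. controlled_solution \<alpha> T\<^sub>0 T\<^sub>1 (?S n) x w y)"
    using main by blast
  ultimately show ?thesis
    by (intro exI[of _ l] exI[of _ c\<^sub>0] exI[of _ c\<^sub>1] conjI allI impI l(1,2))
qed

end
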